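(* Fix $\alpha>0$. There exist constants $C_1,C_2>0$, independent of $\Lambda$ and $\alpha$, such that for all sufficiently large ultraviolet cutoffs $\Lambda$ the ground state energy $E_0=\inf_{\Psi\neq 0}\langle\Psi,H\Psi\rangle/\langle\Psi,\Psi\rangle$ of the operator $$H=\tfrac12\big(p+\sqrt{\alpha}\,A(x)\big)^2+H_f,\qquad p=-i\nabla,$$ acting on $L^2(\mathbb{R}^3)\otimes\mathcal F$, satisfies $$C_1\,\alpha^{1/2}\Lambda^{3/2}<E_0<C_2\,\alpha^{2/7}\Lambda^{12/7}.$$
   Context: Units: energy in units of $mc^2$, length in units of $\hbar/mc$, $\alpha=e^2/\hbar c$ is the fine structure constant. The radiation field lives in a box of side $L$, volume $V=L^3$. Modes are $k\in(2\pi/L)\mathbb{Z}^3$ with $|k|<\Lambda$ (ultraviolet cutoff $\Lambda$) and polarizations $\lambda\in\{1,2\}$; $\varepsilon_\lambda(k)\in\mathbb{R}^3$ are polarization vectors with $\varepsilon_i(k)\cdot\varepsilon_j(k)=\delta_{ij}$, $\varepsilon_i(k)\cdot k=0$. $\mathcal F$ is the photon Fock space generated by polynomials in creation operators $a^*_\lambda(k)$ acting on the vacuum $|0\rangle$, with $[a_\lambda(k),a^*_{\lambda'}(k')]=\delta_{\lambda\lambda'}\delta(k,k')$ and all other pairs commuting. The quantized vector potential is $$A(x)=\frac{1}{\sqrt{2V}}\sum_{|k|<\Lambda}\sum_{\lambda=1,2}\frac{1}{\sqrt{|k|}}\varepsilon_\lambda(k)\big[a_\lambda(k)e^{ix\cdot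 k}+a^*_\lambda(k)e^{-ix\cdot k}\big],$$ and the field energy is $H_f=\sum_{|k|<\Lambda}\sum_{\lambda=1,2}|k|\,a^*_\lambda(k)a_\lambda(k)$. *)

theory Defs
  imports "HOL-Analysis.Analysis"
begin

text \<open>Photon modes: a mode is a pair (n, lam) with n in Z^3 (so k = (2 pi / L) n)
  and polarization index lam in {1,2}. Fock space for the finitely many modes is
  realised in the occupation-number basis: a configuration nu assigns to every mode
  its photon number. A state in L^2(R^3) (x) F is a function Psi x nu.\<close>

type_synonym mode = "(int \<times> int \<times> int) \<times> nat"
type_synonym config = "mode \<Rightarrow> nat"
type_synonym state = "real^3 \<Rightarrow> config \<Rightarrow> complex"

definition kvec :: "real \<Rightarrow> int \<times> int \<times> int \<Rightarrow> real^3" where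
  "kvec L n = (2 * pi / L) *\<^sub>R
      vector [real_of_int (fst n), real_of_int (fst (snd n)), real_of_int (snd (snd n))]"

text \<open>Modes with 0 < |k| < Lambda (the k = 0 mode is decoupled and irrelevant).\<close>
definition modes :: "real \<Rightarrow> real \<Rightarrow> mode set" where
  "modes L \<Lambda> = {(n, lam). lam \<in> {1, 2} \<and> 0 < norm (kvec L n) \<and> norm (kvec L n) < \<Lambda>}"

definition valid_polarization :: "real \<Rightarrow> (nat \<Rightarrow> real^3 \<Rightarrow> real^3) \<Rightarrow> bool" where
  "valid_polarization L \<epsilon> \<longleftrightarrow>
     (\<forall>n. kvec L n \<noteq> 0 \<longrightarrow>
        (\<forall>i\<in>{1,2}. \<forall>j\<in>{1,2}. \<epsilon> i (kvec L n) \<bullet> \<epsilon> j (kvec L n) = (if i = j then 1 else 0)) \<and>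
        (\<forall>i\<in>{1,2}. \<epsilon> i (kvec L n) \<bullet> kvec L n = 0))"

text \<open>Component j of the quantized vector potential A(x), acting on a Fock vector phi
  (given by its coefficients in the occupation-number basis):
  (a_m phi)(nu) = sqrt(nu_m + 1) phi(nu + e_m),  (a*_m phi)(nu) = sqrt(nu_m) phi(nu - e_m).\<close>
definition field_A ::
  "real \<Rightarrow> real \<Rightarrow> (nat \<Rightarrow> real^3 \<Rightarrow> real^3) \<Rightarrow> 3 \<Rightarrow> real^3 \<Rightarrow> (config \<Rightarrow> complex) \<Rightarrow> config \<Rightarrow> complex"
where
  "field_A L \<Lambda> \<epsilon> j x \<phi> \<nu> =
     complex_of_real (1 / sqrt (2 * L ^ 3)) *
     (\<Sum>m\<in>modes L \<Lambda>.
        complex_of_real ((1 / sqrt (norm (kvec L (fst m)))) * (\<epsilon> (snd m) (kvec L (fst m)) $ j)) *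
        (cis (x \<bullet> kvec L (fst m)) * complex_of_real (sqrt (real (\<nu> m + 1))) * \<phi> (\<nu>(m := \<nu> m + 1))
         + cis (- (x \<bullet> kvec L (fst m))) *
           (if 0 < \<nu> m then complex_of_real (sqrt (real (\<nu> m))) * \<phi> (\<nu>(m := \<nu> m - 1)) else 0)))"

definition pdiff :: "state \<Rightarrow> config \<Rightarrow> 3 \<Rightarrow> real^3 \<Rightarrow> complex" where
  "pdiff \<Psi> \<nu> j x = frechet_derivative (\<lambda>y. \<Psi> y \<nu>) (at x) (axis j 1)"

text \<open>Trial states (a form core): finitely many photon configurations (supported on the
  modes), each component C^1 with compact support.\<close>
definition admissible :: "real \<Rightarrow> real \<Rightarrow> state \<Rightarrow> bool" where
  "admissible L \<Lambda> \<Psi> \<longleftrightarrow>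
     finite {\<nu>. \<exists>x. \<Psi> x \<nu> \<noteq> 0} \<and>
     (\<forall>x \<nu>. \<Psi> x \<nu> \<noteq> 0 \<longrightarrow> (\<forall>m. m \<notin> modes L \<Lambda> \<longrightarrow> \<nu> m = 0)) \<and>
     (\<forall>\<nu>. (\<forall>x. (\<lambda>y. \<Psi> y \<nu>) differentiable (at x)) \<and>
          (\<forall>j. continuous_on UNIV (pdiff \<Psi> \<nu> j)) \<and>
          (\<exists>R. \<forall>x. R < norm x \<longrightarrow> \<Psi> x \<nu> = 0))"

definition norm_sq :: "state \<Rightarrow> real" where
  "norm_sq \<Psi> = infsum (\<lambda>\<nu>. LINT x|lborel. (cmod (\<Psi> x \<nu>))\<^sup>2) UNIV"

text \<open>Quadratic form <Psi, H Psi> with H = 1/2 (p + sqrt alpha A(x))^2 + H_f,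
  written as 1/2 sum_j || (p_j + sqrt alpha A_j) Psi ||^2 + <Psi, H_f Psi>.\<close>
definition energy_form :: "real \<Rightarrow> real \<Rightarrow> real \<Rightarrow> (nat \<Rightarrow> real^3 \<Rightarrow> real^3) \<Rightarrow> state \<Rightarrow> real" where
  "energy_form \<alpha> L \<Lambda> \<epsilon> \<Psi> =
     (1 / 2) * (\<Sum>j\<in>UNIV.
        infsum (\<lambda>\<nu>. LINT x|lborel.
           (cmod (- \<i> * pdiff \<Psi> \<nu> j x + complex_of_real (sqrt \<alpha>) * field_A L \<Lambda> \<epsilon> j x (\<Psi> x) \<nu>))\<^sup>2) UNIV)
     + infsum (\<lambda>\<nu>. (\<Sum>m\<in>modes L \<Lambda>. norm (kvec L (fst m)) * real (\<nu> m)) *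
                     (LINT x|lborel. (cmod (\<Psi> x \<nu>))\<^sup>2)) UNIV"

definition ground_state_energy :: "real \<Rightarrow> real \<Rightarrow> real \<Rightarrow> (nat \<Rightarrow> real^3 \<Rightarrow> real^3) \<Rightarrow> ereal" where
  "ground_state_energy \<alpha> L \<Lambda> \<epsilon> =
     (INF \<Psi> \<in> {\<Psi>. admissible L \<Lambda> \<Psi> \<and> norm_sq \<Psi> \<noteq> 0}. ereal (energy_form \<alpha> L \<Lambda> \<epsilon> \<Psi> / norm_sq \<Psi>))"

end

theory Submission
  imports Defs "HOL-Real_Asymp.Real_Asymp"
begin

text \<open>Lower bound: let \<open>A\<^sub>j = a(g\<^sub>j) + a\<^sup>*(g\<^sub>j)\<close> and \<open>Y\<^sub>j = a(h\<^sub>j) - a\<^sup>*(h\<^sub>j)\<close> with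
  \<open>h\<^sub>j = sqrt |k| \<epsilon>\<^sub>j exp (- i k x)\<close>. Expand \<open>0 \<le> \<Sum>\<^sub>j \<parallel>(p\<^sub>j + sqrt \<alpha> A\<^sub>j + t Y\<^sub>j) \<Psi>\<parallel>\<^sup>2\<close>. The commutator of
  \<open>A\<^sub>j\<close> and \<open>Y\<^sub>j\<close> is a scalar and yields \<open>- t sqrt (2 \<alpha> / V) N \<parallel>\<Psi>\<parallel>\<^sup>2\<close>, where \<open>N\<close> is the number of modes; the cross
  term of \<open>p\<close> and \<open>Y\<close> is a divergence because the polarizations are transversal; and \<open>\<Sum>\<^sub>j \<parallel>Y\<^sub>j \<Psi>\<parallel>\<^sup>2\<close> is at most
  \<open>N (4 H\<^sub>f + 2 \<Lambda>)\<close>. With \<open>t\<^sup>2 = 1 / (2 N)\<close> and \<open>N \<ge> c V \<Lambda>\<^sup>3\<close> the bound follows.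

  Upper bound: localize the electron in a ball of radius \<open>l = y / \<Lambda>\<close>, \<open>\<Lambda> = \<alpha> y\<^sup>7\<close>. For \<open>|x| \<le> l\<close> the Taylor polynomials
  of degree about \<open>8 y\<close> of \<open>exp (- i k x)\<close> approximate the vector potential up to an error exponentially small in \<open>y\<close>
  by smeared fields from a real space of dimension \<open>O(y\<^sup>3)\<close> on which the fields commute. A squeezed state in these
  modes reduces the field fluctuation by a factor \<open>\<delta> = 1 / (\<alpha> y\<^sup>2)\<close> at the price of \<open>O(y\<^sup>3 / \<delta>)\<close> photons. The
  kinetic energy \<open>1 / l\<^sup>2\<close>, the fluctuation \<open>\<alpha> \<Lambda>\<^sup>2 \<delta>\<close> and the field energy \<open>\<Lambda> y\<^sup>3 / \<delta>\<close> are then all of the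
  order \<open>\<alpha>\<^sup>2 y\<^sup>1\<^sup>2 = \<alpha>\<^bsup>2/7\<^esup> \<Lambda>\<^bsup>12/7\<^esup>\<close>.\<close>

section \<open>Fock vectors in the occupation-number basis\<close>

text \<open>The exponents come from a balance. In the lower bound the gain is about
  \<open>t * sqrt (\<alpha> / V) * N\<close>, but the field energy has to absorb
  \<open>4 * t\<^sup>2 * N\<close> copies of itself, so \<open>t\<close> is at most of order
  \<open>1 / sqrt N\<close>; this leaves \<open>sqrt (\<alpha> * N / V)\<close>, and the other loss,
  of order \<Lambda>, is negligible for large \<Lambda>. In the upper bound a ball of radius
  \<open>y / \<Lambda>\<close> resolves only about \<open>y ^ 3\<close> independent field modes, and
  three costs compete: \<open>\<Lambda>\<^sup>2 / y\<^sup>2\<close> for localization,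
  \<open>\<alpha> * \<Lambda>\<^sup>2 * \<delta>\<close> for the remaining fluctuation and
  \<open>\<Lambda> * y ^ 3 / \<delta>\<close> for the photons. The first two agree for
  \<open>\<delta> = 1 / (\<alpha> * y\<^sup>2)\<close>, and then all three agree exactly for
  \<open>\<Lambda> = \<alpha> * y ^ 7\<close>, which explains the sevenths. Two obstacles shape the
  construction. One state can reduce many fields at once only if these commute, so all form factors
  must lie in a space on which the inner product is real, whatever the choice of polarization
  vectors. And an exact squeezed vacuum has infinitely many configurations, whereas trial states
  have finitely many, so the state is truncated and its top component controlled.\<close>

definition Ann :: "'m \<Rightarrow> (('m \<Rightarrow> nat) \<Rightarrow> complex) \<Rightarrow> ('m \<Rightarrow> nat) \<Rightarrow> complex" where
  "Ann m \<phi> \<nu> = complex_of_real (sqrt (real (\<nu> m + 1))) * \<phi> (\<nu>(m := \<nu> m + 1))"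

definition Cre :: "'m \<Rightarrow> (('m \<Rightarrow> nat) \<Rightarrow> complex) \<Rightarrow> ('m \<Rightarrow> nat) \<Rightarrow> complex" where
  "Cre m \<phi> \<nu> = (if 0 < \<nu> m then complex_of_real (sqrt (real (\<nu> m))) * \<phi> (\<nu>(m := \<nu> m - 1)) else 0)"

definition supp :: "('c \<Rightarrow> complex) \<Rightarrow> 'c set" where
  "supp \<phi> = {\<nu>. \<phi> \<nu> \<noteq> 0}"

text \<open>The sum runs over the support of the left argument. The form is therefore linear on the
  right without any finiteness assumption, while the rules for the left argument and for conjugation
  ask for finite supports; an infinite support yields the default value 0.\<close>

definition ip :: "('c \<Rightarrow> complex) \<Rightarrow> ('c \<Rightarrow> complex) \<Rightarrow> complex" where
  "ip \<phi> \<psi> = (\<Sum>\<nu>\<in>supp \<phi>. cnj (\<phi> \<nu>) * \<psi> \<nu>)"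

definition nsq :: "('c \<Rightarrow> complex) \<Rightarrow> real" where
  "nsq \<phi> = (\<Sum>\<nu>\<in>supp \<phi>. (cmod (\<phi> \<nu>))\<^sup>2)"

lemma ip_eq_sum:
  assumes "finite S" "supp \<phi> \<subseteq> S"
  shows "ip \<phi> \<psi> = (\<Sum>\<nu>\<in>S. cnj (\<phi> \<nu>) * \<psi> \<nu>)"
  unfolding ip_def using assms by (intro sum.mono_neutral_left) (auto simp: supp_def)

lemma nsq_eq_sum:
  assumes "finite S" "supp \<phi> \<subseteq> S"
  shows "nsq \<phi> = (\<Sum>\<nu>\<in>S. (cmod (\<phi> \<nu>))\<^sup>2)"
  unfolding nsq_def using assms by (intro sum.mono_neutral_left) (auto simp: supp_def)

lemma nsq_nonneg: "0 \<le> nsq \<phi>"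
  by (simp add: nsq_def sum_nonneg)

lemma ip_self: "ip \<phi> \<phi> = complex_of_real (nsq \<phi>)"
  unfolding ip_def nsq_def of_real_sum
  by (intro sum.cong refl) (metis complex_norm_square mult.commute of_real_power)

lemma supp_add: "supp (\<lambda>\<nu>. \<phi> \<nu> + \<psi> \<nu>) \<subseteq> supp \<phi> \<union> supp \<psi>"
  and supp_diff: "supp (\<lambda>\<nu>. \<phi> \<nu> - \<psi> \<nu>) \<subseteq> supp \<phi> \<union> supp \<psi>"
  and supp_scale: "supp (\<lambda>\<nu>. c * \<phi> \<nu>) \<subseteq> supp \<phi>"
  by (auto simp: supp_def)

lemma finite_supp_zero [simp]: "finite (supp (\<lambda>\<nu>. 0))"
  by (simp add: supp_def)

lemma finite_supp_add [intro]: "finite (supp \<phi>) \<Longrightarrow> finite (supp \<psi>) \<Longrightarrow> finite (supp (\<lambda>\<nu>. \<phi> \<nu> + \<psi> \<nu>))"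
  by (rule finite_subset[OF supp_add]) auto

lemma finite_supp_diff [intro]: "finite (supp \<phi>) \<Longrightarrow> finite (supp \<psi>) \<Longrightarrow> finite (supp (\<lambda>\<nu>. \<phi> \<nu> - \<psi> \<nu>))"
  by (rule finite_subset[OF supp_diff]) auto

lemma finite_supp_scale [intro]: "finite (supp \<phi>) \<Longrightarrow> finite (supp (\<lambda>\<nu>. c * \<phi> \<nu>))"
  by (rule finite_subset[OF supp_scale])

lemma finite_supp_sum [intro]:
  "(\<And>i. i \<in> I \<Longrightarrow> finite (supp (f i))) \<Longrightarrow> finite (supp (\<lambda>\<nu>. \<Sum>i\<in>I. f i \<nu>))"
  by (induction I rule: infinite_finite_induct) auto

lemma ip_add_left:
  assumes "finite (supp \<phi>)" "finite (supp \<psi>)"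
  shows "ip (\<lambda>\<nu>. \<phi> \<nu> + \<psi> \<nu>) \<omega> = ip \<phi> \<omega> + ip \<psi> \<omega>"
  using assms supp_add[of \<phi> \<psi>]
  by (simp add: ip_eq_sum[where S = "supp \<phi> \<union> supp \<psi>"] sum.distrib algebra_simps)

lemma ip_scale_left:
  assumes "finite (supp \<phi>)"
  shows "ip (\<lambda>\<nu>. c * \<phi> \<nu>) \<omega> = cnj c * ip \<phi> \<omega>"
  using assms supp_scale[of c \<phi>]
  by (simp add: ip_eq_sum[where S = "supp \<phi>"] sum_distrib_left algebra_simps)

lemma ip_add_right: "ip \<omega> (\<lambda>\<nu>. \<phi> \<nu> + \<psi> \<nu>) = ip \<omega> \<phi> + ip \<omega> \<psi>"
  by (simp add: ip_def sum.distrib algebra_simps)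

lemma ip_diff_right: "ip \<omega> (\<lambda>\<nu>. \<phi> \<nu> - \<psi> \<nu>) = ip \<omega> \<phi> - ip \<omega> \<psi>"
  by (simp add: ip_def sum_subtractf algebra_simps)

lemma ip_scale_right: "ip \<omega> (\<lambda>\<nu>. c * \<phi> \<nu>) = c * ip \<omega> \<phi>"
  by (simp add: ip_def sum_distrib_left algebra_simps)

lemma ip_sum_right: "ip \<omega> (\<lambda>\<nu>. \<Sum>i\<in>I. f i \<nu>) = (\<Sum>i\<in>I. ip \<omega> (f i))"
  unfolding ip_def by (simp add: sum_distrib_left) (rule sum.swap)

lemma ip_sum_left:
  assumes "\<And>i. i \<in> I \<Longrightarrow> finite (supp (f i))"
  shows "ip (\<lambda>\<nu>. \<Sum>i\<in>I. f i \<nu>) \<omega> = (\<Sum>i\<in>I. ip (f i) \<omega>)"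
  using assms
proof (induction I rule: infinite_finite_induct)
  case (insert i I)
  have "finite (supp (\<lambda>\<nu>. \<Sum>i\<in>I. f i \<nu>))" using insert by auto
  with insert show ?case by (simp add: ip_add_left)
qed (auto simp: ip_def supp_def)

lemma ip_cnj:
  assumes "finite (supp \<phi>)" "finite (supp \<psi>)"
  shows "cnj (ip \<phi> \<psi>) = ip \<psi> \<phi>"
  using assms
  by (simp add: ip_eq_sum[where S = "supp \<phi> \<union> supp \<psi>"] algebra_simps)

lemma nsq_add:
  assumes "finite (supp \<phi>)" "finite (supp \<psi>)"
  shows "nsq (\<lambda>\<nu>. \<phi> \<nu> + \<psi> \<nu>) = nsq \<phi> + 2 * Re (ip \<phi> \<psi>) + nsq \<psi>"
proof -
  have "complex_of_real (nsq (\<lambda>\<nu>. \<phi> \<nu> + \<psi> \<nu>)) = ip (\<lambda>\<nu>. \<phi> \<nu> + \<psi> \<nu>) (\<lambda>\<nu>. \<phi> \<nu> + \<psi> \<nu>)"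
    by (simp add: ip_self)
  also have "\<dots> = of_real (nsq \<phi>) + ip \<phi> \<psi> + cnj (ip \<phi> \<psi>) + of_real (nsq \<psi>)"
    using assms by (simp add: ip_add_left ip_add_right ip_self ip_cnj)
  finally have "Re (complex_of_real (nsq (\<lambda>\<nu>. \<phi> \<nu> + \<psi> \<nu>))) = Re (of_real (nsq \<phi>) + ip \<phi> \<psi> + cnj (ip \<phi> \<psi>) + of_real (nsq \<psi>))"
    by simp
  then show ?thesis by simp
qed

lemma nsq_scale:
  assumes "finite (supp \<phi>)"
  shows "nsq (\<lambda>\<nu>. c * \<phi> \<nu>) = (cmod c)\<^sup>2 * nsq \<phi>"
  using assms supp_scale[of c \<phi>]
  by (simp add: nsq_eq_sum[where S = "supp \<phi>"] sum_distrib_left norm_mult power_mult_distrib)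

lemma nsq_add_le:
  assumes "finite (supp \<phi>)" "finite (supp \<psi>)"
  shows "nsq (\<lambda>\<nu>. \<phi> \<nu> + \<psi> \<nu>) \<le> 2 * nsq \<phi> + 2 * nsq \<psi>"
proof -
  have "(cmod (a + b))\<^sup>2 \<le> 2 * (cmod a)\<^sup>2 + 2 * (cmod b)\<^sup>2" for a b
  proof -
    have "(cmod (a + b))\<^sup>2 \<le> (cmod a + cmod b)\<^sup>2"
      by (intro power_mono norm_triangle_ineq) auto
    also have "\<dots> \<le> 2 * (cmod a)\<^sup>2 + 2 * (cmod b)\<^sup>2"
      using sum_squares_bound[of "cmod a" "cmod b"] by (simp add: power2_sum)
    finally show ?thesis .
  qed
  then have "(\<Sum>\<nu>\<in>supp \<phi> \<union> supp \<psi>. (cmod (\<phi> \<nu> + \<psi> \<nu>))\<^sup>2) \<le>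
     (\<Sum>\<nu>\<in>supp \<phi> \<union> supp \<psi>. 2 * (cmod (\<phi> \<nu>))\<^sup>2 + 2 * (cmod (\<psi> \<nu>))\<^sup>2)"
    by (intro sum_mono)
  then show ?thesis using assms supp_add[of \<phi> \<psi>]
    by (simp add: nsq_eq_sum[where S = "supp \<phi> \<union> supp \<psi>"] sum.distrib sum_distrib_left)
qed

text \<open>Cauchy-Schwarz at each configuration, with every summand split into
  \<open>c i / sqrt (w i)\<close> and \<open>sqrt (w i) * f i \<nu>\<close>. Applied to annihilation
  operators, the weight \<open>|k|\<close> produces the field energy and the weight 1 the photon
  number.\<close>

lemma nsq_sum_le:
  assumes "finite I" "\<And>i. i \<in> I \<Longrightarrow> finite (supp (f i))" "\<And>i. i \<in> I \<Longrightarrow> 0 < w i"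
  shows "nsq (\<lambda>\<nu>. \<Sum>i\<in>I. c i * f i \<nu>) \<le> (\<Sum>i\<in>I. (cmod (c i))\<^sup>2 / w i) * (\<Sum>i\<in>I. w i * nsq (f i))"
proof -
  define S where "S = (\<Union>i\<in>I. supp (f i))"
  have S: "finite S" using assms by (simp add: S_def)
  have sub: "supp (\<lambda>\<nu>. \<Sum>i\<in>I. c i * f i \<nu>) \<subseteq> S"
  proof
    fix \<nu> assume "\<nu> \<in> supp (\<lambda>\<nu>. \<Sum>i\<in>I. c i * f i \<nu>)"
    then obtain i where "i \<in> I" "c i * f i \<nu> \<noteq> 0"
      unfolding supp_def by (metis (mono_tags, lifting) mem_Collect_eq sum.neutral)
    then show "\<nu> \<in> S" by (auto simp: S_def supp_def)
  qed
  have *: "(cmod (\<Sum>i\<in>I. c i * f i \<nu>))\<^sup>2 \<le> (\<Sum>i\<in>I. (cmod (c i))\<^sup>2 / w i) * (\<Sum>i\<in>I. w i * (cmod (f i \<nu>))\<^sup>2)" for \<nu>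
  proof -
    have "(cmod (\<Sum>i\<in>I. c i * f i \<nu>))\<^sup>2 \<le> (\<Sum>i\<in>I. (cmod (c i) / sqrt (w i)) * (sqrt (w i) * cmod (f i \<nu>)))\<^sup>2"
    proof (intro power_mono)
      have "cmod (\<Sum>i\<in>I. c i * f i \<nu>) \<le> (\<Sum>i\<in>I. cmod (c i * f i \<nu>))" by (rule norm_sum)
      also have "\<dots> = (\<Sum>i\<in>I. (cmod (c i) / sqrt (w i)) * (sqrt (w i) * cmod (f i \<nu>)))"
        using assms(3) by (intro sum.cong) (auto simp: norm_mult order_less_imp_not_eq2)
      finally show "cmod (\<Sum>i\<in>I. c i * f i \<nu>) \<le> \<dots>" .
    qed auto
    also have "\<dots> \<le> (\<Sum>i\<in>I. (cmod (c i) / sqrt (w i))\<^sup>2) * (\<Sum>i\<in>I. (sqrt (w i) * cmod (f i \<nu>))\<^sup>2)"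
      by (rule Cauchy_Schwarz_ineq_sum)
    also have "(\<Sum>i\<in>I. (cmod (c i) / sqrt (w i))\<^sup>2) = (\<Sum>i\<in>I. (cmod (c i))\<^sup>2 / w i)"
      using assms(3) by (intro sum.cong) (auto simp: power_divide less_imp_le)
    also have "(\<Sum>i\<in>I. (sqrt (w i) * cmod (f i \<nu>))\<^sup>2) = (\<Sum>i\<in>I. w i * (cmod (f i \<nu>))\<^sup>2)"
      using assms(3) by (intro sum.cong) (auto simp: power_mult_distrib less_imp_le)
    finally show ?thesis .
  qed
  have "nsq (\<lambda>\<nu>. \<Sum>i\<in>I. c i * f i \<nu>) = (\<Sum>\<nu>\<in>S. (cmod (\<Sum>i\<in>I. c i * f i \<nu>))\<^sup>2)"
    using nsq_eq_sum[OF S sub] .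
  also have "\<dots> \<le> (\<Sum>\<nu>\<in>S. (\<Sum>i\<in>I. (cmod (c i))\<^sup>2 / w i) * (\<Sum>i\<in>I. w i * (cmod (f i \<nu>))\<^sup>2))"
    by (intro sum_mono *)
  also have "\<dots> = (\<Sum>i\<in>I. (cmod (c i))\<^sup>2 / w i) * (\<Sum>i\<in>I. w i * (\<Sum>\<nu>\<in>S. (cmod (f i \<nu>))\<^sup>2))"
    unfolding sum_distrib_left[symmetric] by (subst sum.swap) (simp add: sum_distrib_left)
  also have "(\<Sum>i\<in>I. w i * (\<Sum>\<nu>\<in>S. (cmod (f i \<nu>))\<^sup>2)) = (\<Sum>i\<in>I. w i * nsq (f i))"
  proof (intro sum.cong refl)
    fix i assume "i \<in> I"
    then have "supp (f i) \<subseteq> S" by (auto simp: S_def)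
    then show "w i * (\<Sum>\<nu>\<in>S. (cmod (f i \<nu>))\<^sup>2) = w i * nsq (f i)"
      using nsq_eq_sum[OF S, of "f i"] by simp
  qed
  finally show ?thesis .
qed

section \<open>Ladder operators: supports, adjointness and commutation relations\<close>

lemma supp_Ann: "supp (Ann m \<phi>) \<subseteq> (\<lambda>\<nu>. \<nu>(m := \<nu> m - 1)) ` supp \<phi>"
proof
  fix \<nu> assume "\<nu> \<in> supp (Ann m \<phi>)"
  then have "\<nu>(m := \<nu> m + 1) \<in> supp \<phi>" by (auto simp: supp_def Ann_def)
  moreover have "\<nu> = (\<lambda>\<nu>. \<nu>(m := \<nu> m - 1)) (\<nu>(m := \<nu> m + 1))" by simp
  ultimately show "\<nu> \<in> (\<lambda>\<nu>. \<nu>(m := \<nu> m - 1)) ` supp \<phi>" by blast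
qed

lemma supp_Cre: "supp (Cre m \<phi>) \<subseteq> (\<lambda>\<nu>. \<nu>(m := \<nu> m + 1)) ` supp \<phi>"
proof
  fix \<nu> assume *: "\<nu> \<in> supp (Cre m \<phi>)"
  then have pos: "0 < \<nu> m" by (auto simp: supp_def Cre_def split: if_splits)
  from * have "\<nu>(m := \<nu> m - 1) \<in> supp \<phi>" by (auto simp: supp_def Cre_def split: if_splits)
  moreover have "\<nu> = (\<lambda>\<nu>. \<nu>(m := \<nu> m + 1)) (\<nu>(m := \<nu> m - 1))" using pos by simp
  ultimately show "\<nu> \<in> (\<lambda>\<nu>. \<nu>(m := \<nu> m + 1)) ` supp \<phi>" by blast
qed

lemma finite_supp_Ann [intro]: "finite (supp \<phi>) \<Longrightarrow> finite (supp (Ann m \<phi>))"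
  by (rule finite_subset[OF supp_Ann]) auto

lemma finite_supp_Cre [intro]: "finite (supp \<phi>) \<Longrightarrow> finite (supp (Cre m \<phi>))"
  by (rule finite_subset[OF supp_Cre]) auto

text \<open>Configurations without a photon in mode \<open>m\<close> drop out on the right, because
  \<open>Cre m\<close> vanishes there; removing one photon is a bijection from the others onto the
  support of \<open>Ann m \<phi>\<close>.\<close>

lemma ip_Ann_left:
  assumes "finite (supp \<phi>)"
  shows "ip (Ann m \<phi>) \<psi> = ip \<phi> (Cre m \<psi>)"
proof -
  define T where "T = supp \<phi> \<inter> {\<nu>. 0 < \<nu> m}"
  have "ip \<phi> (Cre m \<psi>) = (\<Sum>\<nu>\<in>T. cnj (\<phi> \<nu>) * Cre m \<psi> \<nu>)"
    unfolding ip_def T_def using assms by (intro sum.mono_neutral_right) (auto simp: Cre_def)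
  also have "\<dots> = (\<Sum>\<nu>\<in>supp (Ann m \<phi>). cnj (Ann m \<phi> \<nu>) * \<psi> \<nu>)"
    by (rule sum.reindex_bij_witness[where i = "\<lambda>\<nu>. \<nu>(m := \<nu> m + 1)" and j = "\<lambda>\<nu>. \<nu>(m := \<nu> m - 1)"])
      (auto simp: T_def supp_def Ann_def Cre_def)
  finally show ?thesis by (simp add: ip_def)
qed

text \<open>For \<open>m = n\<close> both products are multiplications, by
  \<open>\<nu> n + 1\<close> and by \<open>\<nu> n\<close>; for distinct modes the two updates of
  the configuration commute.\<close>

lemma Ann_Cre: "Ann m (Cre n \<phi>) \<nu> = Cre n (Ann m \<phi>) \<nu> + (if m = n then \<phi> \<nu> else 0)"
proof (cases "m = n")
  case True
  have "complex_of_real (sqrt (real k)) * (complex_of_real (sqrt (real k)) * z) = of_nat k * z" for k z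
    by (metis abs_of_nat mult.assoc of_real_mult of_real_of_nat_eq real_sqrt_mult_self)
  note s = this
  have "Ann n (Cre n \<phi>) \<nu> = of_nat (\<nu> n + 1) * \<phi> \<nu>"
    using s[of "\<nu> n + 1" "\<phi> \<nu>"] by (simp add: Ann_def Cre_def del: of_nat_add of_nat_Suc)
  moreover have "Cre n (Ann n \<phi>) \<nu> = of_nat (\<nu> n) * \<phi> \<nu>"
    using s[of "\<nu> n" "\<phi> \<nu>"] by (auto simp: Ann_def Cre_def)
  ultimately show ?thesis using True by (simp add: algebra_simps)
next
  case False
  then show ?thesis by (auto simp: Ann_def Cre_def fun_upd_twist algebra_simps)
qed

lemma Cre_Cre: "Cre m (Cre n \<phi>) \<nu> = Cre n (Cre m \<phi>) \<nu>"
  by (cases "m = n") (auto simp: Cre_def fun_upd_twist algebra_simps)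

lemma Ann_scale: "Ann m (\<lambda>\<nu>. c * \<phi> \<nu>) = (\<lambda>\<nu>. c * Ann m \<phi> \<nu>)"
  and Cre_add: "Cre m (\<lambda>\<nu>. \<phi> \<nu> + \<psi> \<nu>) = (\<lambda>\<nu>. Cre m \<phi> \<nu> + Cre m \<psi> \<nu>)"
  and Cre_scale: "Cre m (\<lambda>\<nu>. c * \<phi> \<nu>) = (\<lambda>\<nu>. c * Cre m \<phi> \<nu>)"
  and Ann_sum: "Ann m (\<lambda>\<nu>. \<Sum>i\<in>I. f i \<nu>) = (\<lambda>\<nu>. \<Sum>i\<in>I. Ann m (f i) \<nu>)"
  and Cre_sum: "Cre m (\<lambda>\<nu>. \<Sum>i\<in>I. f i \<nu>) = (\<lambda>\<nu>. \<Sum>i\<in>I. Cre m (f i) \<nu>)"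
  by (auto simp: Ann_def Cre_def algebra_simps sum_distrib_left fun_eq_iff)

section \<open>Smeared annihilation and creation operators\<close>

definition aop :: "'m set \<Rightarrow> ('m \<Rightarrow> complex) \<Rightarrow> (('m \<Rightarrow> nat) \<Rightarrow> complex) \<Rightarrow> ('m \<Rightarrow> nat) \<Rightarrow> complex" where
  "aop M f \<phi> \<nu> = (\<Sum>m\<in>M. cnj (f m) * Ann m \<phi> \<nu>)"

definition cop :: "'m set \<Rightarrow> ('m \<Rightarrow> complex) \<Rightarrow> (('m \<Rightarrow> nat) \<Rightarrow> complex) \<Rightarrow> ('m \<Rightarrow> nat) \<Rightarrow> complex" where
  "cop M f \<phi> \<nu> = (\<Sum>m\<in>M. f m * Cre m \<phi> \<nu>)"

definition mip :: "'m set \<Rightarrow> ('m \<Rightarrow> complex) \<Rightarrow> ('m \<Rightarrow> complex) \<Rightarrow> complex" where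
  "mip M f g = (\<Sum>m\<in>M. cnj (f m) * g m)"

definition mnsq :: "'m set \<Rightarrow> ('m \<Rightarrow> complex) \<Rightarrow> real" where
  "mnsq M f = (\<Sum>m\<in>M. (cmod (f m))\<^sup>2)"

lemma mip_self: "mip M f f = complex_of_real (mnsq M f)"
  unfolding mip_def mnsq_def of_real_sum
  by (intro sum.cong refl) (metis complex_norm_square mult.commute of_real_power)

lemma mip_cnj: "cnj (mip M f g) = mip M g f"
  by (simp add: mip_def algebra_simps)

lemma mnsq_nonneg: "0 \<le> mnsq M f"
  by (simp add: mnsq_def sum_nonneg)

lemma finite_supp_aop [intro]: "finite (supp \<phi>) \<Longrightarrow> finite (supp (aop M f \<phi>))"
  unfolding aop_def[abs_def] by (intro finite_supp_sum finite_supp_scale finite_supp_Ann)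

lemma finite_supp_cop [intro]: "finite (supp \<phi>) \<Longrightarrow> finite (supp (cop M f \<phi>))"
  unfolding cop_def[abs_def] by (intro finite_supp_sum finite_supp_scale finite_supp_Cre)

lemma ip_aop_left:
  assumes "finite (supp \<phi>)"
  shows "ip (aop M f \<phi>) \<psi> = ip \<phi> (cop M f \<psi>)"
proof -
  have "ip (aop M f \<phi>) \<psi> = (\<Sum>m\<in>M. ip (\<lambda>\<nu>. cnj (f m) * Ann m \<phi> \<nu>) \<psi>)"
    unfolding aop_def[abs_def] using assms by (intro ip_sum_left) auto
  also have "\<dots> = (\<Sum>m\<in>M. f m * ip \<phi> (Cre m \<psi>))"
    using assms by (intro sum.cong refl) (simp add: ip_scale_left ip_Ann_left finite_supp_Ann)
  also have "\<dots> = ip \<phi> (cop M f \<psi>)"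
    unfolding cop_def[abs_def] by (simp add: ip_sum_right ip_scale_right)
  finally show ?thesis .
qed

lemma ip_cop_left:
  assumes "finite (supp \<phi>)" "finite (supp \<psi>)"
  shows "ip (cop M f \<phi>) \<psi> = ip \<phi> (aop M f \<psi>)"
  using assms by (metis finite_supp_aop finite_supp_cop ip_aop_left ip_cnj)

lemma aop_cop:
  assumes "finite M"
  shows "aop M f (cop M g \<phi>) \<nu> = cop M g (aop M f \<phi>) \<nu> + mip M f g * \<phi> \<nu>"
proof -
  have "aop M f (cop M g \<phi>) \<nu> = (\<Sum>m\<in>M. \<Sum>n\<in>M. cnj (f m) * (g n * Ann m (Cre n \<phi>) \<nu>))"
    unfolding aop_def cop_def[abs_def] by (simp add: Ann_sum Ann_scale sum_distrib_left)
  also have "\<dots> = (\<Sum>m\<in>M. \<Sum>n\<in>M. cnj (f m) * (g n * Cre n (Ann m \<phi>) \<nu>)) +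
      (\<Sum>m\<in>M. \<Sum>n\<in>M. if m = n then cnj (f m) * g n * \<phi> \<nu> else 0)"
    unfolding sum.distrib[symmetric] by (intro sum.cong refl) (auto simp: Ann_Cre algebra_simps)
  also have "(\<Sum>m\<in>M. \<Sum>n\<in>M. cnj (f m) * (g n * Cre n (Ann m \<phi>) \<nu>)) = cop M g (aop M f \<phi>) \<nu>"
    unfolding cop_def aop_def[abs_def]
    by (subst sum.swap) (simp add: Cre_sum Cre_scale sum_distrib_left algebra_simps)
  also have "(\<Sum>m\<in>M. \<Sum>n\<in>M. if m = n then cnj (f m) * g n * \<phi> \<nu> else 0) = mip M f g * \<phi> \<nu>"
    using assms by (simp add: mip_def sum_distrib_right)
  finally show ?thesis .
qed

lemma cop_cop: "cop M f (cop M g \<phi>) = cop M g (cop M f \<phi>)"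
proof
  fix \<nu>
  have "cop M f (cop M g \<phi>) \<nu> = (\<Sum>m\<in>M. \<Sum>n\<in>M. f m * (g n * Cre m (Cre n \<phi>) \<nu>))"
    by (simp add: cop_def[abs_def] Cre_sum Cre_scale sum_distrib_left)
  also have "\<dots> = (\<Sum>n\<in>M. \<Sum>m\<in>M. g n * (f m * Cre n (Cre m \<phi>) \<nu>))"
    by (subst sum.swap) (simp add: Cre_Cre algebra_simps)
  also have "\<dots> = cop M g (cop M f \<phi>) \<nu>"
    by (simp add: cop_def[abs_def] Cre_sum Cre_scale sum_distrib_left)
  finally show "cop M f (cop M g \<phi>) \<nu> = cop M g (cop M f \<phi>) \<nu>" .
qed

lemma aop_scale: "aop M f (\<lambda>\<nu>. c * \<phi> \<nu>) = (\<lambda>\<nu>. c * aop M f \<phi> \<nu>)"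
  and cop_add: "cop M f (\<lambda>\<nu>. \<phi> \<nu> + \<psi> \<nu>) = (\<lambda>\<nu>. cop M f \<phi> \<nu> + cop M f \<psi> \<nu>)"
  and cop_scale: "cop M f (\<lambda>\<nu>. c * \<phi> \<nu>) = (\<lambda>\<nu>. c * cop M f \<phi> \<nu>)"
  by (auto simp: aop_def cop_def Ann_scale Cre_add Cre_scale algebra_simps
      sum.distrib sum_distrib_left fun_eq_iff)

lemma aop_sum: "aop M f (\<lambda>\<nu>. \<Sum>i\<in>I. F i \<nu>) = (\<lambda>\<nu>. \<Sum>i\<in>I. aop M f (F i) \<nu>)"
  and cop_sum: "cop M f (\<lambda>\<nu>. \<Sum>i\<in>I. F i \<nu>) = (\<lambda>\<nu>. \<Sum>i\<in>I. cop M f (F i) \<nu>)"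
  unfolding aop_def cop_def Ann_sum Cre_sum sum_distrib_left by (intro ext, rule sum.swap)+

text \<open>Moving one \<open>cop\<close> to the other side of the inner product and commuting it
  past the second leaves the scalar \<open>mip M f f\<close>.\<close>

lemma nsq_cop:
  assumes "finite M" "finite (supp \<phi>)"
  shows "nsq (cop M f \<phi>) = nsq (aop M f \<phi>) + mnsq M f * nsq \<phi>"
proof -
  have "complex_of_real (nsq (cop M f \<phi>)) = ip \<phi> (aop M f (cop M f \<phi>))"
    using assms by (metis finite_supp_cop ip_cop_left ip_self)
  also have "aop M f (cop M f \<phi>) = (\<lambda>\<nu>. cop M f (aop M f \<phi>) \<nu> + mip M f f * \<phi> \<nu>)"
    using assms by (auto simp: aop_cop)
  also have "ip \<phi> \<dots> = complex_of_real (nsq (aop M f \<phi>) + mnsq M f * nsq \<phi>)"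
    using assms by (simp add: ip_add_right ip_scale_right ip_aop_left[symmetric] ip_self mip_self)
  finally show ?thesis by (simp only: of_real_eq_iff)
qed

lemma nsq_aop_le:
  assumes "finite M" "finite (supp \<phi>)" "\<And>m. m \<in> M \<Longrightarrow> 0 < w m"
  shows "nsq (aop M f \<phi>) \<le> (\<Sum>m\<in>M. (cmod (f m))\<^sup>2 / w m) * (\<Sum>m\<in>M. w m * nsq (Ann m \<phi>))"
  unfolding aop_def[abs_def]
  using nsq_sum_le[of M "\<lambda>m. Ann m \<phi>" w "\<lambda>m. cnj (f m)"] assms by auto

text \<open>\<open>Cre m (Ann m \<phi>)\<close> is multiplication by the occupation number
  \<open>\<nu> m\<close>. This converts the field energy, defined by occupation numbers, into norms
  of annihilated vectors.\<close>

lemma nsq_Ann: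
  assumes "finite S" "supp \<phi> \<subseteq> S"
  shows "nsq (Ann m \<phi>) = (\<Sum>\<nu>\<in>S. real (\<nu> m) * (cmod (\<phi> \<nu>))\<^sup>2)"
proof -
  have fs: "finite (supp \<phi>)" using assms finite_subset by blast
  have s: "complex_of_real (sqrt (real k)) * (complex_of_real (sqrt (real k)) * z) = of_nat k * z" for k z
    by (metis abs_of_nat mult.assoc of_real_mult of_real_of_nat_eq real_sqrt_mult_self)
  have c: "Cre m (Ann m \<phi>) \<nu> = of_nat (\<nu> m) * \<phi> \<nu>" for \<nu>
    using s[of "\<nu> m"] by (auto simp: Cre_def Ann_def)
  have "complex_of_real (nsq (Ann m \<phi>)) = ip \<phi> (Cre m (Ann m \<phi>))"
    using fs by (simp add: ip_self[symmetric] ip_Ann_left)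
  also have "\<dots> = (\<Sum>\<nu>\<in>S. cnj (\<phi> \<nu>) * (of_nat (\<nu> m) * \<phi> \<nu>))"
    by (simp add: ip_eq_sum[OF assms] c)
  also have "\<dots> = complex_of_real (\<Sum>\<nu>\<in>S. real (\<nu> m) * (cmod (\<phi> \<nu>))\<^sup>2)"
    unfolding of_real_sum
    by (intro sum.cong refl) (simp add: complex_norm_square mult_ac del: of_real_power)
  finally show ?thesis by (simp only: of_real_eq_iff)
qed

section \<open>Squeezed states\<close>

text \<open>The sector of exactly \<open>k\<close> photons, all of them in modes of
  \<open>M\<close>. Vectors of different sectors have disjoint supports, a strong form of
  orthogonality that is used pointwise in the configuration.\<close>

definition hom :: "'m set \<Rightarrow> nat \<Rightarrow> (('m \<Rightarrow> nat) \<Rightarrow> complex) \<Rightarrow> bool" where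
  "hom M k \<phi> \<longleftrightarrow> (\<forall>\<nu>. \<phi> \<nu> \<noteq> 0 \<longrightarrow> (\<Sum>m\<in>M. \<nu> m) = k \<and> (\<forall>m. m \<notin> M \<longrightarrow> \<nu> m = 0))"

lemma hom_sum: "(\<And>i. i \<in> I \<Longrightarrow> hom M k (F i)) \<Longrightarrow> hom M k (\<lambda>\<nu>. \<Sum>i\<in>I. c i * F i \<nu>)"
  unfolding hom_def by (metis (no_types, lifting) mult_zero_right sum.neutral)

lemma hom_Cre:
  assumes "finite M" "m \<in> M" "hom M k \<phi>"
  shows "hom M (Suc k) (Cre m \<phi>)"
  unfolding hom_def
proof (intro allI impI)
  fix \<nu> assume ne: "Cre m \<phi> \<nu> \<noteq> 0"
  then have pos: "0 < \<nu> m" by (auto simp: Cre_def split: if_splits)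
  from ne have "\<phi> (\<nu>(m := \<nu> m - 1)) \<noteq> 0" by (auto simp: Cre_def split: if_splits)
  with assms have a: "(\<Sum>n\<in>M. (\<nu>(m := \<nu> m - 1)) n) = k" and b: "\<And>n. n \<notin> M \<Longrightarrow> (\<nu>(m := \<nu> m - 1)) n = 0"
    unfolding hom_def by blast+
  have "(\<Sum>n\<in>M. \<nu> n) = \<nu> m + (\<Sum>n\<in>M - {m}. \<nu> n)"
    using assms by (simp add: sum.remove)
  moreover have "(\<Sum>n\<in>M. (\<nu>(m := \<nu> m - 1)) n) = (\<nu> m - 1) + (\<Sum>n\<in>M - {m}. \<nu> n)"
    using assms by (simp add: sum.remove)
  moreover have "\<nu> n = 0" if "n \<notin> M" for n using b[OF that] assms(2) that by (auto split: if_splits)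
  ultimately show "(\<Sum>n\<in>M. \<nu> n) = Suc k \<and> (\<forall>n. n \<notin> M \<longrightarrow> \<nu> n = 0)"
    using a pos by auto
qed

lemma hom_cop: "finite M \<Longrightarrow> hom M k \<phi> \<Longrightarrow> hom M (Suc k) (cop M g \<phi>)"
  unfolding cop_def[abs_def] by (intro hom_sum hom_Cre)

text \<open>At a given configuration at most one summand is nonzero, since the total photon number
  determines \<open>k i\<close> and hence \<open>i\<close>; cross terms never arise.\<close>

lemma cmod_sq_sum_hom:
  assumes "finite I" "inj_on k I" "\<And>i. i \<in> I \<Longrightarrow> hom M (k i) (F i)"
  shows "(cmod (\<Sum>i\<in>I. c i * F i \<nu>))\<^sup>2 = (\<Sum>i\<in>I. (cmod (c i))\<^sup>2 * (cmod (F i \<nu>))\<^sup>2)"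
proof (cases "\<exists>i\<in>I. F i \<nu> \<noteq> 0")
  case True
  then obtain i where i: "i \<in> I" "F i \<nu> \<noteq> 0" by blast
  have z: "F j \<nu> = 0" if j: "j \<in> I" "j \<noteq> i" for j
  proof (rule ccontr)
    assume "F j \<nu> \<noteq> 0"
    then have "k j = k i" using assms(3)[OF i(1)] assms(3)[OF j(1)] i(2) unfolding hom_def by metis
    then show False using assms(2) i j by (auto dest: inj_onD)
  qed
  have "(\<Sum>j\<in>I. c j * F j \<nu>) = (\<Sum>j\<in>{i}. c j * F j \<nu>)"
    using assms(1) i z by (intro sum.mono_neutral_right) auto
  moreover have "(\<Sum>j\<in>I. (cmod (c j))\<^sup>2 * (cmod (F j \<nu>))\<^sup>2) = (\<Sum>j\<in>{i}. (cmod (c j))\<^sup>2 * (cmod (F j \<nu>))\<^sup>2)"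
    using assms(1) i z by (intro sum.mono_neutral_right) auto
  ultimately show ?thesis by (simp add: norm_mult power_mult_distrib)
next
  case False
  then have "(\<Sum>i\<in>I. c i * F i \<nu>) = 0" "(\<Sum>i\<in>I. (cmod (c i))\<^sup>2 * (cmod (F i \<nu>))\<^sup>2) = 0"
    by (auto intro: sum.neutral)
  then show ?thesis by simp
qed

lemma nsq_sum_hom:
  assumes "finite I" "inj_on k I" "\<And>i. i \<in> I \<Longrightarrow> hom M (k i) (F i)" "\<And>i. i \<in> I \<Longrightarrow> finite (supp (F i))"
  shows "nsq (\<lambda>\<nu>. \<Sum>i\<in>I. c i * F i \<nu>) = (\<Sum>i\<in>I. (cmod (c i))\<^sup>2 * nsq (F i))"
proof -
  define S where "S = (\<Union>i\<in>I. supp (F i))"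
  have S: "finite S" using assms by (simp add: S_def)
  have "supp (\<lambda>\<nu>. \<Sum>i\<in>I. c i * F i \<nu>) \<subseteq> S"
  proof
    fix \<nu> assume "\<nu> \<in> supp (\<lambda>\<nu>. \<Sum>i\<in>I. c i * F i \<nu>)"
    then obtain i where "i \<in> I" "c i * F i \<nu> \<noteq> 0"
      unfolding supp_def by (metis (mono_tags, lifting) mem_Collect_eq sum.neutral)
    then show "\<nu> \<in> S" by (auto simp: S_def supp_def)
  qed
  then have "nsq (\<lambda>\<nu>. \<Sum>i\<in>I. c i * F i \<nu>) = (\<Sum>\<nu>\<in>S. \<Sum>i\<in>I. (cmod (c i))\<^sup>2 * (cmod (F i \<nu>))\<^sup>2)"
    using nsq_eq_sum[OF S] cmod_sq_sum_hom[OF assms(1-3)] by simp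
  also have "\<dots> = (\<Sum>i\<in>I. (cmod (c i))\<^sup>2 * (\<Sum>\<nu>\<in>S. (cmod (F i \<nu>))\<^sup>2))"
    by (subst sum.swap) (simp add: sum_distrib_left)
  also have "\<dots> = (\<Sum>i\<in>I. (cmod (c i))\<^sup>2 * nsq (F i))"
  proof (intro sum.cong refl)
    fix i assume "i \<in> I"
    then have "supp (F i) \<subseteq> S" by (auto simp: S_def)
    then show "(cmod (c i))\<^sup>2 * (\<Sum>\<nu>\<in>S. (cmod (F i \<nu>))\<^sup>2) = (cmod (c i))\<^sup>2 * nsq (F i)"
      using nsq_eq_sum[OF S, of "F i"] by simp
  qed
  finally show ?thesis .
qed

section \<open>The vacuum\<close>

definition vac :: "('m \<Rightarrow> nat) \<Rightarrow> complex" where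
  "vac \<nu> = (if \<nu> = (\<lambda>_. 0) then 1 else 0)"

lemma finite_supp_vac: "finite (supp vac)"
  by (rule finite_subset[of _ "{\<lambda>_. 0}"]) (auto simp: supp_def vac_def split: if_splits)

lemma nsq_vac: "nsq vac = 1"
  by (subst nsq_eq_sum[of "{\<lambda>_. 0}"]) (auto simp: supp_def vac_def split: if_splits)

lemma Ann_vac: "Ann m vac = (\<lambda>\<nu>. 0)"
proof
  fix \<nu> :: "'a \<Rightarrow> nat"
  have "\<nu>(m := \<nu> m + 1) \<noteq> (\<lambda>_. 0)" by (metis Suc_eq_plus1 fun_upd_same nat.distinct(1))
  then show "Ann m vac \<nu> = 0" by (simp add: Ann_def vac_def)
qed

text \<open>Negative binomial weights: with \<open>p = d / 2\<close>, \<open>q n\<close> is the squared norm of the component of the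
  squeezed state with \<open>2 n\<close> photons.\<close>
lemma negative_binomial_truncation:
  fixes q :: "nat \<Rightarrow> real"
  assumes p: "0 < p" and \<delta>: "0 < \<delta>" "\<delta> \<le> 1" and q0: "q 0 = 1"
    and rec: "\<And>n. q (Suc n) = (1 - \<delta>)\<^sup>2 * (p + real n) / real (Suc n) * q n"
  obtains N where
    "\<delta>\<^sup>2 * (\<Sum>n<N. q n * (1 + real n / p)) + q N * (1 + real N / p) \<le> 2 * \<delta> * (\<Sum>n\<le>N. q n)"
    "(\<Sum>n\<le>N. 2 * real n * q n) \<le> 2 * p / \<delta> * (\<Sum>n\<le>N. q n)"
proof -
  have nn: "0 \<le> q n" for n
    by (induction n) (use p in \<open>auto simp: q0 rec intro!: mult_nonneg_nonneg divide_nonneg_nonneg\<close>)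
  define a where "a = (1 - \<delta>)\<^sup>2"
  have a: "0 \<le> a" "a \<le> 1 - \<delta>"
    using \<delta> by (auto simp: a_def power2_eq_square intro: mult_left_le_one_le)
  \<comment> \<open>Shifting the index in \<open>\<Sum>n\<le>N. real n * q n\<close> and inserting
    the recursion reproduces the same sum with factor \<open>a \<le> 1 - \<delta>\<close>.
    Truncation only loses the nonnegative term at \<open>n = N\<close>, so the estimate holds for
    every \<open>N\<close>.\<close>
  have mean: "\<delta> * (\<Sum>n\<le>N. real n * q n) \<le> (1 - \<delta>) * (p * (\<Sum>n\<le>N. q n))" for N
  proof -
    have "(\<Sum>n\<le>N. real n * q n) = (\<Sum>n<N. real (Suc n) * q (Suc n))"
      by (simp add: sum.atMost_shift del: of_nat_Suc)
    also have "\<dots> = (\<Sum>n<N. a * ((p + real n) * q n))"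
      by (intro sum.cong refl) (simp add: rec a_def del: of_nat_Suc)
    also have "\<dots> \<le> (\<Sum>n\<le>N. a * ((p + real n) * q n))"
      using p a nn by (intro sum_mono2) auto
    also have "\<dots> = a * (p * (\<Sum>n\<le>N. q n) + (\<Sum>n\<le>N. real n * q n))"
      by (simp add: sum_distrib_left sum.distrib algebra_simps)
    also have "\<dots> \<le> (1 - \<delta>) * (p * (\<Sum>n\<le>N. q n) + (\<Sum>n\<le>N. real n * q n))"
      using a p nn by (intro mult_right_mono add_nonneg_nonneg mult_nonneg_nonneg sum_nonneg) auto
    finally show ?thesis by (simp add: algebra_simps)
  qed
  \<comment> \<open>The ratio of consecutive terms tends to \<open>a\<close>, which lies below
    \<open>1 - \<delta> / 2\<close>; summability then makes the boundary term at \<open>N\<close>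
    arbitrarily small.\<close>
  have "summable (\<lambda>n. q n * (1 + real n / p))"
  proof -
    have "(\<lambda>n. a * (p + real n + 1) / (real n + 1)) \<longlonglongrightarrow> a"
      by real_asymp
    moreover have "a < 1 - \<delta> / 2" using a \<delta> by auto
    ultimately have "\<forall>\<^sub>F n in sequentially. a * (p + real n + 1) / (real n + 1) < 1 - \<delta> / 2"
      by (rule order_tendstoD)
    then obtain N where N: "\<And>n. n \<ge> N \<Longrightarrow> a * (p + real n + 1) / (real n + 1) < 1 - \<delta> / 2"
      unfolding eventually_sequentially by blast
    show ?thesis
    proof (rule summable_ratio_test[of "1 - \<delta> / 2" N])
      fix n assume "N \<le> n"
      have "q (Suc n) * (1 + real (Suc n) / p) = (a * (p + real n + 1) / (real n + 1)) * (q n * (1 + real n / p))"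
        using p by (simp add: rec a_def field_simps)
      also have "\<dots> \<le> (1 - \<delta> / 2) * (q n * (1 + real n / p))"
        using p nn[of n] N[OF \<open>N \<le> n\<close>] by (intro mult_right_mono) auto
      finally show "norm (q (Suc n) * (1 + real (Suc n) / p)) \<le> (1 - \<delta> / 2) * norm (q n * (1 + real n / p))"
        using p nn[of n] nn[of "Suc n"] by (simp add: abs_mult)
    qed (use \<delta> in auto)
  qed
  then have "(\<lambda>n. q n * (1 + real n / p)) \<longlonglongrightarrow> 0"
    by (rule summable_LIMSEQ_zero)
  then have "\<forall>\<^sub>F n in sequentially. q n * (1 + real n / p) < \<delta>"
    using \<delta> by (intro order_tendstoD)
  \<comment> \<open>A boundary term below \<delta> is small enough: the total weight is at least
    \<open>q 0 = 1\<close>, so the term is below \<delta> times the total weight.\<close>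
  then obtain N where N: "q N * (1 + real N / p) < \<delta>"
    unfolding eventually_sequentially by blast
  have S1: "1 \<le> (\<Sum>n\<le>N. q n)"
    using nn by (subst q0[symmetric]) (intro member_le_sum, auto)
  have "\<delta>\<^sup>2 * (\<Sum>n<N. q n * (1 + real n / p)) \<le> \<delta>\<^sup>2 * (\<Sum>n\<le>N. q n * (1 + real n / p))"
    using nn p by (intro mult_left_mono sum_mono2) auto
  also have "\<dots> = \<delta> * (\<delta> * (\<Sum>n\<le>N. q n) + (\<delta> * (\<Sum>n\<le>N. real n * q n)) / p)"
    by (simp add: power2_eq_square algebra_simps sum.distrib sum_distrib_left sum_divide_distrib)
  also have "\<dots> \<le> \<delta> * (\<delta> * (\<Sum>n\<le>N. q n) + ((1 - \<delta>) * (p * (\<Sum>n\<le>N. q n))) / p)"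
    using mean[of N] p \<delta> by (intro mult_left_mono add_left_mono divide_right_mono) auto
  also have "\<dots> = \<delta> * (\<Sum>n\<le>N. q n)" using p by (simp add: field_simps)
  finally have "\<delta>\<^sup>2 * (\<Sum>n<N. q n * (1 + real n / p)) \<le> \<delta> * (\<Sum>n\<le>N. q n)" .
  moreover have "q N * (1 + real N / p) \<le> \<delta> * (\<Sum>n\<le>N. q n)"
  proof -
    have "\<delta> * 1 \<le> \<delta> * (\<Sum>n\<le>N. q n)" using \<delta> by (intro mult_left_mono S1) simp
    then show ?thesis using N by linarith
  qed
  moreover have "(\<Sum>n\<le>N. 2 * real n * q n) \<le> 2 * p / \<delta> * (\<Sum>n\<le>N. q n)"
  proof -
    have "0 \<le> \<delta> * (p * (\<Sum>n\<le>N. q n))" using S1 p \<delta> by (intro mult_nonneg_nonneg) auto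
    then have "\<delta> * (\<Sum>n\<le>N. real n * q n) \<le> p * (\<Sum>n\<le>N. q n)"
      using mean[of N] by (simp add: left_diff_distrib)
    moreover have "(\<Sum>n\<le>N. 2 * real n * q n) = 2 * (\<Sum>n\<le>N. real n * q n)"
      by (simp add: sum_distrib_left mult.assoc)
    ultimately show ?thesis using \<delta> by (simp add: field_simps)
  qed
  ultimately show thesis by (intro that[of N]) auto
qed


locale orthonormal_modes =
  fixes M :: "'m set" and f :: "nat \<Rightarrow> 'm \<Rightarrow> complex" and d :: nat
  assumes fin: "finite M" and d_pos: "0 < d"
    and orthonormal: "\<And>i j. i < d \<Longrightarrow> j < d \<Longrightarrow> mip M (f i) (f j) = (if i = j then 1 else 0)"
begin

text \<open>The pair creation operator, the raising operator of su(1,1). The formal exponential of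
  \<open>- r * Kp\<close> applied to the vacuum is an unnormalized squeezed vacuum; its component
  with \<open>2 * n\<close> photons is \<open>u n\<close> times
  \<open>(- r) ^ n / fact n\<close>.\<close>

definition Kp :: "(('m \<Rightarrow> nat) \<Rightarrow> complex) \<Rightarrow> ('m \<Rightarrow> nat) \<Rightarrow> complex" where
  "Kp \<phi> = (\<lambda>\<nu>. \<Sum>i<d. (1 / 2) * cop M (f i) (cop M (f i) \<phi>) \<nu>)"

definition u :: "nat \<Rightarrow> ('m \<Rightarrow> nat) \<Rightarrow> complex" where
  "u n = (Kp ^^ n) vac"

text \<open>The commutator of the fields with form factors \<open>g\<close> and \<open>h\<close> is
  \<open>2 * \<i>\<close> times the imaginary part of \<open>mip M g h\<close>. Real combinations of
  orthonormal modes thus have commuting fields. Equality is asked on \<open>M\<close> only, because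
  the smeared operators see no other values.\<close>

definition real_span :: "('m \<Rightarrow> complex) \<Rightarrow> bool" where
  "real_span g \<longleftrightarrow> (\<exists>c :: nat \<Rightarrow> real. \<forall>m\<in>M. g m = (\<Sum>i<d. of_real (c i) * f i m))"

lemma u_0 [simp]: "u 0 = vac" and u_Suc: "u (Suc n) = Kp (u n)"
  by (simp_all add: u_def)

lemma finite_supp_Kp: "finite (supp \<phi>) \<Longrightarrow> finite (supp (Kp \<phi>))"
  unfolding Kp_def by (intro finite_supp_sum finite_supp_scale finite_supp_cop)

lemma finite_supp_u: "finite (supp (u n))"
  by (induction n) (auto simp: u_Suc finite_supp_vac intro: finite_supp_Kp)

lemma hom_u: "hom M (2 * n) (u n)"
proof (induction n)
  case 0
  show ?case by (auto simp: hom_def vac_def split: if_splits)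
next
  case (Suc n)
  have "hom M (Suc (Suc (2 * n))) (Kp (u n))"
    unfolding Kp_def by (intro hom_sum hom_cop fin Suc)
  then show ?case by (simp add: u_Suc)
qed

lemma Kp_scale: "Kp (\<lambda>\<nu>. c * \<phi> \<nu>) = (\<lambda>\<nu>. c * Kp \<phi> \<nu>)"
  by (simp add: Kp_def cop_scale sum_distrib_left algebra_simps)

lemma cop_Kp: "cop M g (Kp \<phi>) = Kp (cop M g \<phi>)"
  unfolding Kp_def cop_sum cop_scale by (simp add: cop_cop[of M g])

lemma cop_real_span:
  assumes "\<And>m. m \<in> M \<Longrightarrow> g m = (\<Sum>i<d. of_real (c i) * f i m)"
  shows "cop M g \<phi> \<nu> = (\<Sum>i<d. of_real (c i) * cop M (f i) \<phi> \<nu>)"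
proof -
  have "cop M g \<phi> \<nu> = (\<Sum>m\<in>M. \<Sum>i<d. of_real (c i) * (f i m * Cre m \<phi> \<nu>))"
    unfolding cop_def by (intro sum.cong refl) (simp add: assms sum_distrib_right mult.assoc)
  also have "\<dots> = (\<Sum>i<d. of_real (c i) * cop M (f i) \<phi> \<nu>)"
    unfolding cop_def by (subst sum.swap) (simp add: sum_distrib_left)
  finally show ?thesis .
qed

lemma mip_real_span:
  assumes "\<And>m. m \<in> M \<Longrightarrow> g m = (\<Sum>i<d. of_real (c i) * f i m)" "j < d"
  shows "mip M g (f j) = of_real (c j)"
proof -
  have "mip M g (f j) = (\<Sum>m\<in>M. \<Sum>i<d. of_real (c i) * (cnj (f i m) * f j m))"
    unfolding mip_def by (intro sum.cong refl) (simp add: assms(1) sum_distrib_right mult.assoc)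
  also have "\<dots> = (\<Sum>i<d. of_real (c i) * mip M (f i) (f j))"
    unfolding mip_def by (subst sum.swap) (simp add: sum_distrib_left)
  also have "\<dots> = (\<Sum>i<d. if i = j then of_real (c i) else 0)"
    using assms(2) by (intro sum.cong refl) (simp add: orthonormal)
  finally show ?thesis using assms(2) by simp
qed

text \<open>Commuting \<open>aop M g\<close> through the two factors of each pair gives
  \<open>mip M g (f i)\<close> times \<open>cop M (f i)\<close>; the factor 2 cancels the 1/2. The
  coefficients being real, these scalars are the coefficients of \<open>g\<close> itself, and the
  commutator of \<open>aop M g\<close> with \<open>Kp\<close> is \<open>cop M g\<close>.\<close>

lemma aop_Kp:
  assumes "real_span g"
  shows "aop M g (Kp \<phi>) = (\<lambda>\<nu>. Kp (aop M g \<phi>) \<nu> + cop M g \<phi> \<nu>)"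
proof
  fix \<nu>
  from assms obtain c :: "nat \<Rightarrow> real" where c: "\<And>m. m \<in> M \<Longrightarrow> g m = (\<Sum>i<d. of_real (c i) * f i m)"
    unfolding real_span_def by blast
  have "aop M g (Kp \<phi>) \<nu> = (\<Sum>i<d. (1 / 2) * aop M g (cop M (f i) (cop M (f i) \<phi>)) \<nu>)"
    unfolding Kp_def aop_sum aop_scale ..
  also have "\<dots> = (\<Sum>i<d. (1 / 2) * cop M (f i) (cop M (f i) (aop M g \<phi>)) \<nu> + of_real (c i) * cop M (f i) \<phi> \<nu>)"
  proof (intro sum.cong refl)
    fix i assume "i \<in> {..<d}"
    then have m: "mip M g (f i) = of_real (c i)" using mip_real_span[OF c] by auto
    have "aop M g (cop M (f i) \<phi>) = (\<lambda>\<nu>. cop M (f i) (aop M g \<phi>) \<nu> + of_real (c i) * \<phi> \<nu>)"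
      using aop_cop[OF fin] m by auto
    then show "(1 / 2) * aop M g (cop M (f i) (cop M (f i) \<phi>)) \<nu> =
      (1 / 2) * cop M (f i) (cop M (f i) (aop M g \<phi>)) \<nu> + of_real (c i) * cop M (f i) \<phi> \<nu>"
      by (simp add: aop_cop[OF fin] m cop_add cop_scale)
  qed
  also have "\<dots> = Kp (aop M g \<phi>) \<nu> + cop M g \<phi> \<nu>"
    using cop_real_span[OF c] by (simp add: Kp_def sum.distrib)
  finally show "aop M g (Kp \<phi>) \<nu> = Kp (aop M g \<phi>) \<nu> + cop M g \<phi> \<nu>" .
qed

lemma aop_vac: "aop M g vac = (\<lambda>\<nu>. 0)"
  by (simp add: aop_def[abs_def] Ann_vac)

text \<open>\<open>aop M g\<close> kills the vacuum, and each of the \<open>Suc n\<close> factors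
  \<open>Kp\<close> it passes contributes one \<open>cop M g\<close>, which commutes with the
  remaining factors.\<close>

lemma aop_u_Suc:
  assumes "real_span g"
  shows "aop M g (u (Suc n)) = (\<lambda>\<nu>. of_nat (Suc n) * cop M g (u n) \<nu>)"
proof (induction n)
  case 0
  have "Kp (\<lambda>\<nu>. 0) = (\<lambda>\<nu>. 0)" using Kp_scale[of 0 "\<lambda>\<nu>. 0"] by simp
  then show ?case unfolding u_Suc aop_Kp[OF assms] by (simp add: aop_vac)
next
  case (Suc n)
  show ?case
    unfolding u_Suc[of "Suc n"] aop_Kp[OF assms] Suc Kp_scale cop_Kp[symmetric]
    by (simp add: u_Suc algebra_simps)
qed

lemma real_span_f: "i < d \<Longrightarrow> real_span (f i)"
  unfolding real_span_def
proof (intro exI[of _ "\<lambda>j. if j = i then 1 else 0"] ballI)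
  fix m assume "i < d"
  then have "f i m = (\<Sum>j<d. if j = i then f j m else 0)" by simp
  also have "\<dots> = (\<Sum>j<d. of_real (if j = i then 1 else 0) * f j m)" by (intro sum.cong) auto
  finally show "f i m = (\<Sum>j<d. of_real (if j = i then 1 else 0) * f j m)" .
qed

text \<open>Moving one \<open>cop\<close> of \<open>Kp\<close> across leaves
  \<open>real (Suc n) / 2\<close> times the sum of the squared norms of
  \<open>cop M (f i) (u n)\<close>. By the commutation relation this sum is \<open>2 * n + d\<close>
  times \<open>nsq (u n)\<close>: the number operator contributes \<open>2 * n\<close>, as
  \<open>low\<close> shows, and each of the \<open>d\<close> modes contributes 1.\<close>

lemma nsq_u_Suc: "nsq (u (Suc n)) = real (Suc n) * (real d / 2 + real n) * nsq (u n)"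
proof -
  have low: "(\<Sum>i<d. nsq (aop M (f i) (u n))) = 2 * real n * nsq (u n)"
  proof (cases n)
    case 0
    then show ?thesis by (simp add: aop_vac nsq_def)
  next
    case (Suc k)
    have "complex_of_real (\<Sum>i<d. nsq (aop M (f i) (u n))) = (\<Sum>i<d. ip (u n) (cop M (f i) (aop M (f i) (u n))))"
      by (simp add: ip_self[symmetric] ip_aop_left finite_supp_u)
    also have "\<dots> = (\<Sum>i<d. of_nat n * ip (u n) (cop M (f i) (cop M (f i) (u k))))"
      by (intro sum.cong refl) (simp add: Suc aop_u_Suc real_span_f cop_scale ip_scale_right del: of_nat_Suc)
    also have "\<dots> = 2 * of_nat n * ip (u n) (u n)"
    proof -
      have "ip (u n) (u n) = ip (u n) (Kp (u k))" by (simp add: Suc u_Suc)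
      also have "\<dots> = (\<Sum>i<d. (1 / 2) * ip (u n) (cop M (f i) (cop M (f i) (u k))))"
        unfolding Kp_def ip_sum_right ip_scale_right ..
      finally show ?thesis by (simp add: sum_distrib_left)
    qed
    also have "\<dots> = complex_of_real (2 * real n * nsq (u n))" by (simp add: ip_self)
    finally show ?thesis by (simp only: of_real_eq_iff)
  qed
  have "complex_of_real (nsq (u (Suc n))) = ip (Kp (u n)) (u (Suc n))"
    by (simp add: ip_self[symmetric] u_Suc)
  also have "\<dots> = (\<Sum>i<d. (1 / 2) * ip (cop M (f i) (cop M (f i) (u n))) (u (Suc n)))"
    unfolding Kp_def
    by (subst ip_sum_left)
      (simp_all only: ip_scale_left[OF finite_supp_cop[OF finite_supp_cop[OF finite_supp_u]]]
        finite_supp_scale finite_supp_u finite_supp_cop, simp)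
  also have "\<dots> = (\<Sum>i<d. of_nat (Suc n) / 2 * ip (cop M (f i) (u n)) (cop M (f i) (u n)))"
    by (intro sum.cong refl)
      (simp add: ip_cop_left finite_supp_u finite_supp_cop aop_u_Suc real_span_f ip_scale_right del: of_nat_Suc)
  also have "\<dots> = complex_of_real (real (Suc n) / 2 * (\<Sum>i<d. nsq (cop M (f i) (u n))))"
    by (simp add: ip_self sum_distrib_left del: of_nat_Suc)
  finally have "nsq (u (Suc n)) = real (Suc n) / 2 * (\<Sum>i<d. nsq (cop M (f i) (u n)))"
    by (simp only: of_real_eq_iff)
  also have "(\<Sum>i<d. nsq (cop M (f i) (u n))) = (\<Sum>i<d. nsq (aop M (f i) (u n)) + nsq (u n))"
  proof (intro sum.cong refl)
    fix i assume "i \<in> {..<d}"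
    then have "complex_of_real (mnsq M (f i)) = 1"
      using orthonormal[of i i] by (simp add: mip_self)
    then have "mnsq M (f i) = 1" by (simp only: of_real_eq_1_iff)
    then show "nsq (cop M (f i) (u n)) = nsq (aop M (f i) (u n)) + nsq (u n)"
      by (simp add: nsq_cop fin finite_supp_u)
  qed
  finally show ?thesis by (simp add: sum.distrib low field_simps)
qed

text \<open>\<open>Kp\<close> is invariant under real orthogonal changes of the modes, so
  \<open>g\<close> can enter only through its norm. The induction uses that \<open>aop M g\<close>
  maps \<open>u (Suc n)\<close> to a multiple of \<open>cop M g (u n)\<close>, which makes the
  recursion for the norms close.\<close>

lemma nsq_cop_u:
  assumes "real_span g"
  shows "nsq (cop M g (u n)) = mnsq M g * (nsq (u n) * (1 + real n / (real d / 2)))"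
proof (induction n)
  case 0
  show ?case using nsq_cop[OF fin finite_supp_vac] by (simp add: aop_vac nsq_vac) (simp add: nsq_def)
next
  case (Suc n)
  have "nsq (cop M g (u (Suc n))) = (real (Suc n))\<^sup>2 * nsq (cop M g (u n)) + mnsq M g * nsq (u (Suc n))"
    by (simp add: nsq_cop fin finite_supp_u aop_u_Suc assms nsq_scale finite_supp_cop del: of_nat_Suc)
  also have "\<dots> = mnsq M g * (nsq (u (Suc n)) * (1 + real (Suc n) / (real d / 2)))"
    unfolding Suc nsq_u_Suc using d_pos by (simp add: field_simps power2_eq_square)
  finally show ?case .
qed

text \<open>For the untruncated exponential with \<open>r = 1 - \<delta>\<close>,
  \<open>aop M g \<xi>\<close> equals \<open>- r\<close> times \<open>cop M g \<xi>\<close>, so the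
  field acts as \<delta> times \<open>cop M g\<close>. This cancellation lowers the squared field
  norm from order 1 to order \<delta> for every real form factor at once, while the mean photon
  number is at most \<open>d / \<delta>\<close>. The state is the partial sum up to
  \<open>2 * N\<close> photons.\<close>

theorem squeezed_state:
  assumes \<delta>: "0 < \<delta>" "\<delta> \<le> 1"
  obtains \<xi> where "finite (supp \<xi>)" "0 < nsq \<xi>"
    "\<And>\<nu> m. \<xi> \<nu> \<noteq> 0 \<Longrightarrow> m \<notin> M \<Longrightarrow> \<nu> m = 0"
    "\<And>g. real_span g \<Longrightarrow> nsq (\<lambda>\<nu>. aop M g \<xi> \<nu> + cop M g \<xi> \<nu>) \<le> 2 * \<delta> * mnsq M g * nsq \<xi>"
    "(\<Sum>m\<in>M. nsq (Ann m \<xi>)) \<le> real d / \<delta> * nsq \<xi>"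
proof -
  define r where "r = 1 - \<delta>"
  define p where "p = real d / 2"
  define c where "c n = (- r) ^ n / fact n" for n
  define q where "q n = (c n)\<^sup>2 * nsq (u n)" for n
  have p: "0 < p" using d_pos by (simp add: p_def)
  have c_Suc: "real (Suc n) * c (Suc n) = - r * c n" for n
    by (simp add: c_def field_simps del: of_nat_Suc)
  have q0: "q 0 = 1" by (simp add: q_def c_def nsq_vac)
  have rec: "q (Suc n) = (1 - \<delta>)\<^sup>2 * (p + real n) / real (Suc n) * q n" for n
  proof -
    have "(real (Suc n) * c (Suc n))\<^sup>2 = r\<^sup>2 * (c n)\<^sup>2" unfolding c_Suc by (simp add: power_mult_distrib)
    then have "(c (Suc n))\<^sup>2 = r\<^sup>2 * (c n)\<^sup>2 / (real (Suc n))\<^sup>2"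
      by (simp add: power_mult_distrib eq_divide_eq mult.commute del: of_nat_Suc)
    moreover have "x / z\<^sup>2 * (z * a * b) = x * a / z * b" if "z \<noteq> 0" for x z a b :: real
      using that by (simp add: power2_eq_square)
    ultimately show ?thesis
      unfolding q_def nsq_u_Suc p_def r_def by (simp add: mult_ac del: of_nat_Suc)
  qed
  obtain N where N1: "\<delta>\<^sup>2 * (\<Sum>n<N. q n * (1 + real n / p)) + q N * (1 + real N / p) \<le> 2 * \<delta> * (\<Sum>n\<le>N. q n)"
    and N2: "(\<Sum>n\<le>N. 2 * real n * q n) \<le> 2 * p / \<delta> * (\<Sum>n\<le>N. q n)"
    using negative_binomial_truncation[OF p \<delta> q0 rec] .
  define \<xi> where "\<xi> \<nu> = (\<Sum>n\<le>N. of_real (c n) * u n \<nu>)" for \<nu>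
  have fs: "finite (supp \<xi>)"
    unfolding \<xi>_def[abs_def] by (intro finite_supp_sum finite_supp_scale finite_supp_u)
  have nsq\<xi>: "nsq \<xi> = (\<Sum>n\<le>N. q n)"
    unfolding \<xi>_def[abs_def]
    by (subst nsq_sum_hom[where M = M and k = "\<lambda>n. 2 * n"]) (auto simp: hom_u finite_supp_u q_def inj_on_def)
  have pos: "0 < nsq \<xi>"
  proof -
    have "q 0 \<le> (\<Sum>n\<le>N. q n)"
      by (intro member_le_sum) (auto simp: q_def nsq_nonneg)
    then show ?thesis by (simp add: nsq\<xi> q0)
  qed
  have supported: "\<nu> m = 0" if "\<xi> \<nu> \<noteq> 0" "m \<notin> M" for \<nu> m
  proof -
    from that(1) obtain n where "of_real (c n) * u n \<nu> \<noteq> 0"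
      unfolding \<xi>_def by (metis (mono_tags, lifting) sum.neutral)
    then show ?thesis using hom_u[of n] that(2) unfolding hom_def by auto
  qed
  have field: "nsq (\<lambda>\<nu>. aop M g \<xi> \<nu> + cop M g \<xi> \<nu>) \<le> 2 * \<delta> * mnsq M g * nsq \<xi>" if g: "real_span g" for g
  proof -
    \<comment> \<open>The coefficient of \<open>cop M g (u n)\<close> in the field applied to \<xi>.
      Below \<open>N\<close> the annihilation part from \<open>u (Suc n)\<close> reduces
      \<open>c n\<close> to \<open>\<delta> * c n\<close>; at \<open>N\<close> this partner has been
      cut off and \<open>c N\<close> stays.\<close>
    define e where "e n = (if n < N then \<delta> * c n else c n)" for n
    have "aop M g \<xi> \<nu> + cop M g \<xi> \<nu> = (\<Sum>n\<le>N. of_real (e n) * cop M g (u n) \<nu>)" for \<nu>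
    proof -
      have "aop M g \<xi> \<nu> = (\<Sum>n\<le>N. of_real (c n) * aop M g (u n) \<nu>)"
        unfolding \<xi>_def[abs_def] aop_sum aop_scale ..
      also have "\<dots> = (\<Sum>n<N. of_real (c (Suc n)) * aop M g (u (Suc n)) \<nu>)"
        by (simp add: sum.atMost_shift aop_vac)
      also have "\<dots> = (\<Sum>n<N. of_real (- r * c n) * cop M g (u n) \<nu>)"
        unfolding aop_u_Suc[OF g] c_Suc[symmetric] by (intro sum.cong refl) (simp add: algebra_simps)
      finally have a: "aop M g \<xi> \<nu> = (\<Sum>n<N. of_real (- r * c n) * cop M g (u n) \<nu>)" .
      have b: "cop M g \<xi> \<nu> = (\<Sum>n<N. of_real (c n) * cop M g (u n) \<nu>) + of_real (c N) * cop M g (u N) \<nu>"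
        unfolding \<xi>_def[abs_def] cop_sum cop_scale by (simp add: lessThan_Suc_atMost[symmetric])
      have "(\<Sum>n\<le>N. of_real (e n) * cop M g (u n) \<nu>) =
          (\<Sum>n<N. of_real (\<delta> * c n) * cop M g (u n) \<nu>) + of_real (c N) * cop M g (u N) \<nu>"
        by (simp add: lessThan_Suc_atMost[symmetric] e_def)
      also have "(\<Sum>n<N. of_real (\<delta> * c n) * cop M g (u n) \<nu>) =
          (\<Sum>n<N. of_real (- r * c n) * cop M g (u n) \<nu>) + (\<Sum>n<N. of_real (c n) * cop M g (u n) \<nu>)"
        unfolding sum.distrib[symmetric] by (intro sum.cong refl) (simp add: r_def algebra_simps)
      finally show ?thesis using a b by simp
    qed
    then have "nsq (\<lambda>\<nu>. aop M g \<xi> \<nu> + cop M g \<xi> \<nu>) = nsq (\<lambda>\<nu>. \<Sum>n\<le>N. of_real (e n) * cop M g (u n) \<nu>)"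
      by simp
    also have "\<dots> = (\<Sum>n\<le>N. (cmod (of_real (e n)))\<^sup>2 * nsq (cop M g (u n)))"
      by (rule nsq_sum_hom[where M = M and k = "\<lambda>n. Suc (2 * n)"])
        (auto simp: fin inj_on_def intro!: hom_cop hom_u finite_supp_cop finite_supp_u)
    also have "\<dots> = (\<Sum>n\<le>N. (e n)\<^sup>2 * (mnsq M g * (nsq (u n) * (1 + real n / p))))"
      by (simp add: nsq_cop_u[OF g] p_def)
    also have "\<dots> = mnsq M g * (\<delta>\<^sup>2 * (\<Sum>n<N. q n * (1 + real n / p)) + q N * (1 + real N / p))"
      by (simp add: lessThan_Suc_atMost[symmetric] e_def q_def sum_distrib_left distrib_left power_mult_distrib mult_ac)
    also have "\<dots> \<le> mnsq M g * (2 * \<delta> * (\<Sum>n\<le>N. q n))"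
      using N1 mnsq_nonneg by (intro mult_left_mono)
    finally show ?thesis by (simp add: nsq\<xi> mult_ac)
  qed
  have number: "(\<Sum>m\<in>M. nsq (Ann m \<xi>)) \<le> real d / \<delta> * nsq \<xi>"
  proof -
    define S where "S = (\<Union>n\<le>N. supp (u n))"
    have S: "finite S" by (simp add: S_def finite_supp_u)
    have sub: "supp (u n) \<subseteq> S" if "n \<le> N" for n using that by (auto simp: S_def)
    have "supp \<xi> \<subseteq> S"
    proof
      fix \<nu> assume "\<nu> \<in> supp \<xi>"
      then obtain n where "n \<in> {..N}" "of_real (c n) * u n \<nu> \<noteq> 0"
        unfolding \<xi>_def supp_def by (metis (mono_tags, lifting) mem_Collect_eq sum.neutral)
      then show "\<nu> \<in> S" by (auto simp: S_def supp_def)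
    qed
    then have "(\<Sum>m\<in>M. nsq (Ann m \<xi>)) = (\<Sum>m\<in>M. \<Sum>\<nu>\<in>S. real (\<nu> m) * (cmod (\<xi> \<nu>))\<^sup>2)"
      using nsq_Ann[OF S] by simp
    also have "\<dots> = (\<Sum>\<nu>\<in>S. real (\<Sum>m\<in>M. \<nu> m) * (cmod (\<xi> \<nu>))\<^sup>2)"
      by (subst sum.swap) (simp add: sum_distrib_right)
    also have "\<dots> = (\<Sum>\<nu>\<in>S. \<Sum>n\<le>N. 2 * real n * ((c n)\<^sup>2 * (cmod (u n \<nu>))\<^sup>2))"
    proof (intro sum.cong refl)
      fix \<nu>
      have "(cmod (\<xi> \<nu>))\<^sup>2 = (\<Sum>n\<le>N. (cmod (of_real (c n)))\<^sup>2 * (cmod (u n \<nu>))\<^sup>2)"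
        unfolding \<xi>_def by (rule cmod_sq_sum_hom[where M = M and k = "\<lambda>n. 2 * n"]) (auto simp: hom_u inj_on_def)
      then have "real (\<Sum>m\<in>M. \<nu> m) * (cmod (\<xi> \<nu>))\<^sup>2 = (\<Sum>n\<le>N. real (\<Sum>m\<in>M. \<nu> m) * ((c n)\<^sup>2 * (cmod (u n \<nu>))\<^sup>2))"
        by (simp add: sum_distrib_left)
      \<comment> \<open>Wherever \<open>u n\<close> is nonzero the total photon number is
        \<open>2 * n\<close>.\<close>
      also have "\<dots> = (\<Sum>n\<le>N. 2 * real n * ((c n)\<^sup>2 * (cmod (u n \<nu>))\<^sup>2))"
      proof (intro sum.cong refl)
        fix n
        show "real (\<Sum>m\<in>M. \<nu> m) * ((c n)\<^sup>2 * (cmod (u n \<nu>))\<^sup>2) = 2 * real n * ((c n)\<^sup>2 * (cmod (u n \<nu>))\<^sup>2)"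
          using hom_u[of n] by (cases "u n \<nu> = 0") (auto simp: hom_def)
      qed
      finally show "real (\<Sum>m\<in>M. \<nu> m) * (cmod (\<xi> \<nu>))\<^sup>2 = (\<Sum>n\<le>N. 2 * real n * ((c n)\<^sup>2 * (cmod (u n \<nu>))\<^sup>2))" .
    qed
    also have "\<dots> = (\<Sum>n\<le>N. 2 * real n * ((c n)\<^sup>2 * (\<Sum>\<nu>\<in>S. (cmod (u n \<nu>))\<^sup>2)))"
      by (subst sum.swap) (simp add: sum_distrib_left)
    also have "\<dots> = (\<Sum>n\<le>N. 2 * real n * q n)"
      by (intro sum.cong refl) (simp add: q_def nsq_eq_sum[OF S sub])
    also have "\<dots> \<le> 2 * p / \<delta> * (\<Sum>n\<le>N. q n)" by (rule N2)
    finally show ?thesis by (simp add: nsq\<xi> p_def)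
  qed
  show thesis by (rule that[of \<xi>]) (fact fs pos supported field number)+
qed

end

section \<open>Compactly supported functions\<close>

definition ccs :: "('a::euclidean_space \<Rightarrow> 'b::real_normed_vector) \<Rightarrow> bool" where
  "ccs F \<longleftrightarrow> continuous_on UNIV F \<and> (\<exists>R. \<forall>x. R < norm x \<longrightarrow> F x = 0)"

lemma ccs_bounded:
  assumes "ccs F"
  obtains B where "0 \<le> B" "\<And>x. norm (F x) \<le> B"
proof -
  from assms obtain R where F: "continuous_on UNIV F" and R: "\<And>x. R < norm x \<Longrightarrow> F x = 0"
    unfolding ccs_def by blast
  have "compact (F ` cball 0 R)"
    by (intro compact_continuous_image continuous_on_subset[OF F]) auto
  then obtain B where B: "\<And>y. y \<in> F ` cball 0 R \<Longrightarrow> norm y \<le> B"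
    using compact_imp_bounded bounded_iff by metis
  have "norm (F x) \<le> max B 0" for x
  proof (cases "norm x \<le> R")
    case True
    then have "norm (F x) \<le> B" by (intro B) auto
    then show ?thesis by simp
  qed (use R in auto)
  then show ?thesis using that[of "max B 0"] by auto
qed

lemma ccs_integrable:
  fixes F :: "'a::euclidean_space \<Rightarrow> 'b::{banach, second_countable_topology}"
  assumes "ccs F"
  shows "integrable lborel F"
proof -
  from assms obtain R where F: "continuous_on UNIV F" and R: "\<And>x. R < norm x \<Longrightarrow> F x = 0"
    unfolding ccs_def by blast
  have "integrable lborel (\<lambda>x. indicator (cball 0 R) x *\<^sub>R F x)"
    by (intro borel_integrable_compact continuous_on_subset[OF F]) auto
  also have "(\<lambda>x. indicator (cball 0 R) x *\<^sub>R F x) = F"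
    using R by (force simp: indicator_def fun_eq_iff)
  finally show ?thesis .
qed

lemma ccs_add: "ccs F \<Longrightarrow> ccs G \<Longrightarrow> ccs (\<lambda>x. F x + G x)"
proof -
  assume "ccs F" "ccs G"
  then obtain R R' where F: "continuous_on UNIV F" and R: "\<And>x. R < norm x \<Longrightarrow> F x = 0"
    and G: "continuous_on UNIV G" and R': "\<And>x. R' < norm x \<Longrightarrow> G x = 0"
    unfolding ccs_def by blast
  have "\<forall>x. max R R' < norm x \<longrightarrow> F x + G x = 0" using R R' by auto
  moreover have "continuous_on UNIV (\<lambda>x. F x + G x)" using F G by (rule continuous_on_add)
  ultimately show ?thesis unfolding ccs_def by blast
qed

lemma ccs_zero: "ccs (\<lambda>x. 0)"
  by (simp add: ccs_def)

lemma ccs_sum: "(\<And>i. i \<in> I \<Longrightarrow> ccs (F i)) \<Longrightarrow> ccs (\<lambda>x. \<Sum>i\<in>I. F i x)"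
  by (induction I rule: infinite_finite_induct) (auto intro: ccs_add ccs_zero)

lemma ccs_mult_left:
  fixes F :: "'a::euclidean_space \<Rightarrow> 'b::real_normed_algebra"
  shows "continuous_on UNIV G \<Longrightarrow> ccs F \<Longrightarrow> ccs (\<lambda>x. G x * F x)"
proof -
  assume G: "continuous_on UNIV G" and "ccs F"
  then obtain R where F: "continuous_on UNIV F" and R: "\<And>x. R < norm x \<Longrightarrow> F x = 0"
    unfolding ccs_def by blast
  have "\<forall>x. R < norm x \<longrightarrow> G x * F x = 0" using R by auto
  moreover have "continuous_on UNIV (\<lambda>x. G x * F x)" using G F by (rule continuous_on_mult)
  ultimately show ?thesis unfolding ccs_def by blast
qed

lemma ccs_compose: "ccs F \<Longrightarrow> continuous_on UNIV h \<Longrightarrow> h 0 = 0 \<Longrightarrow> ccs (\<lambda>x. h (F x))"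
proof -
  assume "ccs F" and h: "continuous_on UNIV h" "h 0 = 0"
  then obtain R where F: "continuous_on UNIV F" and R: "\<And>x. R < norm x \<Longrightarrow> F x = 0"
    unfolding ccs_def by blast
  have "continuous_on UNIV (\<lambda>x. h (F x))" by (rule continuous_on_compose2[OF h(1) F]) auto
  moreover have "\<forall>x. R < norm x \<longrightarrow> h (F x) = 0" using R h(2) by auto
  ultimately show ?thesis unfolding ccs_def by blast
qed

section \<open>Integrals of derivatives of compactly supported functions\<close>

lemma derivative_eq_0_outside:
  assumes "(F has_derivative F') (at x)" "\<And>x. R < norm x \<Longrightarrow> F x = 0" "R < norm x"
  shows "F' = (\<lambda>_. 0)"
proof -
  have "open {x. R < norm x}" by (intro open_Collect_less continuous_intros)
  then have "((\<lambda>_. 0) has_derivative F') (at x)"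
    using has_derivative_transform_within_open[OF assms(1), of "{x. R < norm x}" "\<lambda>_. 0"] assms by auto
  then show ?thesis using has_derivative_unique[OF _ has_derivative_const[of 0]] by metis
qed

text \<open>The difference quotients along \<open>v\<close> have integral 0 by translation
  invariance of Lebesgue measure, and they converge to the directional derivative under a common
  integrable bound.\<close>

lemma integral_derivative_eq_0:
  fixes F :: "'a::euclidean_space \<Rightarrow> 'b::{banach, second_countable_topology}"
  assumes der: "\<And>x. (F has_derivative F' x) (at x)" and F: "ccs F"
    and F': "continuous_on UNIV (\<lambda>x. F' x v)"
  shows "(LINT x|lborel. F' x v) = 0"
proof -
  from F obtain R where cont: "continuous_on UNIV F" and R: "\<And>x. R < norm x \<Longrightarrow> F x = 0"
    unfolding ccs_def by blast
  have F'0: "F' x v = 0" if "R < norm x" for x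
    using derivative_eq_0_outside[OF der R that] by simp
  have "ccs (\<lambda>x. F' x v)" unfolding ccs_def using F' F'0 by blast
  then obtain B where B: "0 \<le> B" "\<And>x. norm (F' x v) \<le> B" using ccs_bounded by blast
  define h where "h n = inverse (real (Suc n))" for n
  have h: "0 < h n" "h n \<le> 1" for n by (auto simp: h_def field_simps)
  define s where "s n x = (F (x + h n *\<^sub>R v) - F x) /\<^sub>R h n" for n x
  have vder: "((\<lambda>t. F (x + t *\<^sub>R v)) has_vector_derivative F' (x + t *\<^sub>R v) v) (at t within T)" for x t T
  proof -
    have "((\<lambda>t. F (x + t *\<^sub>R v)) has_derivative (\<lambda>s. F' (x + t *\<^sub>R v) (s *\<^sub>R v))) (at t within T)"
      by (rule has_derivative_compose[OF _ der]) (auto intro!: derivative_eq_intros)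
    moreover have "F' (x + t *\<^sub>R v) (s *\<^sub>R v) = s *\<^sub>R F' (x + t *\<^sub>R v) v" for s
      using has_derivative_bounded_linear[OF der] by (rule linear_scale[OF bounded_linear.linear])
    ultimately show ?thesis by (simp add: has_vector_derivative_def)
  qed
  have lim: "(\<lambda>n. s n x) \<longlonglongrightarrow> F' x v" for x
  proof -
    have "((\<lambda>t. F (x + t *\<^sub>R v)) has_vector_derivative F' x v) (at 0)"
      using vder[of x 0] by simp
    then have "((\<lambda>t. norm (F (x + t *\<^sub>R v) - F x - t *\<^sub>R F' x v) / norm t) \<longlongrightarrow> 0) (at 0)"
      by (simp add: has_vector_derivative_def has_derivative_at)
    moreover have "filterlim h (at 0) sequentially"
      unfolding filterlim_at h_def using LIMSEQ_inverse_real_of_nat by auto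
    ultimately have "(\<lambda>n. norm (F (x + h n *\<^sub>R v) - F x - h n *\<^sub>R F' x v) / norm (h n)) \<longlonglongrightarrow> 0"
      by (rule filterlim_compose)
    moreover have "norm (F (x + h n *\<^sub>R v) - F x - h n *\<^sub>R F' x v) / norm (h n) = norm (s n x - F' x v)" for n
    proof -
      have "F (x + h n *\<^sub>R v) - F x - h n *\<^sub>R F' x v = h n *\<^sub>R (s n x - F' x v)"
        using h[of n] by (simp add: s_def scaleR_right_diff_distrib)
      then show ?thesis using h[of n] by simp
    qed
    ultimately have "(\<lambda>n. norm (s n x - F' x v)) \<longlonglongrightarrow> 0" by simp
    then have "(\<lambda>n. s n x - F' x v) \<longlonglongrightarrow> 0" by (rule tendsto_norm_zero_cancel)
    then show ?thesis by (rule LIM_zero_cancel)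
  qed
  \<comment> \<open>Steps \<open>h n \<le> 1\<close> keep all quotients supported in one ball, of
    radius \<open>R + norm v\<close>; inside it the mean value inequality bounds them by
    \<open>B\<close>.\<close>
  have bound: "norm (s n x) \<le> indicator (cball 0 (R + norm v)) x *\<^sub>R B" for n x
  proof (cases "x \<in> cball 0 (R + norm v)")
    case True
    have "norm (F (x + h n *\<^sub>R v) - F (x + 0 *\<^sub>R v)) \<le> B * norm (h n - 0)"
    proof (rule differentiable_bound[where S = UNIV])
      fix t :: real
      show "((\<lambda>t. F (x + t *\<^sub>R v)) has_derivative (\<lambda>s. s *\<^sub>R F' (x + t *\<^sub>R v) v)) (at t within UNIV)"
        using vder[of x t UNIV] by (simp add: has_vector_derivative_def)
      show "onorm (\<lambda>s. s *\<^sub>R F' (x + t *\<^sub>R v) v) \<le> B"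
        using B by (intro onorm_bound) (auto simp: mult.commute[of B] intro: mult_left_mono)
    qed auto
    moreover have "norm (s n x) = norm (F (x + h n *\<^sub>R v) - F x) / h n"
      using h[of n] by (simp add: s_def divide_inverse mult.commute)
    ultimately show ?thesis using True h[of n] by (simp add: pos_divide_le_eq)
  next
    case False
    then have x: "R + norm v < norm x" by simp
    have "norm (h n *\<^sub>R v) \<le> norm v" using h[of n] by (simp add: mult_left_le_one_le)
    then have "R < norm (x + h n *\<^sub>R v)"
      using x norm_diff_ineq[of x "h n *\<^sub>R v"] by linarith
    moreover have "R < norm x" using x norm_ge_zero[of v] by linarith
    ultimately show ?thesis using R False by (simp add: s_def)
  qed
  have [measurable]: "F \<in> borel_measurable borel" "(\<lambda>x. F' x v) \<in> borel_measurable borel"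
    using cont F' by (auto intro: borel_measurable_continuous_onI)
  have "(\<lambda>n. LINT x|lborel. s n x) \<longlonglongrightarrow> (LINT x|lborel. F' x v)"
  proof (rule integral_dominated_convergence[where w = "\<lambda>x. indicator (cball 0 (R + norm v)) x *\<^sub>R B"])
    show "integrable lborel (\<lambda>x. indicator (cball 0 (R + norm v)) x *\<^sub>R B)"
      by (intro borel_integrable_compact) auto
    show "s n \<in> borel_measurable lborel" for n unfolding s_def by measurable
  qed (use lim bound in auto)
  moreover have "(LINT x|lborel. s n x) = 0" for n
  proof -
    have int: "integrable lborel F" by (rule ccs_integrable[OF F])
    have d: "distr lborel borel (\<lambda>x. x + h n *\<^sub>R v) = lborel"
      using lborel_distr_plus[of "h n *\<^sub>R v"] by (simp add: add.commute[of _ "h n *\<^sub>R v"])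
    have "integrable (distr lborel borel (\<lambda>x. x + h n *\<^sub>R v)) F" using int by (simp add: d)
    then have i2: "integrable lborel (\<lambda>x. F (x + h n *\<^sub>R v))"
      by (subst (asm) integrable_distr_eq) auto
    have "(LINT x|lborel. F (x + h n *\<^sub>R v)) = (LINT x|distr lborel borel (\<lambda>x. x + h n *\<^sub>R v). F x)"
      by (subst integral_distr) auto
    also have "\<dots> = (LINT x|lborel. F x)" by (simp add: d)
    finally show ?thesis using int i2 by (simp add: s_def)
  qed
  ultimately show ?thesis by (simp add: LIMSEQ_const_iff)
qed

section \<open>Admissible states\<close>

lemma admissibleD:
  assumes "admissible L \<Lambda> \<Psi>"
  shows "(\<lambda>y. \<Psi> y \<nu>) differentiable (at x)" "continuous_on UNIV (pdiff \<Psi> \<nu> j)"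
    "\<exists>R. \<forall>x. R < norm x \<longrightarrow> \<Psi> x \<nu> = 0" "finite {\<nu>. \<exists>x. \<Psi> x \<nu> \<noteq> 0}"
proof -
  note a = assms[unfolded admissible_def]
  note b = a[THEN conjunct2, THEN conjunct2, THEN spec]
  show "(\<lambda>y. \<Psi> y \<nu>) differentiable (at x)" by (rule b[THEN conjunct1, THEN spec])
  show "continuous_on UNIV (pdiff \<Psi> \<nu> j)" by (rule b[THEN conjunct2, THEN conjunct1, THEN spec])
  show "\<exists>R. \<forall>x. R < norm x \<longrightarrow> \<Psi> x \<nu> = 0" by (rule b[THEN conjunct2, THEN conjunct2])
  show "finite {\<nu>. \<exists>x. \<Psi> x \<nu> \<noteq> 0}" by (rule a[THEN conjunct1])
qed

lemma admissible_has_derivative: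
  assumes "admissible L \<Lambda> \<Psi>"
  shows "((\<lambda>y. \<Psi> y \<nu>) has_derivative (\<lambda>v. \<Sum>j\<in>UNIV. of_real (v $ j) * pdiff \<Psi> \<nu> j x)) (at x)"
proof -
  have "(\<lambda>y. \<Psi> y \<nu>) differentiable (at x)" by (rule admissibleD(1)[OF assms])
  then have d: "((\<lambda>y. \<Psi> y \<nu>) has_derivative frechet_derivative (\<lambda>y. \<Psi> y \<nu>) (at x)) (at x)"
    by (simp add: frechet_derivative_works[symmetric])
  have lin: "linear (frechet_derivative (\<lambda>y. \<Psi> y \<nu>) (at x))"
    using has_derivative_bounded_linear[OF d] by (rule bounded_linear.linear)
  have "frechet_derivative (\<lambda>y. \<Psi> y \<nu>) (at x) v = (\<Sum>j\<in>UNIV. of_real (v $ j) * pdiff \<Psi> \<nu> j x)" for v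
  proof -
    have "frechet_derivative (\<lambda>y. \<Psi> y \<nu>) (at x) v
        = frechet_derivative (\<lambda>y. \<Psi> y \<nu>) (at x) (\<Sum>j\<in>UNIV. v $ j *\<^sub>R axis j 1)"
      using basis_expansion[of v] by (simp add: scalar_mult_eq_scaleR)
    also have "\<dots> = (\<Sum>j\<in>UNIV. of_real (v $ j) * pdiff \<Psi> \<nu> j x)"
      unfolding linear_sum[OF lin] linear_scale[OF lin] pdiff_def scaleR_conv_of_real[where 'a = complex] ..
    finally show ?thesis .
  qed
  then have "frechet_derivative (\<lambda>y. \<Psi> y \<nu>) (at x) = (\<lambda>v. \<Sum>j\<in>UNIV. of_real (v $ j) * pdiff \<Psi> \<nu> j x)"
    by (rule ext)
  with d show ?thesis by simp
qed

lemma admissible_ccs: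
  assumes "admissible L \<Lambda> \<Psi>"
  shows "ccs (\<lambda>x. \<Psi> x \<nu>)"
proof -
  have "continuous_on UNIV (\<lambda>x. \<Psi> x \<nu>)"
    using has_derivative_continuous[OF admissible_has_derivative[OF assms]]
    by (auto intro: continuous_at_imp_continuous_on)
  moreover have "\<exists>R. \<forall>x. R < norm x \<longrightarrow> \<Psi> x \<nu> = 0"
    by (rule admissibleD(3)[OF assms])
  ultimately show ?thesis by (simp add: ccs_def)
qed

lemma admissible_ccs_pdiff:
  assumes "admissible L \<Lambda> \<Psi>"
  shows "ccs (pdiff \<Psi> \<nu> j)"
proof -
  obtain R where R: "\<And>x. R < norm x \<Longrightarrow> \<Psi> x \<nu> = 0"
    using admissible_ccs[OF assms, of \<nu>] unfolding ccs_def by blast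
  have "pdiff \<Psi> \<nu> j x = 0" if "R < norm x" for x
  proof -
    have "0 = (\<Sum>i\<in>UNIV. of_real (axis j 1 $ i) * pdiff \<Psi> \<nu> i x)"
      using fun_cong[OF derivative_eq_0_outside[OF admissible_has_derivative[OF assms] R that], of "axis j 1"]
      by simp
    also have "\<dots> = (\<Sum>i\<in>UNIV. if i = j then pdiff \<Psi> \<nu> i x else 0)"
      by (intro sum.cong) (auto simp: axis_def)
    finally show ?thesis by simp
  qed
  then show ?thesis
    unfolding ccs_def using admissibleD(2)[OF assms] by blast
qed

section \<open>Finite photon supports, uniform in the position\<close>

lemma pdiff_eq_0:
  assumes "\<And>x. \<Psi> x \<nu> = 0"
  shows "pdiff \<Psi> \<nu> j x = 0"
  using assms by (simp add: pdiff_def)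

text \<open>One finite set of configurations serves all positions \<open>x\<close>, so infinite sums
  over configurations become finite sums that can be interchanged with the integral.\<close>

definition photon_support :: "state \<Rightarrow> config set" where
  "photon_support \<Psi> = {\<nu>. \<exists>x. \<Psi> x \<nu> \<noteq> 0}"

lemma finite_photon_support: "admissible L \<Lambda> \<Psi> \<Longrightarrow> finite (photon_support \<Psi>)"
  unfolding photon_support_def by (rule admissibleD(4))

lemma supp_subset_photon_support: "supp (\<Psi> x) \<subseteq> photon_support \<Psi>"
  by (auto simp: supp_def photon_support_def)

lemma supp_pdiff_subset: "supp (\<lambda>\<nu>. pdiff \<Psi> \<nu> j x) \<subseteq> photon_support \<Psi>"
  using pdiff_eq_0[of \<Psi> _ j x] by (auto simp: supp_def photon_support_def)

text \<open>Contains all configurations reached from \<open>S\<close> by adding or removing one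
  photon in a mode of \<open>M\<close>. Natural subtraction fixes a configuration that has no photon
  to remove, which stays inside \<open>S\<close>.\<close>

definition neighbours :: "'m set \<Rightarrow> ('m \<Rightarrow> nat) set \<Rightarrow> ('m \<Rightarrow> nat) set" where
  "neighbours M S = S \<union> (\<Union>m\<in>M. (\<lambda>\<nu>. \<nu>(m := \<nu> m - 1)) ` S \<union> (\<lambda>\<nu>. \<nu>(m := \<nu> m + 1)) ` S)"

lemma finite_neighbours: "finite M \<Longrightarrow> finite S \<Longrightarrow> finite (neighbours M S)"
  by (simp add: neighbours_def)

lemma supp_sum_subset:
  assumes "\<And>i. i \<in> I \<Longrightarrow> supp (F i) \<subseteq> S"
  shows "supp (\<lambda>\<nu>. \<Sum>i\<in>I. F i \<nu>) \<subseteq> S"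
proof
  fix \<nu> assume "\<nu> \<in> supp (\<lambda>\<nu>. \<Sum>i\<in>I. F i \<nu>)"
  then obtain i where "i \<in> I" "F i \<nu> \<noteq> 0"
    unfolding supp_def by (metis (mono_tags, lifting) mem_Collect_eq sum.neutral)
  then show "\<nu> \<in> S" using assms by (auto simp: supp_def)
qed

lemma supp_aop: "supp \<phi> \<subseteq> S \<Longrightarrow> supp (aop M f \<phi>) \<subseteq> neighbours M S"
  unfolding aop_def[abs_def]
proof (rule supp_sum_subset)
  fix m assume "supp \<phi> \<subseteq> S" "m \<in> M"
  have "supp (\<lambda>\<nu>. cnj (f m) * Ann m \<phi> \<nu>) \<subseteq> supp (Ann m \<phi>)" by (rule supp_scale)
  also have "\<dots> \<subseteq> (\<lambda>\<nu>. \<nu>(m := \<nu> m - 1)) ` supp \<phi>" by (rule supp_Ann)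
  also have "\<dots> \<subseteq> (\<lambda>\<nu>. \<nu>(m := \<nu> m - 1)) ` S" using \<open>supp \<phi> \<subseteq> S\<close> by (rule image_mono)
  also have "\<dots> \<subseteq> neighbours M S" unfolding neighbours_def using \<open>m \<in> M\<close> by blast
  finally show "supp (\<lambda>\<nu>. cnj (f m) * Ann m \<phi> \<nu>) \<subseteq> neighbours M S" .
qed

lemma supp_cop: "supp \<phi> \<subseteq> S \<Longrightarrow> supp (cop M f \<phi>) \<subseteq> neighbours M S"
  unfolding cop_def[abs_def]
proof (rule supp_sum_subset)
  fix m assume "supp \<phi> \<subseteq> S" "m \<in> M"
  have "supp (\<lambda>\<nu>. f m * Cre m \<phi> \<nu>) \<subseteq> supp (Cre m \<phi>)" by (rule supp_scale)
  also have "\<dots> \<subseteq> (\<lambda>\<nu>. \<nu>(m := \<nu> m + 1)) ` supp \<phi>" by (rule supp_Cre)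
  also have "\<dots> \<subseteq> (\<lambda>\<nu>. \<nu>(m := \<nu> m + 1)) ` S" using \<open>supp \<phi> \<subseteq> S\<close> by (rule image_mono)
  also have "\<dots> \<subseteq> neighbours M S" unfolding neighbours_def using \<open>m \<in> M\<close> by blast
  finally show "supp (\<lambda>\<nu>. f m * Cre m \<phi> \<nu>) \<subseteq> neighbours M S" .
qed

text \<open>The form factor for which component \<open>j\<close> of the potential is
  \<open>aop\<close> plus \<open>cop\<close>. The phase carries a minus sign because
  \<open>aop\<close> conjugates its form factor.\<close>

definition coupling :: "real \<Rightarrow> (nat \<Rightarrow> real^3 \<Rightarrow> real^3) \<Rightarrow> 3 \<Rightarrow> real^3 \<Rightarrow> mode \<Rightarrow> complex" where
  "coupling L \<epsilon> j x m = of_real (1 / sqrt (2 * L ^ 3) * (1 / sqrt (norm (kvec L (fst m)))) *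
      (\<epsilon> (snd m) (kvec L (fst m)) $ j)) * cis (- (x \<bullet> kvec L (fst m)))"

lemma field_A_eq:
  "field_A L \<Lambda> \<epsilon> j x \<phi> = (\<lambda>\<nu>. aop (modes L \<Lambda>) (coupling L \<epsilon> j x) \<phi> \<nu> + cop (modes L \<Lambda>) (coupling L \<epsilon> j x) \<phi> \<nu>)"
  unfolding field_A_def[abs_def] aop_def cop_def sum.distrib[symmetric] sum_distrib_left
  by (intro ext sum.cong refl) (simp add: coupling_def Ann_def Cre_def cis_cnj algebra_simps)

lemma kvec_nth: "kvec L n $ i = 2 * pi / L * real_of_int ((vector [fst n, fst (snd n), snd (snd n)] :: int^3) $ i)"
  by (cases n) (use exhaust_3[of i] in \<open>auto simp: kvec_def vector_3\<close>)

lemma norm_kvec: "0 < L \<Longrightarrow> (norm (kvec L (a, b, c)))\<^sup>2 = (2 * pi / L)\<^sup>2 * (real_of_int a ^ 2 + real_of_int b ^ 2 + real_of_int c ^ 2)"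
  unfolding power2_norm_eq_inner inner_vec_def sum_3
  by (simp add: kvec_nth vector_3 power2_eq_square algebra_simps add_divide_distrib)

lemma finite_modes:
  assumes "0 < L"
  shows "finite (modes L \<Lambda>)"
proof -
  define K where "K = \<lceil>\<Lambda> * L / (2 * pi)\<rceil>"
  have "modes L \<Lambda> \<subseteq> ({-K..K} \<times> {-K..K} \<times> {-K..K}) \<times> {1, 2}"
  proof
    fix m assume "m \<in> modes L \<Lambda>"
    then obtain a b c lam where m: "m = ((a, b, c), lam)" and lam: "lam \<in> {1, 2}" and n: "norm (kvec L (a, b, c)) < \<Lambda>"
      by (auto simp: modes_def)
    have "\<bar>kvec L (a, b, c) $ i\<bar> < \<Lambda>" for i using n component_le_norm_cart[of "kvec L (a, b, c)" i] by linarith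
    from this[of 1] this[of 2] this[of 3]
    have "2 * pi / L * \<bar>real_of_int z\<bar> < \<Lambda>" if "z \<in> {a, b, c}" for z
      using that assms by (auto simp: kvec_nth vector_3 abs_mult)
    then have "\<bar>real_of_int z\<bar> < \<Lambda> * L / (2 * pi)" if "z \<in> {a, b, c}" for z
      using that assms by (fastforce simp: field_simps)
    moreover have "\<Lambda> * L / (2 * pi) \<le> real_of_int K" unfolding K_def by (rule le_of_int_ceiling)
    ultimately have "real_of_int \<bar>z\<bar> \<le> real_of_int K" if "z \<in> {a, b, c}" for z
      using that unfolding of_int_abs by (meson less_imp_le less_le_trans)
    then have "\<bar>z\<bar> \<le> K" if "z \<in> {a, b, c}" for z
      using that by (simp only: of_int_le_iff)
    then have "\<bar>a\<bar> \<le> K" "\<bar>b\<bar> \<le> K" "\<bar>c\<bar> \<le> K" by auto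
    then show "m \<in> ({-K..K} \<times> {-K..K} \<times> {-K..K}) \<times> {1, 2}" using lam by (auto simp: m abs_le_iff)
  qed
  then show ?thesis by (rule finite_subset) auto
qed

lemma modes_pos: "m \<in> modes L \<Lambda> \<Longrightarrow> 0 < norm (kvec L (fst m))"
  and modes_less: "m \<in> modes L \<Lambda> \<Longrightarrow> norm (kvec L (fst m)) < \<Lambda>"
  by (auto simp: modes_def)

definition kinetic_vec :: "real \<Rightarrow> real \<Rightarrow> real \<Rightarrow> (nat \<Rightarrow> real^3 \<Rightarrow> real^3) \<Rightarrow> state \<Rightarrow> 3 \<Rightarrow> real^3 \<Rightarrow> config \<Rightarrow> complex" where
  "kinetic_vec \<alpha> L \<Lambda> \<epsilon> \<Psi> j x \<nu> =
     - \<i> * pdiff \<Psi> \<nu> j x + complex_of_real (sqrt \<alpha>) * field_A L \<Lambda> \<epsilon> j x (\<Psi> x) \<nu>"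

lemma integral_infsum_finite:
  fixes F :: "real^3 \<Rightarrow> config \<Rightarrow> real"
  assumes "finite S" "\<And>x \<nu>. \<nu> \<notin> S \<Longrightarrow> F x \<nu> = 0" "\<And>\<nu>. \<nu> \<in> S \<Longrightarrow> integrable lborel (\<lambda>x. F x \<nu>)"
  shows "infsum (\<lambda>\<nu>. LINT x|lborel. F x \<nu>) UNIV = (LINT x|lborel. (\<Sum>\<nu>\<in>S. F x \<nu>))"
proof -
  have "infsum (\<lambda>\<nu>. LINT x|lborel. F x \<nu>) UNIV = infsum (\<lambda>\<nu>. LINT x|lborel. F x \<nu>) S"
    using assms(2) by (intro infsum_cong_neutral) auto
  also have "\<dots> = (\<Sum>\<nu>\<in>S. LINT x|lborel. F x \<nu>)" using assms(1) by simp
  also have "\<dots> = (LINT x|lborel. (\<Sum>\<nu>\<in>S. F x \<nu>))" using assms(3) by (simp add: Bochner_Integration.integral_sum)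
  finally show ?thesis .
qed

lemma ccs_cmod_sq: "ccs F \<Longrightarrow> ccs (\<lambda>x. (cmod (F x))\<^sup>2)"
  by (rule ccs_compose[where h = "\<lambda>z. (cmod z)\<^sup>2"]) (auto intro!: continuous_intros)

lemma norm_sq_eq:
  assumes "admissible L \<Lambda> \<Psi>"
  shows "norm_sq \<Psi> = (LINT x|lborel. nsq (\<Psi> x))" "integrable lborel (\<lambda>x. nsq (\<Psi> x))"
proof -
  let ?S = "photon_support \<Psi>"
  have eq: "nsq (\<Psi> x) = (\<Sum>\<nu>\<in>?S. (cmod (\<Psi> x \<nu>))\<^sup>2)" for x
    by (rule nsq_eq_sum[OF finite_photon_support[OF assms] supp_subset_photon_support])
  have int: "integrable lborel (\<lambda>x. (cmod (\<Psi> x \<nu>))\<^sup>2)" for \<nu>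
    by (intro ccs_integrable ccs_cmod_sq admissible_ccs[OF assms])
  show "norm_sq \<Psi> = (LINT x|lborel. nsq (\<Psi> x))"
    unfolding norm_sq_def eq
    by (rule integral_infsum_finite) (use finite_photon_support[OF assms] int in \<open>auto simp: photon_support_def\<close>)
  show "integrable lborel (\<lambda>x. nsq (\<Psi> x))"
    unfolding eq using int by simp
qed

text \<open>All kinetic vectors have their support in the neighbours of the photon support, a finite
  set independent of \<open>x\<close>. The energy thereby becomes an integral over \<open>x\<close>
  of Fock space norms, so that estimates can be made at fixed \<open>x\<close>.\<close>

lemma energy_form_eq:
  assumes "0 < L" and adm: "admissible L \<Lambda> \<Psi>"
  shows "energy_form \<alpha> L \<Lambda> \<epsilon> \<Psi> = 1 / 2 * (\<Sum>j\<in>UNIV. LINT x|lborel. nsq (kinetic_vec \<alpha> L \<Lambda> \<epsilon> \<Psi> j x)) +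
      (LINT x|lborel. (\<Sum>m\<in>modes L \<Lambda>. norm (kvec L (fst m)) * nsq (Ann m (\<Psi> x))))"
    and "integrable lborel (\<lambda>x. nsq (kinetic_vec \<alpha> L \<Lambda> \<epsilon> \<Psi> j x))"
    and "integrable lborel (\<lambda>x. \<Sum>m\<in>modes L \<Lambda>. norm (kvec L (fst m)) * nsq (Ann m (\<Psi> x)))"
proof -
  let ?M = "modes L \<Lambda>"
  let ?S = "photon_support \<Psi>"
  let ?T = "neighbours ?M ?S"
  have M: "finite ?M" by (rule finite_modes[OF assms(1)])
  have S: "finite ?S" by (rule finite_photon_support[OF adm])
  have T: "finite ?T" by (rule finite_neighbours[OF M S])
  have sub: "supp (kinetic_vec \<alpha> L \<Lambda> \<epsilon> \<Psi> j x) \<subseteq> ?T" for j x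
  proof -
    have "supp (kinetic_vec \<alpha> L \<Lambda> \<epsilon> \<Psi> j x) \<subseteq> supp (\<lambda>\<nu>. pdiff \<Psi> \<nu> j x) \<union> supp (field_A L \<Lambda> \<epsilon> j x (\<Psi> x))"
      by (auto simp: supp_def kinetic_vec_def)
    moreover have "supp (field_A L \<Lambda> \<epsilon> j x (\<Psi> x)) \<subseteq> ?T"
      unfolding field_A_eq using supp_add supp_aop[OF supp_subset_photon_support] supp_cop[OF supp_subset_photon_support]
      by fast
    moreover have "supp (\<lambda>\<nu>. pdiff \<Psi> \<nu> j x) \<subseteq> ?T"
      using supp_pdiff_subset by (fastforce simp: neighbours_def)
    ultimately show ?thesis by blast
  qed
  have eq: "nsq (kinetic_vec \<alpha> L \<Lambda> \<epsilon> \<Psi> j x) = (\<Sum>\<nu>\<in>?T. (cmod (kinetic_vec \<alpha> L \<Lambda> \<epsilon> \<Psi> j x \<nu>))\<^sup>2)" for j x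
    by (rule nsq_eq_sum[OF T sub])
  have "ccs (\<lambda>x. kinetic_vec \<alpha> L \<Lambda> \<epsilon> \<Psi> j x \<nu>)" for j \<nu>
  proof -
    have c: "continuous_on UNIV (\<lambda>x. coupling L \<epsilon> j x m)" for m
      unfolding coupling_def cis_conv_exp by (intro continuous_intros)
    have "ccs (\<lambda>x. Ann m (\<Psi> x) \<nu>)" for m
      unfolding Ann_def by (intro ccs_mult_left admissible_ccs[OF adm] continuous_intros)
    moreover have "ccs (\<lambda>x. Cre m (\<Psi> x) \<nu>)" for m
      unfolding Cre_def
      by (cases "0 < \<nu> m") (auto intro!: ccs_mult_left admissible_ccs[OF adm] continuous_intros ccs_zero)
    ultimately have "ccs (\<lambda>x. field_A L \<Lambda> \<epsilon> j x (\<Psi> x) \<nu>)"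
      unfolding field_A_eq aop_def cop_def
      by (intro ccs_add ccs_sum ccs_mult_left continuous_intros c)
    then show ?thesis unfolding kinetic_vec_def
      by (intro ccs_add ccs_mult_left continuous_intros admissible_ccs_pdiff[OF adm])
  qed
  then have int: "integrable lborel (\<lambda>x. (cmod (kinetic_vec \<alpha> L \<Lambda> \<epsilon> \<Psi> j x \<nu>))\<^sup>2)" for j \<nu>
    by (intro ccs_integrable ccs_cmod_sq)
  show "integrable lborel (\<lambda>x. nsq (kinetic_vec \<alpha> L \<Lambda> \<epsilon> \<Psi> j x))" unfolding eq using int by simp
  have kin: "infsum (\<lambda>\<nu>. LINT x|lborel. (cmod (kinetic_vec \<alpha> L \<Lambda> \<epsilon> \<Psi> j x \<nu>))\<^sup>2) UNIV
      = (LINT x|lborel. nsq (kinetic_vec \<alpha> L \<Lambda> \<epsilon> \<Psi> j x))" for j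
    unfolding eq by (rule integral_infsum_finite[OF T _ int]) (use sub in \<open>auto simp: supp_def\<close>)
  have eqf: "(\<Sum>m\<in>?M. norm (kvec L (fst m)) * nsq (Ann m (\<Psi> x))) =
      (\<Sum>\<nu>\<in>?S. (\<Sum>m\<in>?M. norm (kvec L (fst m)) * real (\<nu> m)) * (cmod (\<Psi> x \<nu>))\<^sup>2)" for x
    unfolding nsq_Ann[OF S supp_subset_photon_support] sum_distrib_left sum_distrib_right
    by (subst sum.swap) (simp add: mult.assoc)
  have int2: "integrable lborel (\<lambda>x. (\<Sum>m\<in>?M. norm (kvec L (fst m)) * real (\<nu> m)) * (cmod (\<Psi> x \<nu>))\<^sup>2)" for \<nu>
    by (intro integrable_mult_right ccs_integrable ccs_cmod_sq admissible_ccs[OF adm])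
  show "integrable lborel (\<lambda>x. \<Sum>m\<in>?M. norm (kvec L (fst m)) * nsq (Ann m (\<Psi> x)))"
    unfolding eqf using int2 by simp
  have fld: "infsum (\<lambda>\<nu>. (\<Sum>m\<in>?M. norm (kvec L (fst m)) * real (\<nu> m)) * (LINT x|lborel. (cmod (\<Psi> x \<nu>))\<^sup>2)) UNIV
      = (LINT x|lborel. (\<Sum>m\<in>?M. norm (kvec L (fst m)) * nsq (Ann m (\<Psi> x))))"
    unfolding eqf
    by (subst integral_infsum_finite[OF S _ int2, symmetric])
      (auto simp: photon_support_def)
  show "energy_form \<alpha> L \<Lambda> \<epsilon> \<Psi> = 1 / 2 * (\<Sum>j\<in>UNIV. LINT x|lborel. nsq (kinetic_vec \<alpha> L \<Lambda> \<epsilon> \<Psi> j x)) +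
      (LINT x|lborel. (\<Sum>m\<in>?M. norm (kvec L (fst m)) * nsq (Ann m (\<Psi> x))))"
    unfolding energy_form_def fld kin[symmetric] by (simp only: kinetic_vec_def)
qed

section \<open>The lower bound\<close>

lemma polarization_inner:
  assumes "valid_polarization L \<epsilon>" "m \<in> modes L \<Lambda>"
  shows "\<epsilon> (snd m) (kvec L (fst m)) \<bullet> kvec L (fst m) = 0" "norm (\<epsilon> (snd m) (kvec L (fst m))) = 1"
proof -
  have k: "kvec L (fst m) \<noteq> 0" using modes_pos[OF assms(2)] by auto
  have s: "snd m \<in> {1, 2}" using assms(2) by (auto simp: modes_def)
  note v = assms(1)[unfolded valid_polarization_def, rule_format, OF k]
  show "\<epsilon> (snd m) (kvec L (fst m)) \<bullet> kvec L (fst m) = 0" using v s by blast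
  have "\<epsilon> (snd m) (kvec L (fst m)) \<bullet> \<epsilon> (snd m) (kvec L (fst m)) = 1" using v s by auto
  then show "norm (\<epsilon> (snd m) (kvec L (fst m))) = 1" by (simp add: norm_eq_sqrt_inner)
qed

lemma sum_component_sq: "(\<Sum>j\<in>UNIV. ((v :: real^3) $ j)\<^sup>2) = (norm v)\<^sup>2"
  unfolding power2_norm_eq_inner inner_vec_def by (simp add: power2_eq_square)

text \<open>The sum of \<open>aop\<close> and \<open>cop\<close> is symmetric and their difference
  antisymmetric, so twice the real part is the expectation of their commutator, the scalar
  \<open>- 2 * Re (mip M g h)\<close>. In components, the quadratic terms cancel in conjugate
  pairs.\<close>

lemma Re_ip_field_conjugate:
  assumes M: "finite M" and fs: "finite (supp \<phi>)"
  shows "Re (ip (\<lambda>\<nu>. aop M g \<phi> \<nu> + cop M g \<phi> \<nu>) (\<lambda>\<nu>. aop M h \<phi> \<nu> - cop M h \<phi> \<nu>)) = - Re (mip M g h) * nsq \<phi>"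
proof -
  have "ip (cop M g \<phi>) (cop M h \<phi>) = ip \<phi> (aop M g (cop M h \<phi>))"
    using fs by (simp add: ip_cop_left finite_supp_cop)
  also have "aop M g (cop M h \<phi>) = (\<lambda>\<nu>. cop M h (aop M g \<phi>) \<nu> + mip M g h * \<phi> \<nu>)"
    using M by (auto simp: aop_cop)
  also have "ip \<phi> \<dots> = ip (aop M h \<phi>) (aop M g \<phi>) + mip M g h * of_real (nsq \<phi>)"
    using fs by (simp add: ip_add_right ip_scale_right ip_aop_left ip_self)
  also have "ip (aop M h \<phi>) (aop M g \<phi>) = cnj (ip (aop M g \<phi>) (aop M h \<phi>))"
    using fs by (simp add: ip_cnj finite_supp_aop)
  finally have 1: "ip (cop M g \<phi>) (cop M h \<phi>) = cnj (ip (aop M g \<phi>) (aop M h \<phi>)) + mip M g h * of_real (nsq \<phi>)" .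
  have "ip (cop M g \<phi>) (aop M h \<phi>) = ip (cop M h (cop M g \<phi>)) \<phi>"
    using fs by (simp add: ip_cop_left finite_supp_cop)
  also have "\<dots> = cnj (ip \<phi> (cop M g (cop M h \<phi>)))"
    using fs by (simp add: ip_cnj finite_supp_cop cop_cop[of M h])
  also have "ip \<phi> (cop M g (cop M h \<phi>)) = ip (aop M g \<phi>) (cop M h \<phi>)"
    using fs by (simp add: ip_aop_left)
  finally have 2: "ip (cop M g \<phi>) (aop M h \<phi>) = cnj (ip (aop M g \<phi>) (cop M h \<phi>))" .
  show ?thesis
    using fs by (simp add: ip_add_left ip_diff_right finite_supp_aop finite_supp_cop 1 2 algebra_simps)
qed

text \<open>Up to a constant factor the form factor of the electric field, the variable conjugate to
  the potential. The weight \<open>sqrt |k|\<close> cancels \<open>1 / sqrt |k|\<close> in the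
  coupling, so every mode contributes equally to the commutator.\<close>

definition conjugate_coupling :: "real \<Rightarrow> (nat \<Rightarrow> real^3 \<Rightarrow> real^3) \<Rightarrow> 3 \<Rightarrow> real^3 \<Rightarrow> mode \<Rightarrow> complex" where
  "conjugate_coupling L \<epsilon> j x m = of_real (sqrt (norm (kvec L (fst m))) * \<epsilon> (snd m) (kvec L (fst m)) $ j) *
     cis (- (x \<bullet> kvec L (fst m)))"

definition polarized_current :: "real \<Rightarrow> (nat \<Rightarrow> real^3 \<Rightarrow> real^3) \<Rightarrow> state \<Rightarrow> mode \<Rightarrow> real^3 \<Rightarrow> complex" where
  "polarized_current L \<epsilon> \<Psi> m x = cis (x \<bullet> kvec L (fst m)) *
     (\<Sum>j\<in>UNIV. of_real (\<epsilon> (snd m) (kvec L (fst m)) $ j) *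
       (ip (\<lambda>\<nu>. pdiff \<Psi> \<nu> j x) (Ann m (\<Psi> x)) + ip (\<Psi> x) (Ann m (\<lambda>\<nu>. pdiff \<Psi> \<nu> j x))))"

text \<open>The current is the derivative of \<open>cis (x \<bullet> k) * ip (\<Psi> x) (Ann m (\<Psi> x))\<close> in the direction of the
  polarization vector, which is orthogonal to \<open>k\<close>.\<close>
lemma integral_polarized_current:
  assumes adm: "admissible L \<Lambda> \<Psi>" and pol: "valid_polarization L \<epsilon>" and m: "m \<in> modes L \<Lambda>"
  shows "integrable lborel (polarized_current L \<epsilon> \<Psi> m)" "(LINT x|lborel. polarized_current L \<epsilon> \<Psi> m x) = 0"
proof -
  let ?S = "photon_support \<Psi>"
  define k where "k = kvec L (fst m)"
  define e where "e = \<epsilon> (snd m) k"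
  define up where "up \<nu> = \<nu>(m := \<nu> m + 1)" for \<nu> :: config
  define s where "s \<nu> = complex_of_real (sqrt (real (\<nu> m + 1)))" for \<nu> :: config
  define D where "D x \<nu> v = (\<Sum>j\<in>UNIV. of_real (v $ j) * pdiff \<Psi> \<nu> j x)" for x \<nu> and v :: "real^3"
  have S: "finite ?S" by (rule finite_photon_support[OF adm])
  define F where "F x = cis (x \<bullet> k) * (\<Sum>\<nu>\<in>?S. cnj (\<Psi> x \<nu>) * (s \<nu> * \<Psi> x (up \<nu>)))" for x
  define F' where "F' x v = cis (x \<bullet> k) * (\<Sum>\<nu>\<in>?S. cnj (\<Psi> x \<nu>) * (s \<nu> * D x (up \<nu>) v) + cnj (D x \<nu> v) * (s \<nu> * \<Psi> x (up \<nu>)))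
      + (of_real (v \<bullet> k) * \<i> * cis (x \<bullet> k)) * (\<Sum>\<nu>\<in>?S. cnj (\<Psi> x \<nu>) * (s \<nu> * \<Psi> x (up \<nu>)))" for x v
  have dcis: "((\<lambda>x. cis (x \<bullet> k)) has_derivative (\<lambda>v. of_real (v \<bullet> k) * \<i> * cis (x \<bullet> k))) (at x)" for x
  proof -
    have "((\<lambda>x. \<i> * of_real (x \<bullet> k)) has_derivative (\<lambda>v. \<i> * of_real (v \<bullet> k))) (at x)"
      by (intro has_derivative_mult_right has_derivative_of_real has_derivative_inner_left has_derivative_ident)
    from has_derivative_compose[OF this DERIV_exp[unfolded has_field_derivative_def]]
    show ?thesis unfolding cis_conv_exp by (simp add: mult_ac)
  qed
  have dPsi: "((\<lambda>x. \<Psi> x \<nu>) has_derivative D x \<nu>) (at x)" for x \<nu>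
    using admissible_has_derivative[OF adm] unfolding D_def .
  have dcnj: "((\<lambda>x. cnj (\<Psi> x \<nu>)) has_derivative (\<lambda>v. cnj (D x \<nu> v))) (at x)" for x \<nu>
    by (rule bounded_linear.has_derivative[OF bounded_linear_cnj dPsi])
  have der: "(F has_derivative F' x) (at x)" for x
    unfolding F_def F'_def
    by (intro has_derivative_mult has_derivative_sum dcis dcnj dPsi has_derivative_mult_right)
  have ccsPsi: "ccs (\<lambda>x. \<Psi> x \<nu>)" and ccsD: "ccs (\<lambda>x. D x \<nu> v)" for \<nu> v
    unfolding D_def by (intro ccs_sum ccs_mult_left admissible_ccs[OF adm] admissible_ccs_pdiff[OF adm] continuous_intros)+
  have cont: "continuous_on UNIV (\<lambda>x. \<Psi> x \<nu>)" "continuous_on UNIV (\<lambda>x. D x \<nu> v)" "continuous_on UNIV (\<lambda>x. cis (x \<bullet> k))" for \<nu> v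
    using ccsPsi ccsD unfolding ccs_def cis_conv_exp by (auto intro!: continuous_intros)
  have F: "ccs F" unfolding F_def
    by (intro ccs_mult_left ccs_sum continuous_intros cont ccsPsi)
  have G: "ccs (\<lambda>x. F' x v)" for v unfolding F'_def
    by (intro ccs_add ccs_mult_left ccs_sum continuous_intros cont ccsPsi ccsD)
  have ek: "e \<bullet> k = 0" using polarization_inner[OF pol m] by (simp add: e_def k_def)
  have eq: "polarized_current L \<epsilon> \<Psi> m x = F' x e" for x
  proof -
    have a: "ip (\<lambda>\<nu>. pdiff \<Psi> \<nu> j x) (Ann m (\<Psi> x)) = (\<Sum>\<nu>\<in>?S. cnj (pdiff \<Psi> \<nu> j x) * (s \<nu> * \<Psi> x (up \<nu>)))" for j
      by (subst ip_eq_sum[OF S supp_pdiff_subset]) (simp add: Ann_def s_def up_def)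
    have b: "ip (\<Psi> x) (Ann m (\<lambda>\<nu>. pdiff \<Psi> \<nu> j x)) = (\<Sum>\<nu>\<in>?S. cnj (\<Psi> x \<nu>) * (s \<nu> * pdiff \<Psi> (up \<nu>) j x))" for j
      by (subst ip_eq_sum[OF S supp_subset_photon_support]) (simp add: Ann_def s_def up_def)
    have "(\<Sum>j\<in>UNIV. of_real (e $ j) * (ip (\<lambda>\<nu>. pdiff \<Psi> \<nu> j x) (Ann m (\<Psi> x)) + ip (\<Psi> x) (Ann m (\<lambda>\<nu>. pdiff \<Psi> \<nu> j x))))
      = (\<Sum>j\<in>UNIV. \<Sum>\<nu>\<in>?S. of_real (e $ j) * (cnj (\<Psi> x \<nu>) * (s \<nu> * pdiff \<Psi> (up \<nu>) j x) + cnj (pdiff \<Psi> \<nu> j x) * (s \<nu> * \<Psi> x (up \<nu>))))"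
      unfolding a b by (simp add: sum_distrib_left sum.distrib distrib_left add.commute)
    also have "\<dots> = (\<Sum>\<nu>\<in>?S. cnj (\<Psi> x \<nu>) * (s \<nu> * D x (up \<nu>) e) + cnj (D x \<nu> e) * (s \<nu> * \<Psi> x (up \<nu>)))"
      unfolding D_def
      by (subst sum.swap) (simp add: sum_distrib_left sum_distrib_right sum.distrib distrib_left mult_ac)
    finally show ?thesis
      unfolding polarized_current_def F'_def k_def[symmetric] e_def[symmetric] by (simp add: ek)
  qed
  show "integrable lborel (polarized_current L \<epsilon> \<Psi> m)"
    using ccs_integrable[OF G[of e]] by (simp add: eq[abs_def])
  have "continuous_on UNIV (\<lambda>x. F' x e)" using G unfolding ccs_def by blast
  then show "(LINT x|lborel. polarized_current L \<epsilon> \<Psi> m x) = 0"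
    unfolding eq by (rule integral_derivative_eq_0[OF der F])
qed

text \<open>Adjointness moves the creation operator onto the derivative as an annihilation operator;
  conjugation and the factor \<i> turn the minus sign into a plus. The two terms then form the
  product rule derivative of \<open>ip \<phi> (Ann m \<phi>)\<close>, which is what makes the cross
  term a divergence.\<close>

lemma Re_ip_derivative_conjugate:
  assumes M: "finite M" and fs: "finite (supp \<phi>)" and D: "\<And>j. finite (supp (D j))"
    and h: "\<And>j m. m \<in> M \<Longrightarrow> h j m = of_real (w m * e m $ j) * cis (- \<theta> m)"
  shows "(\<Sum>j\<in>UNIV. Re (ip (\<lambda>\<nu>. - \<i> * D j \<nu>) (\<lambda>\<nu>. aop M (h j) \<phi> \<nu> - cop M (h j) \<phi> \<nu>))) =
    (\<Sum>m\<in>M. w m * Re (\<i> * (cis (\<theta> m) * (\<Sum>j\<in>(UNIV :: 'n::finite set). of_real ((e m :: real^'n) $ j) *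
      (ip (D j) (Ann m \<phi>) + ip \<phi> (Ann m (D j)))))))"
proof -
  have "Re (ip (\<lambda>\<nu>. - \<i> * D j \<nu>) (\<lambda>\<nu>. aop M (h j) \<phi> \<nu> - cop M (h j) \<phi> \<nu>)) =
      (\<Sum>m\<in>M. w m * Re (\<i> * (cis (\<theta> m) * (of_real (e m $ j) * (ip (D j) (Ann m \<phi>) + ip \<phi> (Ann m (D j)))))))" for j
  proof -
    have "ip (D j) (cop M (h j) \<phi>) = cnj (ip \<phi> (aop M (h j) (D j)))"
      using fs D by (metis finite_supp_aop ip_aop_left ip_cnj)
    then have "Re (ip (\<lambda>\<nu>. - \<i> * D j \<nu>) (\<lambda>\<nu>. aop M (h j) \<phi> \<nu> - cop M (h j) \<phi> \<nu>)) =
      Re (\<i> * (ip (D j) (aop M (h j) \<phi>) + ip \<phi> (aop M (h j) (D j))))"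
      unfolding ip_scale_left[OF D] ip_diff_right by (simp add: algebra_simps)
    also have "ip (D j) (aop M (h j) \<phi>) + ip \<phi> (aop M (h j) (D j)) =
       (\<Sum>m\<in>M. cnj (h j m) * (ip (D j) (Ann m \<phi>) + ip \<phi> (Ann m (D j))))"
      unfolding aop_def[abs_def] ip_sum_right ip_scale_right by (simp add: sum.distrib distrib_left)
    also have "Re (\<i> * \<dots>) = (\<Sum>m\<in>M. w m * Re (\<i> * (cis (\<theta> m) * (of_real (e m $ j) * (ip (D j) (Ann m \<phi>) + ip \<phi> (Ann m (D j)))))))"
      unfolding sum_distrib_left Re_sum
    proof (intro sum.cong refl)
      fix m assume m: "m \<in> M"
      have "\<i> * (cnj (h j m) * z) = of_real (w m) * (\<i> * (cis (\<theta> m) * (of_real (e m $ j) * z)))" for z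
        using h[OF m, of j] by (simp add: cis_cnj mult_ac)
      then show "Re (\<i> * (cnj (h j m) * (ip (D j) (Ann m \<phi>) + ip \<phi> (Ann m (D j))))) =
        w m * Re (\<i> * (cis (\<theta> m) * (of_real (e m $ j) * (ip (D j) (Ann m \<phi>) + ip \<phi> (Ann m (D j))))))"
        by (simp only: Re_complex_of_real Im_complex_of_real times_complex.sel mult_zero_left diff_0_right)
    qed
    finally show ?thesis .
  qed
  then have "(\<Sum>j\<in>UNIV. Re (ip (\<lambda>\<nu>. - \<i> * D j \<nu>) (\<lambda>\<nu>. aop M (h j) \<phi> \<nu> - cop M (h j) \<phi> \<nu>))) =
     (\<Sum>m\<in>M. \<Sum>j\<in>UNIV. w m * Re (\<i> * (cis (\<theta> m) * (of_real (e m $ j) * (ip (D j) (Ann m \<phi>) + ip \<phi> (Ann m (D j)))))))"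
    by (simp only:) (rule sum.swap)
  also have "\<dots> = (\<Sum>m\<in>M. w m * Re (\<i> * (cis (\<theta> m) * (\<Sum>j\<in>UNIV. of_real (e m $ j) *
      (ip (D j) (Ann m \<phi>) + ip \<phi> (Ann m (D j)))))))"
    unfolding sum_distrib_left Re_sum ..
  finally show ?thesis .
qed

text \<open>The square is expanded at fixed \<open>x\<close>. The current term has to stay, since
  only its integral over \<open>x\<close> vanishes.\<close>

lemma energy_lower_bound_pointwise:
  assumes L: "0 < L" and pol: "valid_polarization L \<epsilon>" and adm: "admissible L \<Lambda> \<Psi>"
  shows "2 * t * sqrt \<alpha> * (1 / sqrt (2 * L ^ 3)) * card (modes L \<Lambda>) * nsq (\<Psi> x) \<le>
    (\<Sum>j\<in>UNIV. nsq (kinetic_vec \<alpha> L \<Lambda> \<epsilon> \<Psi> j x))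
    + 2 * t * (\<Sum>m\<in>modes L \<Lambda>. sqrt (norm (kvec L (fst m))) * Re (\<i> * polarized_current L \<epsilon> \<Psi> m x))
    + t\<^sup>2 * card (modes L \<Lambda>) * (4 * (\<Sum>m\<in>modes L \<Lambda>. norm (kvec L (fst m)) * nsq (Ann m (\<Psi> x))) + 2 * \<Lambda> * nsq (\<Psi> x))"
proof -
  let ?M = "modes L \<Lambda>"
  define k where "k m = kvec L (fst m)" for m :: mode
  define w where "w m = norm (k m)" for m
  define e where "e m = \<epsilon> (snd m) (k m)" for m
  define \<phi> where "\<phi> = \<Psi> x"
  define D where "D j \<nu> = pdiff \<Psi> \<nu> j x" for j \<nu>
  define g where "g j = coupling L \<epsilon> j x" for j
  define h where "h j = conjugate_coupling L \<epsilon> j x" for j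
  define v where "v j = kinetic_vec \<alpha> L \<Lambda> \<epsilon> \<Psi> j x" for j
  define A where "A j \<nu> = aop ?M (g j) \<phi> \<nu> + cop ?M (g j) \<phi> \<nu>" for j \<nu>
  define Y where "Y j \<nu> = aop ?M (h j) \<phi> \<nu> - cop ?M (h j) \<phi> \<nu>" for j \<nu>
  define N where "N = real (card ?M)"
  define H where "H = (\<Sum>m\<in>?M. w m * nsq (Ann m \<phi>))"
  have M: "finite ?M" by (rule finite_modes[OF L])
  have fs: "finite (supp \<phi>)"
    unfolding \<phi>_def by (rule finite_subset[OF supp_subset_photon_support finite_photon_support[OF adm]])
  have fD: "finite (supp (D j))" for j
    unfolding D_def by (rule finite_subset[OF supp_pdiff_subset finite_photon_support[OF adm]])
  have fA: "finite (supp (A j))" for j unfolding A_def using fs by auto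
  have fY: "finite (supp (Y j))" for j unfolding Y_def using fs by auto
  have wpos: "0 < w m" if "m \<in> ?M" for m using modes_pos[OF that] by (simp add: w_def k_def)
  have enorm: "norm (e m) = 1" if "m \<in> ?M" for m
    using polarization_inner[OF pol that] by (simp add: e_def k_def)
  have v_eq: "v j = (\<lambda>\<nu>. - \<i> * D j \<nu> + of_real (sqrt \<alpha>) * A j \<nu>)" for j
    unfolding v_def kinetic_vec_def[abs_def] field_A_eq D_def A_def g_def \<phi>_def ..
  have fv: "finite (supp (v j))" for j
    unfolding v_eq by (intro finite_supp_add finite_supp_scale fD fA)
  have hm: "h j m = of_real (sqrt (w m) * e m $ j) * cis (- (x \<bullet> k m))" for j m
    by (simp add: h_def conjugate_coupling_def w_def k_def e_def)
  have gm: "g j m = of_real (1 / sqrt (2 * L ^ 3) * (1 / sqrt (w m)) * e m $ j) * cis (- (x \<bullet> k m))" for j m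
    by (simp add: g_def coupling_def w_def k_def e_def)
  have cur: "(\<Sum>j\<in>UNIV. Re (ip (\<lambda>\<nu>. - \<i> * D j \<nu>) (Y j))) =
      (\<Sum>m\<in>?M. sqrt (w m) * Re (\<i> * polarized_current L \<epsilon> \<Psi> m x))"
    unfolding Y_def
  proof (subst Re_ip_derivative_conjugate[OF M fs fD hm])
    have "D j = (\<lambda>\<nu>. pdiff \<Psi> \<nu> j x)" for j by (simp add: D_def fun_eq_iff)
    then show "(\<Sum>m\<in>?M. sqrt (w m) * Re (\<i> * (cis (x \<bullet> k m) * (\<Sum>j\<in>UNIV. of_real (e m $ j) *
        (ip (D j) (Ann m \<phi>) + ip \<phi> (Ann m (D j))))))) =
      (\<Sum>m\<in>?M. sqrt (w m) * Re (\<i> * polarized_current L \<epsilon> \<Psi> m x))"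
      by (simp only: polarized_current_def k_def e_def \<phi>_def)
  qed
  have mip: "(\<Sum>j\<in>UNIV. Re (mip ?M (g j) (h j))) = 1 / sqrt (2 * L ^ 3) * N"
  proof -
    have "Re (mip ?M (g j) (h j)) = (\<Sum>m\<in>?M. 1 / sqrt (2 * L ^ 3) * (e m $ j)\<^sup>2)" for j
      unfolding mip_def Re_sum
    proof (intro sum.cong refl)
      fix m assume "m \<in> ?M"
      have "cnj (g j m) * h j m = of_real (1 / sqrt (2 * L ^ 3) * (1 / sqrt (w m)) * e m $ j * (sqrt (w m) * e m $ j)) * (cis (x \<bullet> k m) * cis (- (x \<bullet> k m)))"
        unfolding gm hm by (simp add: cis_cnj mult_ac)
      also have "\<dots> = of_real (1 / sqrt (2 * L ^ 3) * (e m $ j)\<^sup>2)"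
        using wpos[OF \<open>m \<in> ?M\<close>] by (simp add: cis_mult power2_eq_square)
      finally show "Re (cnj (g j m) * h j m) = 1 / sqrt (2 * L ^ 3) * (e m $ j)\<^sup>2" by (metis Re_complex_of_real)
    qed
    then have "(\<Sum>j\<in>UNIV. Re (mip ?M (g j) (h j))) = (\<Sum>m\<in>?M. \<Sum>j\<in>UNIV. 1 / sqrt (2 * L ^ 3) * (e m $ j)\<^sup>2)"
      by (simp only:) (rule sum.swap)
    also have "\<dots> = (\<Sum>m\<in>?M. 1 / sqrt (2 * L ^ 3))"
      by (intro sum.cong refl) (simp only: sum_distrib_left[symmetric] sum_component_sq enorm, simp)
    finally show ?thesis by (simp add: N_def)
  qed
  have habs: "(cmod (h j m))\<^sup>2 = w m * (e m $ j)\<^sup>2" if "m \<in> ?M" for j m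
    unfolding hm using wpos[OF that] by (simp add: norm_mult power_mult_distrib)
  have hsum: "(\<Sum>j\<in>UNIV. mnsq ?M (h j)) \<le> N * \<Lambda>"
  proof -
    have "(\<Sum>j\<in>UNIV. mnsq ?M (h j)) = (\<Sum>m\<in>?M. \<Sum>j\<in>UNIV. w m * (e m $ j)\<^sup>2)"
      unfolding mnsq_def by (subst sum.swap) (simp add: habs)
    also have "\<dots> = (\<Sum>m\<in>?M. w m)"
      by (intro sum.cong refl) (simp add: sum_distrib_left[symmetric] sum_component_sq enorm)
    also have "\<dots> \<le> (\<Sum>m\<in>?M. \<Lambda>)"
      using modes_less by (intro sum_mono) (fastforce simp: w_def k_def intro: less_imp_le)
    finally show ?thesis by (simp add: N_def)
  qed
  \<comment> \<open>Weight \<open>w m = |k|\<close> in the weighted Cauchy-Schwarz inequality: one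
    factor becomes the field energy density \<open>H\<close>, the other the sum of the squared
    polarization vectors, which is the number of modes.\<close>
  have asum: "(\<Sum>j\<in>UNIV. nsq (aop ?M (h j) \<phi>)) \<le> N * H"
  proof -
    have "(\<Sum>j\<in>UNIV. nsq (aop ?M (h j) \<phi>)) \<le> (\<Sum>j\<in>UNIV. (\<Sum>m\<in>?M. (cmod (h j m))\<^sup>2 / w m) * H)"
      unfolding H_def by (intro sum_mono nsq_aop_le M fs wpos)
    also have "\<dots> = (\<Sum>j\<in>UNIV. \<Sum>m\<in>?M. (e m $ j)\<^sup>2) * H"
      unfolding sum_distrib_right[symmetric]
      by (intro arg_cong[where f = "\<lambda>z. z * H"] sum.cong refl) (use wpos in \<open>fastforce simp: habs\<close>)
    also have "(\<Sum>j\<in>UNIV. \<Sum>m\<in>?M. (e m $ j)\<^sup>2) = N"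
      by (subst sum.swap) (simp add: sum_component_sq enorm N_def)
    finally show ?thesis .
  qed
  have Ysum: "(\<Sum>j\<in>UNIV. nsq (Y j)) \<le> N * (4 * H + 2 * \<Lambda> * nsq \<phi>)"
  proof -
    \<comment> \<open>Each of the two operators costs a factor 2, and the \<open>cop\<close> part
      equals the \<open>aop\<close> part plus the commutator term; hence 4 and 2.\<close>
    have "nsq (Y j) \<le> 4 * nsq (aop ?M (h j) \<phi>) + 2 * nsq \<phi> * mnsq ?M (h j)" for j
    proof -
      have "Y j = (\<lambda>\<nu>. aop ?M (h j) \<phi> \<nu> + (- 1) * cop ?M (h j) \<phi> \<nu>)"
        by (simp add: Y_def fun_eq_iff)
      then have "nsq (Y j) \<le> 2 * nsq (aop ?M (h j) \<phi>) + 2 * nsq (\<lambda>\<nu>. (- 1) * cop ?M (h j) \<phi> \<nu>)"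
        by (simp only: nsq_add_le[OF finite_supp_aop[OF fs] finite_supp_scale[OF finite_supp_cop[OF fs]]])
      also have "nsq (\<lambda>\<nu>. (- 1) * cop ?M (h j) \<phi> \<nu>) = nsq (cop ?M (h j) \<phi>)"
        unfolding nsq_scale[OF finite_supp_cop[OF fs]] by simp
      finally show ?thesis by (simp add: nsq_cop[OF M fs] mult_ac)
    qed
    then have "(\<Sum>j\<in>UNIV. nsq (Y j)) \<le> (\<Sum>j\<in>UNIV. 4 * nsq (aop ?M (h j) \<phi>) + 2 * nsq \<phi> * mnsq ?M (h j))"
      by (intro sum_mono)
    also have "\<dots> = 4 * (\<Sum>j\<in>UNIV. nsq (aop ?M (h j) \<phi>)) + 2 * nsq \<phi> * (\<Sum>j\<in>UNIV. mnsq ?M (h j))"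
      by (simp add: sum.distrib sum_distrib_left)
    also have "\<dots> \<le> 4 * (N * H) + 2 * nsq \<phi> * (N * \<Lambda>)"
      using asum hsum nsq_nonneg[of \<phi>] by (intro add_mono mult_left_mono) auto
    finally show ?thesis by (simp add: algebra_simps)
  qed
  have "0 \<le> (\<Sum>j\<in>UNIV. nsq (\<lambda>\<nu>. v j \<nu> + of_real t * Y j \<nu>))"
    by (intro sum_nonneg nsq_nonneg)
  also have "\<dots> = (\<Sum>j\<in>UNIV. nsq (v j) + 2 * t * (Re (ip (\<lambda>\<nu>. - \<i> * D j \<nu>) (Y j)) - sqrt \<alpha> * nsq \<phi> * Re (mip ?M (g j) (h j))) + t\<^sup>2 * nsq (Y j))"
  proof (intro sum.cong refl)
    fix j
    have "Re (ip (v j) (Y j)) = Re (ip (\<lambda>\<nu>. - \<i> * D j \<nu>) (Y j)) + sqrt \<alpha> * Re (ip (A j) (Y j))"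
      unfolding v_eq ip_add_left[OF finite_supp_scale[OF fD] finite_supp_scale[OF fA]] ip_scale_left[OF fA]
      by simp
    moreover have "Re (ip (A j) (Y j)) = - Re (mip ?M (g j) (h j)) * nsq \<phi>"
      unfolding A_def Y_def by (rule Re_ip_field_conjugate[OF M fs])
    ultimately have e: "Re (ip (v j) (Y j)) = Re (ip (\<lambda>\<nu>. - \<i> * D j \<nu>) (Y j)) - sqrt \<alpha> * nsq \<phi> * Re (mip ?M (g j) (h j))"
      by (simp only:) (simp add: algebra_simps)
    show "nsq (\<lambda>\<nu>. v j \<nu> + of_real t * Y j \<nu>) =
      nsq (v j) + 2 * t * (Re (ip (\<lambda>\<nu>. - \<i> * D j \<nu>) (Y j)) - sqrt \<alpha> * nsq \<phi> * Re (mip ?M (g j) (h j))) + t\<^sup>2 * nsq (Y j)"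
      unfolding nsq_add[OF fv finite_supp_scale[OF fY]] ip_scale_right nsq_scale[OF fY] e[symmetric]
      by simp
  qed
  also have "\<dots> = (\<Sum>j\<in>UNIV. nsq (v j)) + 2 * t * ((\<Sum>m\<in>?M. sqrt (w m) * Re (\<i> * polarized_current L \<epsilon> \<Psi> m x))
      - sqrt \<alpha> * nsq \<phi> * (1 / sqrt (2 * L ^ 3) * N)) + t\<^sup>2 * (\<Sum>j\<in>UNIV. nsq (Y j))"
    unfolding cur[symmetric] mip[symmetric]
    by (simp add: sum.distrib sum_distrib_left sum_subtractf right_diff_distrib)
  also have "\<dots> \<le> (\<Sum>j\<in>UNIV. nsq (v j)) + 2 * t * ((\<Sum>m\<in>?M. sqrt (w m) * Re (\<i> * polarized_current L \<epsilon> \<Psi> m x))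
      - sqrt \<alpha> * nsq \<phi> * (1 / sqrt (2 * L ^ 3) * N)) + t\<^sup>2 * (N * (4 * H + 2 * \<Lambda> * nsq \<phi>))"
    using Ysum by (intro add_left_mono mult_left_mono) auto
  finally show ?thesis
    unfolding v_def w_def k_def \<phi>_def N_def H_def by (simp add: algebra_simps)
qed

lemma energy_form_lower_bound:
  assumes L: "0 < L" and pol: "valid_polarization L \<epsilon>" and adm: "admissible L \<Lambda> \<Psi>"
    and ne: "modes L \<Lambda> \<noteq> {}"
  shows "(sqrt \<alpha> * sqrt (card (modes L \<Lambda>) / L ^ 3) - \<Lambda>) * norm_sq \<Psi> \<le> 2 * energy_form \<alpha> L \<Lambda> \<epsilon> \<Psi>"
proof -
  let ?M = "modes L \<Lambda>"
  define N where "N = real (card ?M)"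
  have N: "0 < N" using ne finite_modes[OF L] by (simp add: N_def card_gt_0_iff)
  \<comment> \<open>With this value \<open>4 * t\<^sup>2 * N\<close> is 2, so the field energy
    needed matches the one contained in twice the energy form, and the term
    \<open>2 * t\<^sup>2 * N * \<Lambda>\<close> becomes \<Lambda>.\<close>
  define t where "t = 1 / sqrt (2 * N)"
  have t2: "t\<^sup>2 * N = 1 / 2" using N by (simp add: t_def power_divide)
  let ?v = "\<lambda>j x. nsq (kinetic_vec \<alpha> L \<Lambda> \<epsilon> \<Psi> j x)"
  let ?J = "\<lambda>x. \<Sum>m\<in>?M. sqrt (norm (kvec L (fst m))) * Re (\<i> * polarized_current L \<epsilon> \<Psi> m x)"
  let ?H = "\<lambda>x. \<Sum>m\<in>?M. norm (kvec L (fst m)) * nsq (Ann m (\<Psi> x))"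
  note E = energy_form_eq(1)[OF L adm, of \<alpha> \<epsilon>] energy_form_eq(2,3)[OF L adm]
  note Nq = norm_sq_eq[OF adm]
  have cm: "integrable lborel (\<lambda>x. \<i> * polarized_current L \<epsilon> \<Psi> m x)"
    "(LINT x|lborel. Re (\<i> * polarized_current L \<epsilon> \<Psi> m x)) = 0" if "m \<in> ?M" for m
  proof -
    note pc = integral_polarized_current[OF adm pol that]
    show i: "integrable lborel (\<lambda>x. \<i> * polarized_current L \<epsilon> \<Psi> m x)"
      using pc(1) by (intro integrable_mult_right) auto
    have "(LINT x|lborel. Re (\<i> * polarized_current L \<epsilon> \<Psi> m x)) = Re (LINT x|lborel. \<i> * polarized_current L \<epsilon> \<Psi> m x)"
      by (rule integral_Re[OF i])
    also have "\<dots> = 0" by (simp add: pc(2))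
    finally show "(LINT x|lborel. Re (\<i> * polarized_current L \<epsilon> \<Psi> m x)) = 0" .
  qed
  have Jint: "integrable lborel ?J"
    by (intro Bochner_Integration.integrable_sum integrable_mult_right integrable_Re cm)
  have J0: "(LINT x|lborel. ?J x) = 0"
  proof -
    have "(LINT x|lborel. ?J x) = (\<Sum>m\<in>?M. LINT x|lborel. sqrt (norm (kvec L (fst m))) * Re (\<i> * polarized_current L \<epsilon> \<Psi> m x))"
      by (intro Bochner_Integration.integral_sum integrable_mult_right integrable_Re cm)
    also have "\<dots> = (\<Sum>m\<in>?M. sqrt (norm (kvec L (fst m))) * (LINT x|lborel. Re (\<i> * polarized_current L \<epsilon> \<Psi> m x)))"
      by simp
    also have "\<dots> = 0" by (intro sum.neutral ballI) (simp only: cm(2) mult_zero_right)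
    finally show ?thesis .
  qed
  have coef: "2 * t * sqrt \<alpha> * (1 / sqrt (2 * L ^ 3)) * N = sqrt \<alpha> * sqrt (N / L ^ 3)"
  proof -
    have "sqrt (2 * N) * sqrt (2 * N) = 2 * N" using N by simp
    then have "2 * t * N = sqrt (2 * N)" using N by (simp add: t_def field_simps)
    moreover have "sqrt (2 * N) * (1 / sqrt (2 * L ^ 3)) = sqrt (N / L ^ 3)"
      by (simp add: real_sqrt_mult real_sqrt_divide)
    ultimately show ?thesis by (metis (no_types, opaque_lifting) mult.assoc mult.commute)
  qed
  have "sqrt \<alpha> * sqrt (N / L ^ 3) * norm_sq \<Psi> = (LINT x|lborel. sqrt \<alpha> * sqrt (N / L ^ 3) * nsq (\<Psi> x))"
    by (simp add: Nq)
  also have "\<dots> \<le> (LINT x|lborel. (\<Sum>j\<in>UNIV. ?v j x) + 2 * t * ?J x + (2 * ?H x + \<Lambda> * nsq (\<Psi> x)))"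
  proof (intro integral_mono integrable_mult_right Nq Bochner_Integration.integrable_add Jint E Bochner_Integration.integrable_sum)
    fix x
    have "2 * t * sqrt \<alpha> * (1 / sqrt (2 * L ^ 3)) * N * nsq (\<Psi> x) \<le>
      (\<Sum>j\<in>UNIV. ?v j x) + 2 * t * ?J x + t\<^sup>2 * N * (4 * ?H x + 2 * \<Lambda> * nsq (\<Psi> x))"
      unfolding N_def by (rule energy_lower_bound_pointwise[OF L pol adm])
    then show "sqrt \<alpha> * sqrt (N / L ^ 3) * nsq (\<Psi> x) \<le> (\<Sum>j\<in>UNIV. ?v j x) + 2 * t * ?J x + (2 * ?H x + \<Lambda> * nsq (\<Psi> x))"
      unfolding coef t2 by (simp add: algebra_simps)
  qed
  also have "\<dots> = (\<Sum>j\<in>UNIV. LINT x|lborel. ?v j x) + 2 * t * (LINT x|lborel. ?J x) + (2 * (LINT x|lborel. ?H x) + \<Lambda> * norm_sq \<Psi>)"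
  proof -
    have "(LINT x|lborel. a x + c * b x + (2 * h x + c' * n x)) =
        (LINT x|lborel. a x) + c * (LINT x|lborel. b x) + (2 * (LINT x|lborel. h x) + c' * (LINT x|lborel. n x))"
      if "integrable lborel a" "integrable lborel b" "integrable lborel h" "integrable lborel n"
      for a b h n :: "real^3 \<Rightarrow> real" and c c' using that by simp
    note lin = this[OF Bochner_Integration.integrable_sum Jint E(3) Nq(2)]
    show ?thesis unfolding Nq(1)
      by (subst lin) (simp_all only: E(2) Bochner_Integration.integral_sum)
  qed
  also have "\<dots> = 2 * energy_form \<alpha> L \<Lambda> \<epsilon> \<Psi> + \<Lambda> * norm_sq \<Psi>"
    unfolding J0 E(1) by simp
  finally show ?thesis by (simp add: algebra_simps N_def)
qed

section \<open>Counting modes\<close>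

text \<open>Integer points of the cube with coordinates from 1 to \<open>K\<close>, in one
  polarization, suffice: each momentum component is at most \<open>\<Lambda> / 2\<close> and
  \<open>3 / 4 < 1\<close>. Rounding \<open>z \<ge> 1\<close> down loses at most a factor 2, whence
  \<open>8 * pi\<close>.\<close>

lemma card_modes_lower:
  assumes L: "0 < L" and \<Lambda>: "4 * pi \<le> \<Lambda> * L"
  shows "(\<Lambda> * L / (8 * pi)) ^ 3 \<le> real (card (modes L \<Lambda>))"
proof -
  define z where "z = \<Lambda> * L / (4 * pi)"
  have z: "1 \<le> z" using \<Lambda> by (simp add: z_def)
  define K where "K = nat \<lfloor>z\<rfloor>"
  have K1: "real K \<le> z" and K2: "z / 2 \<le> real K"
  proof -
    have "1 \<le> \<lfloor>z\<rfloor>" using z by simp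
    then have f1: "1 \<le> real_of_int \<lfloor>z\<rfloor>" by (simp only: of_int_1_le_iff)
    have "real K = real_of_int \<lfloor>z\<rfloor>" using \<open>1 \<le> \<lfloor>z\<rfloor>\<close> by (simp add: K_def)
    then show "real K \<le> z" "z / 2 \<le> real K" using f1 floor_correct[of z] by linarith+
  qed
  have \<Lambda>pos: "0 < \<Lambda>" using L \<Lambda> pi_gt_zero by (metis mult_less_cancel_right2 less_le_trans mult_pos_pos zero_less_mult_pos2 zero_less_numeral)
  define f where "f = (\<lambda>(a, b, c). ((int a, int b, int c), 1 :: nat))"
  have inj: "inj f" by (auto simp: inj_on_def f_def)
  have "f ` ({1..K} \<times> {1..K} \<times> {1..K}) \<subseteq> modes L \<Lambda>"
  proof
    fix m assume "m \<in> f ` ({1..K} \<times> {1..K} \<times> {1..K})"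
    then obtain a b c where m: "m = ((int a, int b, int c), 1)" and abc: "1 \<le> a" "a \<le> K" "b \<le> K" "c \<le> K"
      by (auto simp: f_def)
    have n2: "(norm (kvec L (fst m)))\<^sup>2 = (2 * pi / L)\<^sup>2 * (real a ^ 2 + real b ^ 2 + real c ^ 2)"
      using norm_kvec[OF L, of "int a" "int b" "int c"] by (simp add: m)
    have "real a ^ 2 \<le> z ^ 2" "real b ^ 2 \<le> z ^ 2" "real c ^ 2 \<le> z ^ 2"
      using abc K1 by (auto intro!: power_mono)
    moreover have z2: "0 < z ^ 2" using z by simp
    ultimately have "real a ^ 2 + real b ^ 2 + real c ^ 2 < 4 * z ^ 2" by linarith
    then have "(norm (kvec L (fst m)))\<^sup>2 < (2 * pi / L)\<^sup>2 * (4 * z ^ 2)"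
      unfolding n2 using L by (intro mult_strict_left_mono) auto
    also have "\<dots> = \<Lambda>\<^sup>2" using L by (simp add: z_def power2_eq_square)
    finally have "norm (kvec L (fst m)) < \<Lambda>" using \<Lambda>pos by (simp add: power_less_imp_less_base)
    moreover have "0 < (norm (kvec L (fst m)))\<^sup>2"
      unfolding n2 using L abc by (intro mult_pos_pos add_pos_nonneg) auto
    ultimately show "m \<in> modes L \<Lambda>" by (auto simp: modes_def m)
  qed
  then have "card ({1..K} \<times> {1..K} \<times> {1..K}) \<le> card (modes L \<Lambda>)"
    using card_mono[OF finite_modes[OF L]] card_image[OF inj_on_subset[OF inj]] by (metis subset_UNIV)
  then have "real (K ^ 3) \<le> real (card (modes L \<Lambda>))"
    by (simp add: card_cartesian_product power3_eq_cube mult.assoc del: of_nat_mult)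
  moreover have "(z / 2) ^ 3 \<le> real K ^ 3" using K2 z by (intro power_mono) auto
  moreover have "z / 2 = \<Lambda> * L / (8 * pi)" by (simp add: z_def)
  ultimately show ?thesis by (simp only: of_nat_power)
qed

text \<open>The witness \<open>\<kappa> / 4\<close> is an absolute constant; the box and the
  coupling enter only through the threshold for the cutoff.\<close>

theorem ground_state_energy_lower:
  assumes L: "0 < L" and pol: "valid_polarization L \<epsilon>"
  shows "\<exists>C>0. \<forall>\<alpha>>0. \<exists>\<Lambda>0. \<forall>\<Lambda>\<ge>\<Lambda>0.
    ereal (C * \<alpha> powr (1/2) * \<Lambda> powr (3/2)) < ground_state_energy \<alpha> L \<Lambda> \<epsilon>"
proof -
  define \<kappa> where "\<kappa> = sqrt ((1 / (8 * pi)) ^ 3)"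
  have \<kappa>: "0 < \<kappa>" by (simp add: \<kappa>_def)
  have main: "ereal (\<kappa> / 4 * \<alpha> powr (1/2) * \<Lambda> powr (3/2)) < ground_state_energy \<alpha> L \<Lambda> \<epsilon>"
    if \<alpha>: "0 < \<alpha>" and \<Lambda>1: "4 * pi / L \<le> \<Lambda>" and \<Lambda>2: "9 / (\<alpha> * \<kappa>\<^sup>2) \<le> \<Lambda>" for \<alpha> \<Lambda>
  proof -
    have \<Lambda>: "0 < \<Lambda>" using \<Lambda>1 L by (meson divide_pos_pos less_le_trans mult_pos_pos pi_gt_zero zero_less_numeral)
    have \<Lambda>L: "4 * pi \<le> \<Lambda> * L" using \<Lambda>1 L by (simp add: pos_divide_le_eq)
    have card: "(\<Lambda> * L / (8 * pi)) ^ 3 \<le> real (card (modes L \<Lambda>))" by (rule card_modes_lower[OF L \<Lambda>L])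
    have "0 < (\<Lambda> * L / (8 * pi)) ^ 3" using L \<Lambda> by simp
    with card have ne: "modes L \<Lambda> \<noteq> {}" by auto
    have "\<kappa> * (\<Lambda> * sqrt \<Lambda>) = sqrt ((\<Lambda> * L / (8 * pi)) ^ 3 / L ^ 3)"
    proof -
      have "(\<Lambda> * L / (8 * pi)) ^ 3 / L ^ 3 = (1 / (8 * pi)) ^ 3 * (\<Lambda>\<^sup>2 * \<Lambda>)"
        using L by (simp add: power_divide power_mult_distrib power2_eq_square power3_eq_cube)
      then show ?thesis using \<Lambda> by (simp add: \<kappa>_def real_sqrt_mult del: power_one_over)
    qed
    also have "\<dots> \<le> sqrt (card (modes L \<Lambda>) / L ^ 3)"
      using card L by (intro real_sqrt_le_mono divide_right_mono) auto
    finally have N: "\<kappa> * (\<Lambda> * sqrt \<Lambda>) \<le> sqrt (card (modes L \<Lambda>) / L ^ 3)" .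
    define b where "b = (sqrt \<alpha> * (\<kappa> * (\<Lambda> * sqrt \<Lambda>)) - \<Lambda>) / 2"
    have "ereal b \<le> ground_state_energy \<alpha> L \<Lambda> \<epsilon>"
      unfolding ground_state_energy_def
    proof (rule INF_greatest)
      fix \<Psi> assume "\<Psi> \<in> {\<Psi>. admissible L \<Lambda> \<Psi> \<and> norm_sq \<Psi> \<noteq> 0}"
      then have adm: "admissible L \<Lambda> \<Psi>" and nz: "norm_sq \<Psi> \<noteq> 0" by auto
      have nn: "0 \<le> norm_sq \<Psi>" unfolding norm_sq_eq(1)[OF adm] by (intro Bochner_Integration.integral_nonneg nsq_nonneg)
      have "2 * b * norm_sq \<Psi> \<le> (sqrt \<alpha> * sqrt (card (modes L \<Lambda>) / L ^ 3) - \<Lambda>) * norm_sq \<Psi>"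
        unfolding b_def using N nn \<alpha> by (intro mult_right_mono) (auto intro!: mult_left_mono)
      also have "\<dots> \<le> 2 * energy_form \<alpha> L \<Lambda> \<epsilon> \<Psi>" by (rule energy_form_lower_bound[OF L pol adm ne])
      finally have "b * norm_sq \<Psi> \<le> energy_form \<alpha> L \<Lambda> \<epsilon> \<Psi>" by simp
      then have "b \<le> energy_form \<alpha> L \<Lambda> \<epsilon> \<Psi> / norm_sq \<Psi>" using nn nz by (simp add: le_divide_eq)
      then show "ereal b \<le> ereal (energy_form \<alpha> L \<Lambda> \<epsilon> \<Psi> / norm_sq \<Psi>)" by simp
    qed
    moreover have "\<kappa> / 4 * \<alpha> powr (1/2) * \<Lambda> powr (3/2) < b"
    proof -
      have p: "\<Lambda> powr (3/2) = \<Lambda> * sqrt \<Lambda>"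
        using \<Lambda> powr_add[of \<Lambda> 1 "1/2"] by (simp add: powr_half_sqrt)
      have "9 \<le> \<Lambda> * (\<alpha> * \<kappa>\<^sup>2)" using \<Lambda>2 \<alpha> \<kappa> by (simp add: pos_divide_le_eq)
      then have "3 \<le> sqrt (\<Lambda> * (\<alpha> * \<kappa>\<^sup>2))" by (intro real_le_rsqrt) simp
      also have "\<dots> = sqrt \<alpha> * \<kappa> * sqrt \<Lambda>" using \<kappa> by (simp add: real_sqrt_mult)
      finally have "3 * \<Lambda> \<le> (sqrt \<alpha> * \<kappa> * sqrt \<Lambda>) * \<Lambda>" using \<Lambda> by (intro mult_right_mono) auto
      moreover have "\<kappa> / 4 * \<alpha> powr (1/2) * \<Lambda> powr (3/2) = (sqrt \<alpha> * \<kappa> * sqrt \<Lambda>) * \<Lambda> / 4"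
        unfolding p using \<alpha> by (simp add: powr_half_sqrt)
      moreover have "b = ((sqrt \<alpha> * \<kappa> * sqrt \<Lambda>) * \<Lambda> - \<Lambda>) / 2" by (simp add: b_def)
      moreover have "x < y" if "3 * l \<le> X" "x = X / 4" "y = (X - l) / 2" "0 < l" for x y X l :: real
        unfolding that(2,3) using that(1,4) by simp
      ultimately show ?thesis using \<Lambda> by blast
    qed
    ultimately show ?thesis by (meson ereal_less_eq(3) less_ereal.simps(1) less_le_trans)
  qed
  show ?thesis
    by (rule exI[of _ "\<kappa> / 4"]) (use \<kappa> main in \<open>auto intro!: exI[of _ "max (4 * pi / L) (9 / (_ * \<kappa>\<^sup>2))"]\<close>)
qed

text \<open>The modes are grouped into shells of constant maximum norm \<open>t\<close>. A shell has
  order \<open>t\<^sup>2\<close> modes and each contributes at most order \<open>1 / t\<close>, so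
  summing \<open>t\<close> up to order \<Lambda> gives order
  \<open>\<Lambda>\<^sup>2\<close>.\<close>

lemma sum_inverse_norm_modes:
  assumes L: "0 < L" and \<Lambda>: "0 \<le> \<Lambda>"
  shows "(\<Sum>m\<in>modes L \<Lambda>. 1 / norm (kvec L (fst m))) \<le> 108 * (L / (2 * pi)) ^ 3 * \<Lambda>\<^sup>2"
proof -
  define s where "s m = (case m of ((a, b, c), lam) \<Rightarrow> nat (max \<bar>a\<bar> (max \<bar>b\<bar> \<bar>c\<bar>)))" for m :: mode
  define R where "R = \<Lambda> * L / (2 * pi)"
  define K where "K = nat \<lfloor>R\<rfloor>"
  have R: "0 \<le> R" using L \<Lambda> by (simp add: R_def)
  have K: "real K \<le> R" using R by (simp add: K_def)
  have fin: "finite (modes L \<Lambda>)" by (rule finite_modes[OF L])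
  have low: "2 * pi / L * real (s m) \<le> norm (kvec L (fst m))" for m
  proof -
    obtain a b c lam where m: "m = ((a, b, c), lam)" by (metis surj_pair)
    have "\<bar>kvec L (a, b, c) $ i\<bar> \<le> norm (kvec L (a, b, c))" for i by (rule component_le_norm_cart)
    from this[of 1] this[of 2] this[of 3]
    have "2 * pi / L * real_of_int \<bar>z\<bar> \<le> norm (kvec L (a, b, c))" if "z \<in> {a, b, c}" for z
      using that L by (auto simp: kvec_nth vector_3 abs_mult)
    moreover have "max \<bar>a\<bar> (max \<bar>b\<bar> \<bar>c\<bar>) \<in> {\<bar>a\<bar>, \<bar>b\<bar>, \<bar>c\<bar>}" by (auto simp: max_def)
    ultimately have "2 * pi / L * real_of_int (max \<bar>a\<bar> (max \<bar>b\<bar> \<bar>c\<bar>)) \<le> norm (kvec L (a, b, c))" by auto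
    moreover have "real (s m) = real_of_int (max \<bar>a\<bar> (max \<bar>b\<bar> \<bar>c\<bar>))"
      unfolding s_def m prod.case by (rule of_nat_nat) (simp add: le_max_iff_disj)
    ultimately show ?thesis by (simp add: m)
  qed
  have s1: "1 \<le> s m" if "m \<in> modes L \<Lambda>" for m
  proof (rule ccontr)
    assume n: "\<not> 1 \<le> s m"
    obtain a b c lam where m: "m = ((a, b, c), lam)" by (metis surj_pair)
    from n have "a = 0" "b = 0" "c = 0" by (auto simp: s_def m)
    then have "(norm (kvec L (fst m)))\<^sup>2 = 0" using norm_kvec[OF L, of a b c] by (simp add: m)
    with modes_pos[OF that] show False by simp
  qed
  have sK: "s m \<le> K" if "m \<in> modes L \<Lambda>" for m
  proof -
    have "2 * pi / L * real (s m) < \<Lambda>" using low[of m] modes_less[OF that] by linarith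
    then have "real (s m) \<le> R" using L by (simp add: R_def field_simps)
    then show ?thesis unfolding K_def by (simp add: le_nat_floor)
  qed
  have card: "real (card {m \<in> modes L \<Lambda>. s m = t}) \<le> 108 * (real t)\<^sup>2" if t: "1 \<le> t" for t
  proof -
    define I where "I = {- int t..int t}"
    define J where "J = {- int t, int t}"
    have cI: "card I = 2 * t + 1" by (simp add: I_def)
    have cJ: "card J \<le> 2" unfolding J_def by (simp add: card_insert_if)
    have fI: "finite I" "finite J" by (auto simp: I_def J_def)
    \<comment> \<open>On the shell some coordinate is \<open>t\<close> or \<open>- t\<close>: 3
      positions, 2 signs, at most \<open>3 * t\<close> values for each other coordinate and 2
      polarizations give \<open>108 * t\<^sup>2\<close>.\<close>
    have "{m \<in> modes L \<Lambda>. s m = t} \<subseteq> (J \<times> I \<times> I \<union> I \<times> J \<times> I \<union> I \<times> I \<times> J) \<times> {1, 2}"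
    proof
      fix m assume "m \<in> {m \<in> modes L \<Lambda>. s m = t}"
      then have m: "m \<in> modes L \<Lambda>" "s m = t" by auto
      obtain a b c lam where mm: "m = ((a, b, c), lam)" by (metis surj_pair)
      have mx: "max \<bar>a\<bar> (max \<bar>b\<bar> \<bar>c\<bar>) = int t" using m(2) by (auto simp: s_def mm le_max_iff_disj nat_eq_iff)
      then have "a \<in> I" "b \<in> I" "c \<in> I" unfolding I_def by auto
      moreover have "a \<in> J \<or> b \<in> J \<or> c \<in> J" using mx unfolding J_def by (auto simp: max_def split: if_splits)
      moreover have "lam \<in> {1, 2}" using m(1) by (auto simp: modes_def mm)
      ultimately show "m \<in> (J \<times> I \<times> I \<union> I \<times> J \<times> I \<union> I \<times> I \<times> J) \<times> {1, 2}" by (auto simp: mm)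
    qed
    then have "card {m \<in> modes L \<Lambda>. s m = t} \<le> card ((J \<times> I \<times> I \<union> I \<times> J \<times> I \<union> I \<times> I \<times> J) \<times> {1, 2 :: nat})"
      by (intro card_mono finite_cartesian_product finite_UnI fI) auto
    also have "\<dots> = card (J \<times> I \<times> I \<union> I \<times> J \<times> I \<union> I \<times> I \<times> J) * 2" by (simp add: card_cartesian_product)
    also have "\<dots> \<le> (card (J \<times> I \<times> I) + card (I \<times> J \<times> I) + card (I \<times> I \<times> J)) * 2"
      by (meson add_le_mono card_Un_le le_refl le_trans mult_le_mono1)
    also have "\<dots> = 6 * card J * (card I)\<^sup>2" by (simp add: card_cartesian_product power2_eq_square)
    also have "\<dots> \<le> 6 * 2 * (3 * t)\<^sup>2"
    proof (intro mult_le_mono power_mono le_refl cJ)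
      show "card I \<le> 3 * t" unfolding cI using that by linarith
    qed simp
    finally have "card {m \<in> modes L \<Lambda>. s m = t} \<le> 108 * t\<^sup>2" by (simp add: power_mult_distrib)
    then have "real (card {m \<in> modes L \<Lambda>. s m = t}) \<le> real (108 * t\<^sup>2)" by (rule of_nat_mono)
    then show ?thesis by simp
  qed
  have "(\<Sum>m\<in>modes L \<Lambda>. 1 / norm (kvec L (fst m))) \<le> (\<Sum>m\<in>modes L \<Lambda>. L / (2 * pi) * (1 / real (s m)))"
  proof (intro sum_mono)
    fix m assume m: "m \<in> modes L \<Lambda>"
    have "1 / norm (kvec L (fst m)) \<le> 1 / (2 * pi / L * real (s m))"
      using low[of m] s1[OF m] L by (intro divide_left_mono mult_pos_pos modes_pos[OF m]) auto
    then show "1 / norm (kvec L (fst m)) \<le> L / (2 * pi) * (1 / real (s m))" by simp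
  qed
  also have "\<dots> = L / (2 * pi) * (\<Sum>m\<in>modes L \<Lambda>. 1 / real (s m))" by (simp add: sum_distrib_left)
  finally have A: "(\<Sum>m\<in>modes L \<Lambda>. 1 / norm (kvec L (fst m))) \<le> L / (2 * pi) * (\<Sum>m\<in>modes L \<Lambda>. 1 / real (s m))" .
  have "(\<Sum>m\<in>modes L \<Lambda>. 1 / real (s m)) = (\<Sum>t\<in>{1..K}. \<Sum>m\<in>{m \<in> modes L \<Lambda>. s m = t}. 1 / real (s m))"
    using s1 sK by (intro sum.group[symmetric] fin) auto
  also have "\<dots> = (\<Sum>t\<in>{1..K}. real (card {m \<in> modes L \<Lambda>. s m = t}) / real t)" by simp
  also have "\<dots> \<le> (\<Sum>t\<in>{1..K}. 108 * real K)"
  proof (intro sum_mono)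
    fix t assume t: "t \<in> {1..K}"
    then have "real (card {m \<in> modes L \<Lambda>. s m = t}) / real t \<le> 108 * (real t)\<^sup>2 / real t"
      by (intro divide_right_mono card) auto
    also have "\<dots> = 108 * real t" using t by (simp add: power2_eq_square)
    finally show "real (card {m \<in> modes L \<Lambda>. s m = t}) / real t \<le> 108 * real K" using t by auto
  qed
  also have "\<dots> = 108 * (real K)\<^sup>2" by (simp add: power2_eq_square)
  also have "\<dots> \<le> 108 * R\<^sup>2" using K by (intro mult_left_mono power_mono) auto
  finally have "(\<Sum>m\<in>modes L \<Lambda>. 1 / real (s m)) \<le> 108 * R\<^sup>2" .
  then have "L / (2 * pi) * (\<Sum>m\<in>modes L \<Lambda>. 1 / real (s m)) \<le> L / (2 * pi) * (108 * R\<^sup>2)"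
    using L by (intro mult_left_mono) auto
  moreover have "L / (2 * pi) * (108 * R\<^sup>2) = 108 * (L / (2 * pi)) ^ 3 * \<Lambda>\<^sup>2"
    by (simp add: R_def power2_eq_square power3_eq_cube)
  ultimately show ?thesis using A by linarith
qed

section \<open>A real subspace of modes approximating the vector potential\<close>

text \<open>On the real vector space \<open>H\<close> the form \<open>mip M\<close> is real, so
  Gram-Schmidt runs with real coefficients although the functions are complex. A vector already in
  the span on \<open>M\<close> is skipped, which is why only \<open>d \<le> card B\<close>
  results.\<close>

lemma real_gram_schmidt:
  fixes H :: "('m \<Rightarrow> complex) \<Rightarrow> bool"
  assumes "finite M" "finite B" "\<And>b. b \<in> B \<Longrightarrow> H b"
    and real: "\<And>f g. H f \<Longrightarrow> H g \<Longrightarrow> Im (mip M f g) = 0"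
    and add: "\<And>f g. H f \<Longrightarrow> H g \<Longrightarrow> H (\<lambda>m. f m + g m)"
    and scale: "\<And>f c. H f \<Longrightarrow> H (\<lambda>m. of_real c * f m)"
  shows "\<exists>d (f :: nat \<Rightarrow> 'm \<Rightarrow> complex). d \<le> card B \<and> (\<forall>i<d. H (f i)) \<and>
    (\<forall>i<d. \<forall>j<d. mip M (f i) (f j) = (if i = j then 1 else 0)) \<and>
    (\<forall>b\<in>B. \<exists>c :: nat \<Rightarrow> real. \<forall>m\<in>M. b m = (\<Sum>i<d. of_real (c i) * f i m))"
  using assms(2,3)
proof (induction B rule: finite_induct)
  case empty
  show ?case by (intro exI[of _ 0]) auto
next
  case (insert b B)
  have "\<And>b. b \<in> B \<Longrightarrow> H b" using insert.prems by simp
  from insert.IH[OF this] obtain d and f :: "nat \<Rightarrow> 'm \<Rightarrow> complex" where d: "d \<le> card B"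
    and Hf': "\<forall>i<d. H (f i)"
    and on': "\<forall>i<d. \<forall>j<d. mip M (f i) (f j) = (if i = j then 1 else 0)"
    and span': "\<forall>b\<in>B. \<exists>c :: nat \<Rightarrow> real. \<forall>m\<in>M. b m = (\<Sum>i<d. of_real (c i) * f i m)"
    by blast
  note Hf = Hf'[rule_format] and on = on'[rule_format] and span = span'[rule_format]
  have Hb: "H b" using insert by auto
  define c where "c i = Re (mip M (f i) b)" for i
  have c: "mip M (f i) b = of_real (c i)" if "i < d" for i
    using real[OF Hf[OF that] Hb] by (simp add: c_def complex_eq_iff)
  define r where "r m = b m - (\<Sum>i<d. of_real (c i) * f i m)" for m
  have Hr: "H r"
  proof -
    have "H (\<lambda>m. b m - (\<Sum>i<n. of_real (c i) * f i m))" if "n \<le> d" for n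
      using that
    proof (induction n)
      case 0
      show ?case using Hb by simp
    next
      case (Suc n)
      then have "H (\<lambda>m. (b m - (\<Sum>i<n. of_real (c i) * f i m)) + of_real (- c n) * f n m)"
        by (intro add scale Hf) auto
      then show ?case by (simp add: algebra_simps)
    qed
    then show ?thesis unfolding r_def by blast
  qed
  have fr: "mip M (f j) r = 0" if "j < d" for j
  proof -
    have "mip M (f j) r = mip M (f j) b - (\<Sum>m\<in>M. \<Sum>i<d. of_real (c i) * (cnj (f j m) * f i m))"
      unfolding mip_def r_def by (simp add: right_diff_distrib sum_subtractf sum_distrib_left mult.left_commute)
    also have "(\<Sum>m\<in>M. \<Sum>i<d. of_real (c i) * (cnj (f j m) * f i m)) = (\<Sum>i<d. of_real (c i) * mip M (f j) (f i))"
      unfolding mip_def by (subst sum.swap) (simp add: sum_distrib_left)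
    also have "\<dots> = (\<Sum>i<d. if i = j then of_real (c i) else 0)"
      using that by (intro sum.cong) (auto simp: on)
    finally show ?thesis using that by (simp add: c)
  qed
  show ?case
  proof (cases "mnsq M r = 0")
    case True
    then have "r m = 0" if "m \<in> M" for m
      using that assms(1) unfolding mnsq_def by (subst (asm) sum_nonneg_eq_0_iff) auto
    then have "b m = (\<Sum>i<d. of_real (c i) * f i m)" if "m \<in> M" for m
      using that by (simp add: r_def)
    then have "\<exists>c :: nat \<Rightarrow> real. \<forall>m\<in>M. b m = (\<Sum>i<d. of_real (c i) * f i m)" by blast
    moreover have "d \<le> card (insert b B)" using d insert by simp
    ultimately show ?thesis using Hf' on' span'
      by (intro exI[of _ d] exI[of _ f] conjI) auto
  next
    case False
    define n where "n = sqrt (mnsq M r)"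
    have n: "0 < n" "n\<^sup>2 = mnsq M r" using False mnsq_nonneg[of M r] by (auto simp: n_def)
    define g where "g i = (if i < d then f i else (\<lambda>m. of_real (1 / n) * r m))" for i
    have gd: "g d = (\<lambda>m. of_real (1 / n) * r m)" by (simp add: g_def)
    have gf: "g i = f i" if "i < d" for i using that by (simp add: g_def)
    have "H (g d)" unfolding gd by (rule scale[OF Hr])
    then have "H (g i)" if "i < Suc d" for i
      using that Hf gf by (cases "i = d") auto
    moreover have "mip M (g i) (g j) = (if i = j then 1 else 0)" if "i < Suc d" "j < Suc d" for i j
    proof -
      have 1: "mip M (f i) (g d) = 0" if "i < d" for i
      proof -
        have "mip M (f i) (g d) = of_real (1 / n) * mip M (f i) r"
          unfolding mip_def gd by (simp add: sum_distrib_left mult_ac)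
        then show ?thesis using fr[OF that] by simp
      qed
      then have 2: "mip M (g d) (f i) = 0" if "i < d" for i
        using that mip_cnj[of M "f i" "g d"] by simp
      have "mip M (g d) (g d) = of_real (1 / n) * of_real (1 / n) * mip M r r"
        unfolding mip_def gd by (simp add: sum_distrib_left mult_ac)
      also have "\<dots> = of_real (1 / n * (1 / n) * n\<^sup>2)" by (simp add: mip_self n(2))
      also have "\<dots> = 1" using n(1) by (simp add: power2_eq_square)
      finally have 3: "mip M (g d) (g d) = 1" .
      show ?thesis using that 1 2 3 on gf by (cases "i = d"; cases "j = d") (auto simp: less_Suc_eq)
    qed
    moreover have "\<exists>c :: nat \<Rightarrow> real. \<forall>m\<in>M. b' m = (\<Sum>i<Suc d. of_real (c i) * g i m)" if b': "b' \<in> insert b B" for b'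
    proof (cases "b' = b")
      case True
      have "b m = (\<Sum>i<Suc d. of_real ((c(d := n)) i) * g i m)" for m
      proof -
        have "(\<Sum>i<Suc d. of_real ((c(d := n)) i) * g i m) = (\<Sum>i<d. of_real (c i) * f i m) + of_real n * g d m"
          by (simp add: gf)
        also have "of_real n * g d m = r m" using n(1) by (simp add: gd)
        finally show ?thesis by (simp add: r_def)
      qed
      then show ?thesis using True by blast
    next
      case False
      then obtain c' :: "nat \<Rightarrow> real" where c': "\<And>m. m \<in> M \<Longrightarrow> b' m = (\<Sum>i<d. of_real (c' i) * f i m)"
        using span[of b'] b' by auto
      have "b' m = (\<Sum>i<Suc d. of_real ((c'(d := 0)) i) * g i m)" if "m \<in> M" for m
        using c'[OF that] by (simp add: gf)
      then show ?thesis by blast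
    qed
    moreover have "Suc d \<le> card (insert b B)" using d insert by simp
    ultimately show ?thesis
      by (intro exI[of _ "Suc d"] exI[of _ g]) auto
  qed
qed

text \<open>The two polarizations and the unit vector along \<open>k\<close> are the rows of a
  matrix \<open>Q\<close> with \<open>Q ** transpose Q = mat 1\<close>; a left inverse of a square
  matrix is a right inverse, and the columns are orthonormal too.\<close>

lemma polarization_completeness:
  fixes e1 e2 k :: "real^3"
  assumes "e1 \<bullet> e1 = 1" "e2 \<bullet> e2 = 1" "e1 \<bullet> e2 = 0" "e1 \<bullet> k = 0" "e2 \<bullet> k = 0" "k \<noteq> 0"
  shows "e1 $ i * e1 $ j + e2 $ i * e2 $ j = (if i = j then 1 else 0) - k $ i * k $ j / (norm k)\<^sup>2"
proof -
  define u where "u = (1 / norm k) *\<^sub>R k"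
  have u: "u \<bullet> u = 1" "e1 \<bullet> u = 0" "e2 \<bullet> u = 0" "u \<bullet> e1 = 0" "u \<bullet> e2 = 0" "e2 \<bullet> e1 = 0"
    using assms by (auto simp: u_def power2_norm_eq_inner[symmetric] power2_eq_square inner_commute)
  define Q where "Q = (vector [e1, e2, u] :: real^3^3)"
  have "Q ** transpose Q = mat 1"
  proof -
    have "(Q ** transpose Q) $ a $ b = (Q $ a) \<bullet> (Q $ b)" for a b
      by (simp add: matrix_matrix_mult_def transpose_def inner_vec_def)
    moreover have "(Q $ a) \<bullet> (Q $ b) = (if a = b then 1 else 0)" for a b
      using exhaust_3[of a] exhaust_3[of b] assms u by (auto simp: Q_def vector_3)
    ultimately show ?thesis by (simp add: vec_eq_iff mat_def)
  qed
  then have "transpose Q ** Q = mat 1" using matrix_left_right_inverse by blast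
  then have "(transpose Q ** Q) $ i $ j = (if i = j then 1 else 0)" by (simp add: mat_def)
  then have "e1 $ i * e1 $ j + e2 $ i * e2 $ j + u $ i * u $ j = (if i = j then 1 else 0)"
    by (simp add: matrix_matrix_mult_def transpose_def sum_3 Q_def vector_3)
  moreover have "u $ i * u $ j = k $ i * k $ j / (norm k)\<^sup>2" by (simp add: u_def power2_eq_square)
  ultimately show ?thesis by (simp only:)
qed

text \<open>Form factors that are polarization components of the Fourier transform \<open>F\<close>
  of a real vector field. The symmetry is imposed on \<open>F\<close>, since the polarization
  vectors at \<open>k\<close> and \<open>- k\<close> may be unrelated.\<close>

definition hermitian_field :: "real \<Rightarrow> (nat \<Rightarrow> real^3 \<Rightarrow> real^3) \<Rightarrow> (mode \<Rightarrow> complex) \<Rightarrow> bool" where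
  "hermitian_field L \<epsilon> f \<longleftrightarrow> (\<exists>F :: real^3 \<Rightarrow> 3 \<Rightarrow> complex. (\<forall>k i. F (- k) i = cnj (F k i)) \<and>
     (\<forall>m. f m = (\<Sum>i\<in>UNIV. of_real (\<epsilon> (snd m) (kvec L (fst m)) $ i) * F (kvec L (fst m)) i)))"

lemma hermitian_fieldE:
  assumes "hermitian_field L \<epsilon> f"
  obtains F :: "real^3 \<Rightarrow> 3 \<Rightarrow> complex" where "\<forall>k i. F (- k) i = cnj (F k i)"
    "\<forall>m. f m = (\<Sum>i\<in>UNIV. of_real (\<epsilon> (snd m) (kvec L (fst m)) $ i) * F (kvec L (fst m)) i)"
  using assms[unfolded hermitian_field_def] by (elim exE conjE)

lemma hermitian_fieldI:
  assumes "\<And>k i. F (- k) i = cnj (F k i)" "\<And>m. f m = (\<Sum>i\<in>UNIV. of_real (\<epsilon> (snd m) (kvec L (fst m)) $ i) * F (kvec L (fst m)) i)"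
  shows "hermitian_field L \<epsilon> f"
  unfolding hermitian_field_def by (rule exI[of _ F]) (intro conjI allI assms)

lemma hermitian_field_add:
  assumes "hermitian_field L \<epsilon> f" "hermitian_field L \<epsilon> g"
  shows "hermitian_field L \<epsilon> (\<lambda>m. f m + g m)"
proof -
  obtain F where F0: "\<forall>k i. F (- k) i = cnj (F k i)" "\<forall>m. f m = (\<Sum>i\<in>UNIV. of_real (\<epsilon> (snd m) (kvec L (fst m)) $ i) * F (kvec L (fst m)) i)"
    using hermitian_fieldE[OF assms(1)] .
  note F = F0[rule_format]
  obtain G where G0: "\<forall>k i. G (- k) i = cnj (G k i)" "\<forall>m. g m = (\<Sum>i\<in>UNIV. of_real (\<epsilon> (snd m) (kvec L (fst m)) $ i) * G (kvec L (fst m)) i)"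
    using hermitian_fieldE[OF assms(2)] .
  note G = G0[rule_format]
  show ?thesis
    by (rule hermitian_fieldI[of "\<lambda>k i. F k i + G k i"]) (simp_all only: F G complex_cnj_add distrib_left sum.distrib)
qed

lemma hermitian_field_scale:
  assumes "hermitian_field L \<epsilon> f"
  shows "hermitian_field L \<epsilon> (\<lambda>m. of_real c * f m)"
proof -
  obtain F where F0: "\<forall>k i. F (- k) i = cnj (F k i)" "\<forall>m. f m = (\<Sum>i\<in>UNIV. of_real (\<epsilon> (snd m) (kvec L (fst m)) $ i) * F (kvec L (fst m)) i)"
    using hermitian_fieldE[OF assms] .
  note F = F0[rule_format]
  show ?thesis
    by (rule hermitian_fieldI[of "\<lambda>k i. of_real c * F k i"])
      (simp_all only: F complex_cnj_mult complex_cnj_complex_of_real sum_distrib_left mult.left_commute)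
qed

lemma kvec_uminus: "kvec L (- n) = - kvec L n"
  by (cases n) (auto simp: vec_eq_iff forall_3 kvec_nth vector_3)

text \<open>The reflection \<open>k \<mapsto> - k\<close> conjugates the summand after the sum over the two polarizations, although
  the polarization vectors themselves need not be even or odd in \<open>k\<close>.\<close>
lemma Im_mip_hermitian_field:
  assumes L: "0 < L" and pol: "valid_polarization L \<epsilon>"
    and f: "hermitian_field L \<epsilon> f" and g: "hermitian_field L \<epsilon> g"
  shows "Im (mip (modes L \<Lambda>) f g) = 0"
proof -
  define Ns where "Ns = {n. 0 < norm (kvec L n) \<and> norm (kvec L n) < \<Lambda>}"
  have modes: "modes L \<Lambda> = Ns \<times> {1, 2}" by (auto simp: modes_def Ns_def)
  have fin: "finite Ns" using finite_modes[OF L, of \<Lambda>] unfolding modes by (rule finite_cartesian_productD1) auto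
  obtain F where F0: "\<forall>k i. F (- k) i = cnj (F k i)" "\<forall>m. f m = (\<Sum>i\<in>UNIV. of_real (\<epsilon> (snd m) (kvec L (fst m)) $ i) * F (kvec L (fst m)) i)"
    using hermitian_fieldE[OF f] .
  note F = F0[rule_format]
  obtain G where G0: "\<forall>k i. G (- k) i = cnj (G k i)" "\<forall>m. g m = (\<Sum>i\<in>UNIV. of_real (\<epsilon> (snd m) (kvec L (fst m)) $ i) * G (kvec L (fst m)) i)"
    using hermitian_fieldE[OF g] .
  note G = G0[rule_format]
  \<comment> \<open>By completeness the polarization sum becomes the projection orthogonal to
    \<open>k\<close>, which is even in \<open>k\<close> and free of the chosen polarization
    vectors.\<close>
  define T where "T k = (\<Sum>i\<in>UNIV. \<Sum>j\<in>UNIV. of_real ((if i = j then 1 else 0) - k $ i * k $ j / (norm k)\<^sup>2) * (cnj (F k i) * G k j))" for k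
  have T: "T (- k) = cnj (T k)" for k by (simp add: T_def F(1) G(1))
  have "mip (modes L \<Lambda>) f g = (\<Sum>n\<in>Ns. \<Sum>lam\<in>{1, 2}. cnj (f (n, lam)) * g (n, lam))"
    unfolding mip_def modes sum.cartesian_product by simp
  also have "\<dots> = (\<Sum>n\<in>Ns. T (kvec L n))"
  proof (intro sum.cong refl)
    fix n assume "n \<in> Ns"
    then have k: "kvec L n \<noteq> 0" by (auto simp: Ns_def)
    define e1 where "e1 = \<epsilon> 1 (kvec L n)"
    define e2 where "e2 = \<epsilon> 2 (kvec L n)"
    note v = pol[unfolded valid_polarization_def, rule_format, OF k]
    have P: "e1 $ i * e1 $ j + e2 $ i * e2 $ j = (if i = j then 1 else 0) - kvec L n $ i * kvec L n $ j / (norm (kvec L n))\<^sup>2" for i j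
      using v k unfolding e1_def e2_def by (intro polarization_completeness) auto
    have "cnj (f (n, lam)) * g (n, lam) = (\<Sum>i\<in>UNIV. \<Sum>j\<in>UNIV. of_real (\<epsilon> lam (kvec L n) $ i * \<epsilon> lam (kvec L n) $ j) * (cnj (F (kvec L n) i) * G (kvec L n) j))" for lam
      unfolding F(2) G(2) cnj_sum sum_product by (simp add: mult_ac)
    then have "(\<Sum>lam\<in>{1, 2}. cnj (f (n, lam)) * g (n, lam)) =
      (\<Sum>i\<in>UNIV. \<Sum>j\<in>UNIV. of_real (e1 $ i * e1 $ j + e2 $ i * e2 $ j) * (cnj (F (kvec L n) i) * G (kvec L n) j))"
      by (simp add: e1_def e2_def sum.distrib distrib_right)
    then show "(\<Sum>lam\<in>{1, 2}. cnj (f (n, lam)) * g (n, lam)) = T (kvec L n)"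
      unfolding P T_def .
  qed
  finally have mip: "mip (modes L \<Lambda>) f g = (\<Sum>n\<in>Ns. T (kvec L n))" .
  have "(\<Sum>n\<in>Ns. T (kvec L n)) = (\<Sum>n\<in>Ns. T (kvec L (- n)))"
    by (rule sum.reindex_bij_witness[of _ uminus uminus]) (auto simp: Ns_def kvec_uminus)
  also have "\<dots> = cnj (\<Sum>n\<in>Ns. T (kvec L n))" by (simp add: kvec_uminus T)
  finally have "mip (modes L \<Lambda>) f g = cnj (mip (modes L \<Lambda>) f g)" by (simp add: mip)
  then show ?thesis by (metis Im_complex_of_real Reals_cnj_iff complex_is_Real_iff)
qed

section \<open>Taylor expansion of the coupling function in the position\<close>

definition amplitude :: "real \<Rightarrow> (nat \<Rightarrow> real^3 \<Rightarrow> real^3) \<Rightarrow> 3 \<Rightarrow> mode \<Rightarrow> real" where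
  "amplitude L \<epsilon> j m = 1 / sqrt (2 * L ^ 3) * (1 / sqrt (norm (kvec L (fst m)))) * (\<epsilon> (snd m) (kvec L (fst m)) $ j)"

definition monomial_mode :: "real \<Rightarrow> (nat \<Rightarrow> real^3 \<Rightarrow> real^3) \<Rightarrow> 3 \<times> nat \<times> nat \<times> nat \<Rightarrow> mode \<Rightarrow> complex" where
  "monomial_mode L \<epsilon> = (\<lambda>(j, a, b, c) m. of_real (amplitude L \<epsilon> j m) *
     ((- \<i> * of_real (kvec L (fst m) $ 1)) ^ a * (- \<i> * of_real (kvec L (fst m) $ 2)) ^ b * (- \<i> * of_real (kvec L (fst m) $ 3)) ^ c))"

text \<open>Each factor \<open>- \<i>\<close> times a component of \<open>k\<close> is conjugated by
  the reflection of \<open>k\<close>, and the prefactor is real and even. This is why the powers of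
  \<open>- \<i>\<close> stay in the mode and not in the coefficients.\<close>

lemma hermitian_field_monomial_mode: "hermitian_field L \<epsilon> (monomial_mode L \<epsilon> p)"
proof -
  obtain j a b c where p: "p = (j, a, b, c)" by (metis surj_pair)
  define F where "F k i = (if i = j then of_real (1 / sqrt (2 * L ^ 3) * (1 / sqrt (norm k))) *
     ((- \<i> * of_real (k $ 1)) ^ a * (- \<i> * of_real (k $ 2)) ^ b * (- \<i> * of_real (k $ 3)) ^ c) else 0)" for k :: "real^3" and i
  have "monomial_mode L \<epsilon> p m = (\<Sum>i\<in>UNIV. of_real (\<epsilon> (snd m) (kvec L (fst m)) $ i) * F (kvec L (fst m)) i)" for m
  proof -
    have "(\<Sum>i\<in>UNIV. of_real (\<epsilon> (snd m) (kvec L (fst m)) $ i) * F (kvec L (fst m)) i) =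
       (\<Sum>i\<in>UNIV. if i = j then of_real (\<epsilon> (snd m) (kvec L (fst m)) $ j) * F (kvec L (fst m)) j else 0)"
      by (intro sum.cong) (auto simp: F_def)
    also have "\<dots> = of_real (\<epsilon> (snd m) (kvec L (fst m)) $ j) * F (kvec L (fst m)) j" by simp
    also have "\<dots> = monomial_mode L \<epsilon> p m"
      by (simp add: p monomial_mode_def amplitude_def F_def)
    finally show ?thesis by simp
  qed
  moreover have "F (- k) i = cnj (F k i)" for k i by (simp add: F_def)
  ultimately show ?thesis by (intro hermitian_fieldI[of F])
qed

definition taylor_coupling :: "real \<Rightarrow> (nat \<Rightarrow> real^3 \<Rightarrow> real^3) \<Rightarrow> nat \<Rightarrow> 3 \<Rightarrow> real^3 \<Rightarrow> mode \<Rightarrow> complex" where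
  "taylor_coupling L \<epsilon> D j x m = of_real (amplitude L \<epsilon> j m) * (\<Sum>n\<le>D. (- \<i> * of_real (x \<bullet> kvec L (fst m))) ^ n / fact n)"

text \<open>Expanding the powers of the inner product separates \<open>x\<close> from
  \<open>k\<close>. The position enters through real coefficients only, so a single finite real
  space contains the truncated couplings for all \<open>x\<close>.\<close>

lemma taylor_coupling_eq:
  "taylor_coupling L \<epsilon> D j x m = (\<Sum>n\<le>D. \<Sum>a\<le>n. \<Sum>b\<le>n - a.
     of_real (1 / fact n * of_nat (n choose a) * of_nat (n - a choose b) * (x $ 1) ^ a * (x $ 2) ^ b * (x $ 3) ^ (n - a - b)) *
     monomial_mode L \<epsilon> (j, a, b, n - a - b) m)"
proof -
  define z where "z i = - \<i> * complex_of_real (kvec L (fst m) $ i)" for i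
  have e: "- \<i> * complex_of_real (x \<bullet> kvec L (fst m)) = of_real (x $ 1) * z 1 + (of_real (x $ 2) * z 2 + of_real (x $ 3) * z 3)"
    by (simp add: z_def inner_vec_def sum_3 algebra_simps)
  show ?thesis
    unfolding taylor_coupling_def e binomial_ring[of "of_real (x $ 1) * z 1"] binomial_ring[of "of_real (x $ 2) * z 2"]
      monomial_mode_def prod.case z_def[symmetric] sum_distrib_left sum_distrib_right sum_divide_distrib
    by (intro sum.cong refl) (simp add: power_mult_distrib)
qed

context orthonormal_modes
begin

lemma real_span_scale: "real_span g \<Longrightarrow> real_span (\<lambda>m. of_real a * g m)"
proof -
  assume "real_span g"
  then obtain c where "\<forall>m\<in>M. g m = (\<Sum>i<d. of_real (c i) * f i m)" unfolding real_span_def by blast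
  then show ?thesis unfolding real_span_def
    by (intro exI[of _ "\<lambda>i. a * c i"]) (simp add: sum_distrib_left mult.assoc)
qed

lemma real_span_sum: "(\<And>i. i \<in> I \<Longrightarrow> real_span (g i)) \<Longrightarrow> real_span (\<lambda>m. \<Sum>i\<in>I. g i m)"
proof (induction I rule: infinite_finite_induct)
  case (insert i I)
  then obtain c c' where "\<forall>m\<in>M. g i m = (\<Sum>i<d. of_real (c i) * f i m)"
    "\<forall>m\<in>M. (\<Sum>i\<in>I. g i m) = (\<Sum>i<d. of_real (c' i) * f i m)"
    unfolding real_span_def by force
  with insert show ?case unfolding real_span_def
    by (intro exI[of _ "\<lambda>i. c i + c' i"]) (simp add: distrib_right sum.distrib)
qed (auto simp: real_span_def intro!: exI[of _ "\<lambda>_. 0"])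

end

text \<open>Gram-Schmidt applied to the monomial modes with all three exponents at most
  \<open>D\<close>, a box that contains every monomial of total degree at most \<open>D\<close>; the
  dimension is thus of order \<open>D ^ 3\<close>, independently of the number of photon
  modes.\<close>

lemma taylor_coupling_real_span:
  assumes L: "0 < L" and pol: "valid_polarization L \<epsilon>" and ne: "modes L \<Lambda> \<noteq> {}"
  obtains d f where "orthonormal_modes (modes L \<Lambda>) f d" "d \<le> 3 * (D + 1) ^ 3"
    "\<And>j x. orthonormal_modes.real_span (modes L \<Lambda>) f d (taylor_coupling L \<epsilon> D j x)"
proof -
  let ?M = "modes L \<Lambda>"
  define B where "B = monomial_mode L \<epsilon> ` (UNIV \<times> {..D} \<times> {..D} \<times> {..D})"
  have cB: "card B \<le> 3 * (D + 1) ^ 3"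
  proof -
    have "card B \<le> card ((UNIV :: 3 set) \<times> {..D} \<times> {..D} \<times> {..D})" unfolding B_def by (rule card_image_le) simp
    also have "\<dots> = 3 * (D + 1) ^ 3" by (simp add: card_cartesian_product power3_eq_cube)
    finally show ?thesis .
  qed
  have "finite B" by (simp add: B_def)
  have HB: "hermitian_field L \<epsilon> b" if "b \<in> B" for b
    using that hermitian_field_monomial_mode by (auto simp: B_def)
  have "\<exists>d (f :: nat \<Rightarrow> mode \<Rightarrow> complex). d \<le> card B \<and> (\<forall>i<d. hermitian_field L \<epsilon> (f i)) \<and>
    (\<forall>i<d. \<forall>j<d. mip ?M (f i) (f j) = (if i = j then 1 else 0)) \<and>
    (\<forall>b\<in>B. \<exists>c :: nat \<Rightarrow> real. \<forall>m\<in>?M. b m = (\<Sum>i<d. of_real (c i) * f i m))"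
    by (rule real_gram_schmidt[where H = "hermitian_field L \<epsilon>"])
      (fact finite_modes[OF L] \<open>finite B\<close> HB Im_mip_hermitian_field[OF L pol]
        hermitian_field_add hermitian_field_scale)+
  then obtain d f where d: "d \<le> card B"
    and on: "\<forall>i<d. \<forall>j<d. mip ?M (f i) (f j) = (if i = j then 1 else 0)"
    and span: "\<forall>b\<in>B. \<exists>c :: nat \<Rightarrow> real. \<forall>m\<in>?M. b m = (\<Sum>i<d. of_real (c i) * f i m)"
    by (elim exE conjE)
  \<comment> \<open>An empty basis would force the modes of degree 0 to vanish, hence all components
    of a polarization vector of norm 1.\<close>
  have "d \<noteq> 0"
  proof
    assume "d = 0"
    from ne obtain m where m: "m \<in> ?M" by blast
    have "amplitude L \<epsilon> j m = 0" for j
    proof -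
      have "monomial_mode L \<epsilon> (j, 0, 0, 0) \<in> B" by (auto simp: B_def)
      then have "monomial_mode L \<epsilon> (j, 0, 0, 0) m = 0" using span m \<open>d = 0\<close> by force
      then show ?thesis by (simp add: monomial_mode_def)
    qed
    then have "\<epsilon> (snd m) (kvec L (fst m)) $ j = 0" for j
      using L modes_pos[OF m] by (simp add: amplitude_def)
    then have "\<epsilon> (snd m) (kvec L (fst m)) = 0" by (simp add: vec_eq_iff)
    then show False using polarization_inner(2)[OF pol m] by simp
  qed
  then interpret orthonormal_modes ?M f d
    using on by unfold_locales (auto simp: finite_modes[OF L])
  have rs: "real_span (monomial_mode L \<epsilon> p)" if "p \<in> UNIV \<times> {..D} \<times> {..D} \<times> {..D}" for p
    using span that unfolding B_def real_span_def by blast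
  have "real_span (taylor_coupling L \<epsilon> D j x)" for j x
    unfolding taylor_coupling_eq
    by (intro real_span_sum real_span_scale rs) auto
  then show ?thesis using that orthonormal_modes_axioms d cB by (meson le_trans)
qed

lemma norm_coupling_diff_le:
  assumes "norm x * norm (kvec L (fst m)) \<le> y"
  shows "cmod (coupling L \<epsilon> j x m - taylor_coupling L \<epsilon> D j x m) \<le> \<bar>amplitude L \<epsilon> j m\<bar> * (y ^ Suc D / fact D)"
proof -
  define \<theta> where "\<theta> = x \<bullet> kvec L (fst m)"
  have \<theta>: "\<bar>\<theta>\<bar> \<le> y" using Cauchy_Schwarz_ineq2[of x "kvec L (fst m)"] assms by (simp add: \<theta>_def)
  have "coupling L \<epsilon> j x m - taylor_coupling L \<epsilon> D j x m =
      of_real (amplitude L \<epsilon> j m) * (exp (- \<i> * of_real \<theta>) - (\<Sum>n\<le>D. (- \<i> * of_real \<theta>) ^ n / fact n))"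
    by (simp add: coupling_def taylor_coupling_def amplitude_def cis_conv_exp \<theta>_def right_diff_distrib)
  then have "cmod (coupling L \<epsilon> j x m - taylor_coupling L \<epsilon> D j x m) =
      \<bar>amplitude L \<epsilon> j m\<bar> * cmod (exp (- \<i> * of_real \<theta>) - (\<Sum>n\<le>D. (- \<i> * of_real \<theta>) ^ n / fact n))"
    by (simp only: norm_mult norm_of_real)
  \<comment> \<open>The argument of the exponential is purely imaginary, so the factor with the real
    part is 1.\<close>
  also have "\<dots> \<le> \<bar>amplitude L \<epsilon> j m\<bar> * (exp \<bar>Re (- \<i> * of_real \<theta>)\<bar> * cmod (- \<i> * of_real \<theta>) ^ Suc D / fact D)"
    by (intro mult_left_mono Taylor_exp) auto
  also have "\<dots> = \<bar>amplitude L \<epsilon> j m\<bar> * (\<bar>\<theta>\<bar> ^ Suc D / fact D)" by (simp add: norm_mult)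
  also have "\<dots> \<le> \<bar>amplitude L \<epsilon> j m\<bar> * (y ^ Suc D / fact D)"
    using \<theta> by (intro mult_left_mono divide_right_mono power_mono) auto
  finally show ?thesis .
qed

section \<open>The trial state\<close>

text \<open>Squaring smooths the kink of the positive part: the difference quotient at 0 is bounded
  by the step. The bump function is a square for this reason, being continuously differentiable
  across the sphere where its support ends.\<close>

lemma has_real_derivative_pos_part_sq:
  "((\<lambda>s. (max 0 s)\<^sup>2) has_real_derivative 2 * max 0 s) (at (s :: real))"
proof -
  consider "0 < s" | "s < 0" | "s = 0" by linarith
  then show ?thesis
  proof cases
    case 1
    have "((\<lambda>s. s\<^sup>2) has_real_derivative 2 * max 0 s) (at s)"
      using 1 by (auto intro!: derivative_eq_intros)
    then show ?thesis
      by (rule has_field_derivative_transform_within_open[where S = "{0<..}"]) (use 1 in auto)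
  next
    case 2
    have "((\<lambda>s. 0) has_real_derivative 2 * max 0 s) (at s)"
      using 2 by (auto intro!: derivative_eq_intros)
    then show ?thesis
      by (rule has_field_derivative_transform_within_open[where S = "{..<0}"]) (use 2 in auto)
  next
    case 3
    have "((\<lambda>h. ((max 0 (0 + h))\<^sup>2 - (max 0 0)\<^sup>2) / h) \<longlongrightarrow> 0) (at (0 :: real))"
    proof (rule Lim_null_comparison[where g = "\<lambda>h. \<bar>h\<bar>"])
      show "\<forall>\<^sub>F h in at (0 :: real). norm (((max 0 (0 + h))\<^sup>2 - (max 0 0)\<^sup>2) / h) \<le> \<bar>h\<bar>"
        by (intro always_eventually allI) (auto simp: max_def power2_eq_square)
      show "((\<lambda>h. \<bar>h\<bar>) \<longlongrightarrow> 0) (at (0 :: real))"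
        by (rule tendsto_eq_intros | simp)+
    qed
    then show ?thesis using 3 by (simp add: DERIV_def)
  qed
qed

definition bump :: "real \<Rightarrow> real^3 \<Rightarrow> real" where
  "bump l x = (max 0 (1 - (x \<bullet> x) / l\<^sup>2))\<^sup>2"

definition bump_deriv :: "real \<Rightarrow> real^3 \<Rightarrow> 3 \<Rightarrow> real" where
  "bump_deriv l x j = - (4 / l\<^sup>2) * max 0 (1 - (x \<bullet> x) / l\<^sup>2) * x $ j"

lemma bump_has_derivative:
  "(bump l has_derivative (\<lambda>v. - (4 / l\<^sup>2) * max 0 (1 - (x \<bullet> x) / l\<^sup>2) * (x \<bullet> v))) (at x)"
proof -
  have "((\<lambda>x. 1 - inverse (l\<^sup>2) * (x \<bullet> x)) has_derivative (\<lambda>v. - (inverse (l\<^sup>2) * (2 * (x \<bullet> v))))) (at x)"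
    by (auto intro!: derivative_eq_intros simp: inner_commute)
  then have "((\<lambda>x. 1 - (x \<bullet> x) / l\<^sup>2) has_derivative (\<lambda>v. - (2 * (x \<bullet> v) / l\<^sup>2))) (at x)"
    by (simp add: divide_inverse mult_ac)
  from has_derivative_compose[OF this has_real_derivative_pos_part_sq[unfolded has_field_derivative_def]]
  show ?thesis unfolding bump_def[abs_def] by (simp add: mult_ac)
qed

lemma bump_eq_0:
  assumes "0 < l" "l \<le> norm x"
  shows "bump l x = 0"
proof -
  have "l\<^sup>2 \<le> x \<bullet> x" using assms by (simp add: power2_norm_eq_inner[symmetric] power_mono)
  then show ?thesis using assms by (simp add: bump_def max_def)
qed

lemma continuous_on_bump: "continuous_on UNIV (bump l)" "continuous_on UNIV (\<lambda>x. bump_deriv l x j)"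
  unfolding bump_def[abs_def] bump_deriv_def divide_inverse by (intro continuous_intros)+

lemma ccs_bump:
  assumes "0 < l"
  shows "ccs (bump l)"
  unfolding ccs_def using continuous_on_bump(1) bump_eq_0[OF assms] by (blast intro: less_imp_le)

text \<open>A product state. The squeezed vector controls the field at all points of the ball
  simultaneously, so the photons need not follow the electron.\<close>

definition trial :: "real \<Rightarrow> (config \<Rightarrow> complex) \<Rightarrow> state" where
  "trial l \<xi> x \<nu> = of_real (bump l x) * \<xi> \<nu>"

lemma trial_has_derivative:
  "((\<lambda>y. trial l \<xi> y \<nu>) has_derivative
     (\<lambda>v. of_real (- (4 / l\<^sup>2) * max 0 (1 - (x \<bullet> x) / l\<^sup>2) * (x \<bullet> v)) * \<xi> \<nu>)) (at x)"
  unfolding trial_def by (intro has_derivative_mult_left has_derivative_of_real bump_has_derivative)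

lemma pdiff_trial: "pdiff (trial l \<xi>) \<nu> j x = of_real (bump_deriv l x j) * \<xi> \<nu>"
  unfolding pdiff_def frechet_derivative_at[OF trial_has_derivative, symmetric] bump_deriv_def
  by (simp add: inner_axis)

lemma admissible_trial:
  assumes l: "0 < l" and fs: "finite (supp \<xi>)" and M: "\<And>\<nu> m. \<xi> \<nu> \<noteq> 0 \<Longrightarrow> m \<notin> modes L \<Lambda> \<Longrightarrow> \<nu> m = 0"
  shows "admissible L \<Lambda> (trial l \<xi>)"
  unfolding admissible_def
proof (intro conjI allI impI)
  show "finite {\<nu>. \<exists>x. trial l \<xi> x \<nu> \<noteq> 0}"
    by (rule finite_subset[OF _ fs]) (auto simp: trial_def supp_def)
  show "\<nu> m = 0" if "trial l \<xi> x \<nu> \<noteq> 0" "m \<notin> modes L \<Lambda>" for x \<nu> m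
  proof (rule M)
    show "\<xi> \<nu> \<noteq> 0" using that(1) by (simp add: trial_def)
  qed (rule that(2))
  show "(\<lambda>y. trial l \<xi> y \<nu>) differentiable at x" for x \<nu>
    using trial_has_derivative unfolding differentiable_def by blast
  show "continuous_on UNIV (pdiff (trial l \<xi>) \<nu> j)" for \<nu> j
  proof -
    have "continuous_on UNIV (\<lambda>x. of_real (bump_deriv l x j) * \<xi> \<nu>)"
      by (intro continuous_intros continuous_on_bump)
    then show ?thesis by (simp add: pdiff_trial[abs_def])
  qed
  show "\<exists>R. \<forall>x. R < norm x \<longrightarrow> trial l \<xi> x \<nu> = 0" for \<nu>
    by (rule exI[of _ l]) (auto simp: trial_def bump_eq_0[OF l])
qed

lemma sum_bump_deriv_sq_le:
  assumes "0 < l"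
  shows "(\<Sum>j\<in>UNIV. (bump_deriv l x j)\<^sup>2) \<le> 16 / l\<^sup>2 * indicator (cball 0 l) x"
proof -
  define s where "s = max 0 (1 - (x \<bullet> x) / l\<^sup>2)"
  have s: "0 \<le> s" "s \<le> 1" by (auto simp: s_def)
  have "(\<Sum>j\<in>UNIV. (bump_deriv l x j)\<^sup>2) = (16 / l\<^sup>2) * (s\<^sup>2 * ((norm x)\<^sup>2 / l\<^sup>2))"
    unfolding bump_deriv_def s_def[symmetric] sum_component_sq[symmetric]
    by (simp add: power_mult_distrib sum_distrib_left power_divide sum_divide_distrib mult_ac)
  also have "\<dots> \<le> (16 / l\<^sup>2) * indicator (cball 0 l) x"
  proof (cases "norm x \<le> l")
    case True
    then have "(norm x)\<^sup>2 / l\<^sup>2 \<le> 1" using assms by (simp add: power_mono)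
    moreover have "s\<^sup>2 \<le> 1" using s by (simp add: power_le_one)
    ultimately have "s\<^sup>2 * ((norm x)\<^sup>2 / l\<^sup>2) \<le> 1 * 1" by (intro mult_mono) auto
    then show ?thesis using True assms by (intro mult_left_mono) auto
  next
    case False
    then have "bump l x = 0" using bump_eq_0[OF assms] by simp
    then have "s = 0" by (simp add: bump_def s_def)
    then show ?thesis by simp
  qed
  finally show ?thesis .
qed

text \<open>On the ball of half the radius the bump is at least 9/16, so its square is at least
  81/256, and the full ball has 8 times that volume. The constant 405 rounds up
  \<open>16 * 8 * 256 / 81\<close>.\<close>

lemma integral_bump_sq:
  assumes "0 < l"
  shows "integrable lborel (\<lambda>x. (bump l x)\<^sup>2)" "0 < (LINT x|lborel. (bump l x)\<^sup>2)"
    "16 / l\<^sup>2 * measure lborel (cball 0 l :: (real^3) set) \<le> 405 / l\<^sup>2 * (LINT x|lborel. (bump l x)\<^sup>2)"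
proof -
  show int: "integrable lborel (\<lambda>x. (bump l x)\<^sup>2)"
    by (rule ccs_integrable) (rule ccs_compose[OF ccs_bump[OF assms], of "\<lambda>z. z\<^sup>2"], auto intro!: continuous_intros)
  define V where "V = measure lborel (cball 0 (l / 2) :: (real^3) set)"
  have V: "measure lborel (cball 0 l :: (real^3) set) = 8 * V" "0 < V"
    using assms by (simp_all add: V_def content_cball power_divide)
  have i2: "integrable lborel (\<lambda>x. 81 / 256 * indicator (cball 0 (l / 2) :: (real^3) set) x :: real)"
    using emeasure_lborel_cball_finite[of "0 :: real^3" "l / 2"]
    by (intro integrable_mult_right integrable_real_indicator) auto
  have "81 / 256 * V = (LINT x|lborel. 81 / 256 * indicator (cball 0 (l / 2) :: (real^3) set) x)"
    by (simp add: V_def)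
  also have "\<dots> \<le> (LINT x|lborel. (bump l x)\<^sup>2)"
  proof (intro integral_mono int i2)
    fix x :: "real^3"
    show "81 / 256 * indicator (cball 0 (l / 2)) x \<le> (bump l x)\<^sup>2"
    proof (cases "norm x \<le> l / 2")
      case True
      then have "(norm x)\<^sup>2 \<le> (l / 2)\<^sup>2" by (intro power_mono) auto
      then have "x \<bullet> x \<le> l\<^sup>2 / 4" by (simp add: power2_norm_eq_inner power_divide)
      then have "3 / 4 \<le> 1 - (x \<bullet> x) / l\<^sup>2" using assms by (simp add: field_simps)
      then have "(3 / 4)\<^sup>2 \<le> bump l x" unfolding bump_def by (intro power_mono max.coboundedI2) auto
      then have "((3 / 4)\<^sup>2)\<^sup>2 \<le> (bump l x)\<^sup>2" by (intro power_mono) auto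
      then show ?thesis using True by (simp add: power_divide)
    qed auto
  qed
  finally have low: "81 / 256 * V \<le> (LINT x|lborel. (bump l x)\<^sup>2)" .
  then show "0 < (LINT x|lborel. (bump l x)\<^sup>2)" using V(2) by linarith
  have "16 * measure lborel (cball 0 l :: (real^3) set) \<le> 405 * (LINT x|lborel. (bump l x)\<^sup>2)"
    using low V by linarith
  then have "16 * measure lborel (cball 0 l :: (real^3) set) / l\<^sup>2 \<le> 405 * (LINT x|lborel. (bump l x)\<^sup>2) / l\<^sup>2"
    by (rule divide_right_mono) simp
  then show "16 / l\<^sup>2 * measure lborel (cball 0 l :: (real^3) set) \<le> 405 / l\<^sup>2 * (LINT x|lborel. (bump l x)\<^sup>2)"
    by simp
qed

text \<open>The cross term between momentum and field is absorbed by \<open>nsq_add_le\<close>,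
  whose factor 2 cancels the 1/2 of the kinetic energy. Outside the ball the bump vanishes, so a
  field bound inside it is enough.\<close>

lemma energy_trial_le:
  assumes L: "0 < L" and l: "0 < l" and fs: "finite (supp \<xi>)" and \<alpha>: "0 < \<alpha>"
    and M: "\<And>\<nu> m. \<xi> \<nu> \<noteq> 0 \<Longrightarrow> m \<notin> modes L \<Lambda> \<Longrightarrow> \<nu> m = 0"
    and \<Lambda>: "0 < \<Lambda>"
    and field: "\<And>x. norm x \<le> l \<Longrightarrow> (\<Sum>j\<in>UNIV. nsq (field_A L \<Lambda> \<epsilon> j x \<xi>)) \<le> Q * nsq \<xi>"
    and number: "(\<Sum>m\<in>modes L \<Lambda>. nsq (Ann m \<xi>)) \<le> P * nsq \<xi>"
  shows "energy_form \<alpha> L \<Lambda> \<epsilon> (trial l \<xi>) \<le> (405 / l\<^sup>2 + \<alpha> * Q + \<Lambda> * P) * norm_sq (trial l \<xi>)"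
    and "norm_sq (trial l \<xi>) = (LINT x|lborel. (bump l x)\<^sup>2) * nsq \<xi>"
proof -
  let ?M = "modes L \<Lambda>" and ?T = "trial l \<xi>"
  define I where "I = (LINT x|lborel. (bump l x)\<^sup>2)"
  have adm: "admissible L \<Lambda> ?T" by (rule admissible_trial[OF l fs]) (rule M)
  note b = integral_bump_sq[OF l]
  have T: "?T x = (\<lambda>\<nu>. of_real (bump l x) * \<xi> \<nu>)" for x by (simp add: trial_def fun_eq_iff)
  have nT: "nsq (?T x) = (bump l x)\<^sup>2 * nsq \<xi>" for x unfolding T nsq_scale[OF fs] by simp
  show N: "norm_sq ?T = (LINT x|lborel. (bump l x)\<^sup>2) * nsq \<xi>"
    unfolding norm_sq_eq(1)[OF adm] nT using b(1) by simp
  note E = energy_form_eq(1)[OF L adm, of \<alpha> \<epsilon>] energy_form_eq(2,3)[OF L adm]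
  have cb: "integrable lborel (\<lambda>x. indicator (cball 0 l :: (real^3) set) x :: real)" 
    using emeasure_lborel_cball_finite[of "0 :: real^3" l] by (intro integrable_real_indicator) auto
  have kin: "nsq (kinetic_vec \<alpha> L \<Lambda> \<epsilon> ?T j x) \<le> 2 * ((bump_deriv l x j)\<^sup>2 * nsq \<xi>) + 2 * (\<alpha> * ((bump l x)\<^sup>2 * nsq (field_A L \<Lambda> \<epsilon> j x \<xi>)))" for j x
  proof -
    have fA: "finite (supp (field_A L \<Lambda> \<epsilon> j x \<xi>))" unfolding field_A_eq using fs by auto
    have "field_A L \<Lambda> \<epsilon> j x (?T x) = (\<lambda>\<nu>. of_real (bump l x) * field_A L \<Lambda> \<epsilon> j x \<xi> \<nu>)"
      unfolding T field_A_eq aop_scale cop_scale by (simp add: distrib_left)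
    then have "kinetic_vec \<alpha> L \<Lambda> \<epsilon> ?T j x =
      (\<lambda>\<nu>. (- \<i> * of_real (bump_deriv l x j)) * \<xi> \<nu> + (of_real (sqrt \<alpha>) * of_real (bump l x)) * field_A L \<Lambda> \<epsilon> j x \<xi> \<nu>)"
      by (simp add: kinetic_vec_def[abs_def] pdiff_trial mult_ac)
    then have "nsq (kinetic_vec \<alpha> L \<Lambda> \<epsilon> ?T j x) \<le>
      2 * nsq (\<lambda>\<nu>. (- \<i> * of_real (bump_deriv l x j)) * \<xi> \<nu>) +
      2 * nsq (\<lambda>\<nu>. (of_real (sqrt \<alpha>) * of_real (bump l x)) * field_A L \<Lambda> \<epsilon> j x \<xi> \<nu>)"
      by (simp only: nsq_add_le[OF finite_supp_scale[OF fs] finite_supp_scale[OF fA]])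
    also have "\<dots> = 2 * ((bump_deriv l x j)\<^sup>2 * nsq \<xi>) + 2 * (\<alpha> * ((bump l x)\<^sup>2 * nsq (field_A L \<Lambda> \<epsilon> j x \<xi>)))"
      unfolding nsq_scale[OF fs] nsq_scale[OF fA] using \<alpha> by (simp add: norm_mult power_mult_distrib)
    finally show ?thesis .
  qed
  have kinsum: "(\<Sum>j\<in>UNIV. nsq (kinetic_vec \<alpha> L \<Lambda> \<epsilon> ?T j x)) \<le>
      2 * (16 / l\<^sup>2) * nsq \<xi> * indicator (cball 0 l) x + 2 * \<alpha> * Q * nsq \<xi> * (bump l x)\<^sup>2" for x
  proof -
    have "(\<Sum>j\<in>UNIV. nsq (kinetic_vec \<alpha> L \<Lambda> \<epsilon> ?T j x)) \<le>
      (\<Sum>j\<in>UNIV. 2 * ((bump_deriv l x j)\<^sup>2 * nsq \<xi>) + 2 * (\<alpha> * ((bump l x)\<^sup>2 * nsq (field_A L \<Lambda> \<epsilon> j x \<xi>))))"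
      by (intro sum_mono kin)
    also have "\<dots> = 2 * nsq \<xi> * (\<Sum>j\<in>UNIV. (bump_deriv l x j)\<^sup>2) + 2 * \<alpha> * ((bump l x)\<^sup>2 * (\<Sum>j\<in>UNIV. nsq (field_A L \<Lambda> \<epsilon> j x \<xi>)))"
      by (simp add: sum.distrib sum_distrib_left mult_ac)
    also have "\<dots> \<le> 2 * nsq \<xi> * (16 / l\<^sup>2 * indicator (cball 0 l) x) + 2 * \<alpha> * ((bump l x)\<^sup>2 * (Q * nsq \<xi>))"
    proof (rule add_mono)
      have "(bump l x)\<^sup>2 * (\<Sum>j\<in>UNIV. nsq (field_A L \<Lambda> \<epsilon> j x \<xi>)) \<le> (bump l x)\<^sup>2 * (Q * nsq \<xi>)"
      proof (cases "norm x \<le> l")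
        case True
        then show ?thesis by (intro mult_left_mono field) auto
      next
        case False
        then show ?thesis using bump_eq_0[OF l] by simp
      qed
      then show "2 * \<alpha> * ((bump l x)\<^sup>2 * (\<Sum>j\<in>UNIV. nsq (field_A L \<Lambda> \<epsilon> j x \<xi>))) \<le> 2 * \<alpha> * ((bump l x)\<^sup>2 * (Q * nsq \<xi>))"
        by (rule mult_left_mono) (use \<alpha> in simp)
      show "2 * nsq \<xi> * (\<Sum>j\<in>UNIV. (bump_deriv l x j)\<^sup>2) \<le> 2 * nsq \<xi> * (16 / l\<^sup>2 * indicator (cball 0 l) x)"
        by (intro mult_left_mono[OF sum_bump_deriv_sq_le[OF l]]) (simp add: nsq_nonneg)
    qed
    finally show ?thesis by (simp add: mult_ac)
  qed
  have "(\<Sum>j\<in>UNIV. LINT x|lborel. nsq (kinetic_vec \<alpha> L \<Lambda> \<epsilon> ?T j x)) = (LINT x|lborel. (\<Sum>j\<in>UNIV. nsq (kinetic_vec \<alpha> L \<Lambda> \<epsilon> ?T j x)))"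
    by (intro Bochner_Integration.integral_sum[symmetric] E)
  also have "\<dots> \<le> (LINT x|lborel. 2 * (16 / l\<^sup>2) * nsq \<xi> * indicator (cball 0 l) x + 2 * \<alpha> * Q * nsq \<xi> * (bump l x)\<^sup>2)"
    by (intro integral_mono Bochner_Integration.integrable_sum E kinsum Bochner_Integration.integrable_add integrable_mult_right cb b(1))
  also have "\<dots> = 2 * nsq \<xi> * (16 / l\<^sup>2 * measure lborel (cball 0 l :: (real^3) set)) + 2 * \<alpha> * Q * nsq \<xi> * I"
    using cb b(1) by (simp add: I_def)
  also have "\<dots> \<le> 2 * nsq \<xi> * (405 / l\<^sup>2 * I) + 2 * \<alpha> * Q * nsq \<xi> * I"
    unfolding I_def using b(3) nsq_nonneg[of \<xi>] by (intro add_right_mono mult_left_mono) auto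
  finally have K: "(\<Sum>j\<in>UNIV. LINT x|lborel. nsq (kinetic_vec \<alpha> L \<Lambda> \<epsilon> ?T j x)) \<le> 2 * (405 / l\<^sup>2 + \<alpha> * Q) * (I * nsq \<xi>)"
    by (simp add: algebra_simps)
  have H: "(LINT x|lborel. (\<Sum>m\<in>?M. norm (kvec L (fst m)) * nsq (Ann m (?T x)))) \<le> \<Lambda> * P * (I * nsq \<xi>)"
  proof -
    have "(\<Sum>m\<in>?M. norm (kvec L (fst m)) * nsq (Ann m (?T x))) \<le> \<Lambda> * P * nsq \<xi> * (bump l x)\<^sup>2" for x
    proof -
      have "(\<Sum>m\<in>?M. norm (kvec L (fst m)) * nsq (Ann m (?T x))) \<le> (\<Sum>m\<in>?M. \<Lambda> * ((bump l x)\<^sup>2 * nsq (Ann m \<xi>)))"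
      proof (intro sum_mono)
        fix m assume "m \<in> ?M"
        have "nsq (Ann m (?T x)) = (bump l x)\<^sup>2 * nsq (Ann m \<xi>)"
          unfolding T Ann_scale nsq_scale[OF finite_supp_Ann[OF fs]] by simp
        then show "norm (kvec L (fst m)) * nsq (Ann m (?T x)) \<le> \<Lambda> * ((bump l x)\<^sup>2 * nsq (Ann m \<xi>))"
          using modes_less[OF \<open>m \<in> ?M\<close>] nsq_nonneg by (auto intro!: mult_right_mono mult_nonneg_nonneg)
      qed
      also have "\<dots> = \<Lambda> * (bump l x)\<^sup>2 * (\<Sum>m\<in>?M. nsq (Ann m \<xi>))" by (simp add: sum_distrib_left mult_ac)
      also have "\<dots> \<le> \<Lambda> * (bump l x)\<^sup>2 * (P * nsq \<xi>)" using number \<Lambda> by (intro mult_left_mono) auto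
      finally show ?thesis by (simp add: mult_ac)
    qed
    then have "(LINT x|lborel. (\<Sum>m\<in>?M. norm (kvec L (fst m)) * nsq (Ann m (?T x)))) \<le> (LINT x|lborel. \<Lambda> * P * nsq \<xi> * (bump l x)\<^sup>2)"
      by (intro integral_mono E integrable_mult_right b(1))
    then show ?thesis using b(1) by (simp add: I_def mult_ac)
  qed
  show "energy_form \<alpha> L \<Lambda> \<epsilon> ?T \<le> (405 / l\<^sup>2 + \<alpha> * Q + \<Lambda> * P) * norm_sq ?T"
  proof -
    have "1 / 2 * A + B \<le> (c + e) * z" if "A \<le> 2 * c * z" "B \<le> e * z" for A B c e z :: real
      using that by (simp add: distrib_right)
    from this[OF K H] show ?thesis unfolding E(1) N I_def .
  qed
qed

section \<open>The upper bound\<close>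

text \<open>A bound for arbitrary form factors, without any gain from squeezing. It serves the
  Taylor remainder, which leaves the squeezed space but is tiny in norm.\<close>

lemma nsq_field_le:
  assumes "finite M" "finite (supp \<xi>)"
  shows "nsq (\<lambda>\<nu>. aop M r \<xi> \<nu> + cop M r \<xi> \<nu>) \<le> mnsq M r * (4 * (\<Sum>m\<in>M. nsq (Ann m \<xi>)) + 2 * nsq \<xi>)"
proof -
  have "nsq (aop M r \<xi>) \<le> mnsq M r * (\<Sum>m\<in>M. nsq (Ann m \<xi>))"
    using nsq_aop_le[OF assms, of "\<lambda>_. 1" r] by (simp add: mnsq_def)
  moreover have "nsq (\<lambda>\<nu>. aop M r \<xi> \<nu> + cop M r \<xi> \<nu>) \<le> 2 * nsq (aop M r \<xi>) + 2 * nsq (cop M r \<xi>)"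
    using assms(2) by (intro nsq_add_le finite_supp_aop finite_supp_cop)
  ultimately show ?thesis by (simp add: nsq_cop[OF assms] algebra_simps)
qed

text \<open>The left side is the squared vacuum fluctuation of the potential. The polarizations are
  unit vectors, so it reduces to the sum of \<open>1 / |k|\<close>; the factor
  \<open>54 / (2 * pi) ^ 3\<close> is below 1.\<close>

lemma sum_amplitude_sq_le:
  assumes L: "0 < L" and pol: "valid_polarization L \<epsilon>" and \<Lambda>: "0 \<le> \<Lambda>"
  shows "(\<Sum>j\<in>UNIV. \<Sum>m\<in>modes L \<Lambda>. (amplitude L \<epsilon> j m)\<^sup>2) \<le> \<Lambda>\<^sup>2"
proof -
  have "(\<Sum>j\<in>UNIV. (amplitude L \<epsilon> j m)\<^sup>2) = 1 / (2 * L ^ 3) * (1 / norm (kvec L (fst m)))" if m: "m \<in> modes L \<Lambda>" for m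
  proof -
    have "(amplitude L \<epsilon> j m)\<^sup>2 = 1 / (2 * L ^ 3) * (1 / norm (kvec L (fst m))) * (\<epsilon> (snd m) (kvec L (fst m)) $ j)\<^sup>2" for j
      using L by (simp add: amplitude_def power_mult_distrib power_divide)
    then show ?thesis
      by (simp only: sum_distrib_left[symmetric] sum_component_sq polarization_inner(2)[OF pol m]) simp
  qed
  then have "(\<Sum>j\<in>UNIV. \<Sum>m\<in>modes L \<Lambda>. (amplitude L \<epsilon> j m)\<^sup>2) = (\<Sum>m\<in>modes L \<Lambda>. 1 / (2 * L ^ 3) * (1 / norm (kvec L (fst m))))"
    by (subst sum.swap) (intro sum.cong refl, simp)
  also have "\<dots> = 1 / (2 * L ^ 3) * (\<Sum>m\<in>modes L \<Lambda>. 1 / norm (kvec L (fst m)))"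
    by (rule sum_distrib_left[symmetric])
  also have "\<dots> \<le> 1 / (2 * L ^ 3) * (108 * (L / (2 * pi)) ^ 3 * \<Lambda>\<^sup>2)"
    using L by (intro mult_left_mono sum_inverse_norm_modes \<Lambda>) auto
  also have "\<dots> = 54 / (2 * pi) ^ 3 * \<Lambda>\<^sup>2"
    using L by (simp add: power_divide)
  also have "\<dots> \<le> 1 * \<Lambda>\<^sup>2"
  proof (intro mult_right_mono)
    have "(6 :: real) ^ 3 \<le> (2 * pi) ^ 3" using pi_gt3 by (intro power_mono) auto
    then have "54 \<le> (2 * pi) ^ 3" by simp
    then show "54 / (2 * pi) ^ 3 \<le> 1" by (simp add: pos_divide_le_eq del: power_mult_distrib)
  qed auto
  finally show ?thesis by simp
qed

text \<open>The bound with radius, squeezing and Taylor degree still free. In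
  \<open>16 * \<delta>\<close> a factor 2 stems from splitting off the remainder,
  \<open>2 * \<delta>\<close> from squeezing and 4 from the norm of the Taylor coupling; the term
  with \<open>\<rho>\<^sup>2\<close> is the remainder in a state with up to
  \<open>d0 / \<delta>\<close> photons on average.\<close>

lemma ground_state_energy_le:
  assumes L: "0 < L" and pol: "valid_polarization L \<epsilon>" and ne: "modes L \<Lambda> \<noteq> {}" and \<alpha>: "0 < \<alpha>"
    and l: "0 < l" and \<delta>: "0 < \<delta>" "\<delta> \<le> 1"
    and \<rho>: "\<rho> = (l * \<Lambda>) ^ Suc D / fact D" "\<rho> \<le> 1"
    and d0: "3 * real (D + 1) ^ 3 = d0"
  shows "ground_state_energy \<alpha> L \<Lambda> \<epsilon> \<le>
    ereal (405 / l\<^sup>2 + \<alpha> * (\<Lambda>\<^sup>2 * (16 * \<delta> + 2 * \<rho>\<^sup>2 * (4 * d0 / \<delta> + 2))) + \<Lambda> * (d0 / \<delta>))"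
proof -
  let ?M = "modes L \<Lambda>"
  have M: "finite ?M" by (rule finite_modes[OF L])
  from ne obtain m0 where m0: "m0 \<in> ?M" by blast
  have \<Lambda>: "0 < \<Lambda>" using modes_pos[OF m0] modes_less[OF m0] by linarith
  have \<rho>0: "0 \<le> \<rho>" using l \<Lambda> by (simp add: \<rho>(1))
  show ?thesis
  proof (rule taylor_coupling_real_span[OF L pol ne, of D])
    fix d f assume on: "orthonormal_modes ?M f d" and d: "d \<le> 3 * (D + 1) ^ 3"
      and rs: "\<And>j x. orthonormal_modes.real_span ?M f d (taylor_coupling L \<epsilon> D j x)"
    interpret orthonormal_modes ?M f d by (rule on)
    have dd: "real d \<le> d0"
    proof -
      have "real d \<le> real (3 * (D + 1) ^ 3)" using d by (rule of_nat_mono)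
      then show ?thesis using d0 by simp
    qed
    show ?thesis
    proof (rule squeezed_state[OF \<delta>])
      fix \<xi> assume fs: "finite (supp \<xi>)" and pos: "0 < nsq \<xi>"
        and supported: "\<And>\<nu> m. \<xi> \<nu> \<noteq> 0 \<Longrightarrow> m \<notin> ?M \<Longrightarrow> \<nu> m = 0"
        and sq: "\<And>g. real_span g \<Longrightarrow> nsq (\<lambda>\<nu>. aop ?M g \<xi> \<nu> + cop ?M g \<xi> \<nu>) \<le> 2 * \<delta> * mnsq ?M g * nsq \<xi>"
        and number: "(\<Sum>m\<in>?M. nsq (Ann m \<xi>)) \<le> real d / \<delta> * nsq \<xi>"
      have number': "(\<Sum>m\<in>?M. nsq (Ann m \<xi>)) \<le> d0 / \<delta> * nsq \<xi>"
        using number dd \<delta> pos by (meson divide_right_mono less_imp_le mult_right_mono order_trans)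
      define G where "G = (\<Sum>j\<in>UNIV. \<Sum>m\<in>?M. (amplitude L \<epsilon> j m)\<^sup>2)"
      have G: "G \<le> \<Lambda>\<^sup>2" unfolding G_def using \<Lambda> by (intro sum_amplitude_sq_le[OF L pol]) auto
      have field: "(\<Sum>j\<in>UNIV. nsq (field_A L \<Lambda> \<epsilon> j x \<xi>)) \<le> (\<Lambda>\<^sup>2 * (16 * \<delta> + 2 * \<rho>\<^sup>2 * (4 * d0 / \<delta> + 2))) * nsq \<xi>"
        if x: "norm x \<le> l" for x
      proof -
        let ?g = "\<lambda>j. coupling L \<epsilon> j x" and ?t = "\<lambda>j. taylor_coupling L \<epsilon> D j x"
        define r where "r j m = ?g j m - ?t j m" for j m
        have rle: "cmod (r j m) \<le> \<bar>amplitude L \<epsilon> j m\<bar> * \<rho>" if "m \<in> ?M" for j m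
          unfolding r_def \<rho>(1) using x modes_less[OF that] l
          by (intro norm_coupling_diff_le mult_mono) auto
        have gn: "cmod (?g j m) = \<bar>amplitude L \<epsilon> j m\<bar>" for j m
          unfolding coupling_def amplitude_def by (simp only: norm_mult norm_of_real norm_cis mult_1_right)
        have r2: "mnsq ?M (r j) \<le> \<rho>\<^sup>2 * (\<Sum>m\<in>?M. (amplitude L \<epsilon> j m)\<^sup>2)" for j
        proof -
          have "mnsq ?M (r j) \<le> (\<Sum>m\<in>?M. (\<bar>amplitude L \<epsilon> j m\<bar> * \<rho>)\<^sup>2)"
            unfolding mnsq_def by (intro sum_mono power_mono rle) auto
          then show ?thesis by (simp add: power_mult_distrib sum_distrib_left mult_ac)
        qed
        \<comment> \<open>Since \<open>\<rho> \<le> 1\<close>, the Taylor coupling is at most twice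
          the amplitude.\<close>
        have t2: "mnsq ?M (?t j) \<le> 4 * (\<Sum>m\<in>?M. (amplitude L \<epsilon> j m)\<^sup>2)" for j
        proof -
          have "mnsq ?M (?t j) \<le> (\<Sum>m\<in>?M. (2 * \<bar>amplitude L \<epsilon> j m\<bar>)\<^sup>2)"
            unfolding mnsq_def
          proof (intro sum_mono power_mono)
            fix m assume m: "m \<in> ?M"
            have "cmod (?t j m) \<le> cmod (?g j m) + cmod (r j m)"
              using norm_triangle_ineq4[of "?g j m" "r j m"] by (simp add: r_def)
            also have "\<dots> \<le> \<bar>amplitude L \<epsilon> j m\<bar> + \<bar>amplitude L \<epsilon> j m\<bar> * 1"
              unfolding gn using rle[OF m, of j] \<rho>(2) mult_left_mono[of \<rho> 1 "\<bar>amplitude L \<epsilon> j m\<bar>"] by linarith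
            finally show "cmod (?t j m) \<le> 2 * \<bar>amplitude L \<epsilon> j m\<bar>" by simp
          qed auto
          then show ?thesis by (simp add: power_mult_distrib sum_distrib_left)
        qed
        define S where "S = (4 * (d0 / \<delta>) + 2) * nsq \<xi>"
        have S: "4 * (\<Sum>m\<in>?M. nsq (Ann m \<xi>)) + 2 * nsq \<xi> \<le> S"
          proof -
          have "S = 4 * (d0 / \<delta> * nsq \<xi>) + 2 * nsq \<xi>" by (simp add: S_def algebra_simps)
          then show ?thesis using number' by linarith
        qed
        have "0 \<le> 4 * (\<Sum>m\<in>?M. nsq (Ann m \<xi>)) + 2 * nsq \<xi>"
          by (intro add_nonneg_nonneg mult_nonneg_nonneg sum_nonneg nsq_nonneg) auto
        with S have S0: "0 \<le> S" by linarith
        have one: "nsq (field_A L \<Lambda> \<epsilon> j x \<xi>) \<le> (16 * \<delta> * nsq \<xi> + 2 * \<rho>\<^sup>2 * S) * (\<Sum>m\<in>?M. (amplitude L \<epsilon> j m)\<^sup>2)" for j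
        proof -
          let ?a = "\<Sum>m\<in>?M. (amplitude L \<epsilon> j m)\<^sup>2"
          have "field_A L \<Lambda> \<epsilon> j x \<xi> = (\<lambda>\<nu>. (aop ?M (?t j) \<xi> \<nu> + cop ?M (?t j) \<xi> \<nu>) + (aop ?M (r j) \<xi> \<nu> + cop ?M (r j) \<xi> \<nu>))"
            unfolding field_A_eq aop_def cop_def r_def by (simp add: sum.distrib sum_subtractf algebra_simps)
          then have "nsq (field_A L \<Lambda> \<epsilon> j x \<xi>) \<le> 2 * nsq (\<lambda>\<nu>. aop ?M (?t j) \<xi> \<nu> + cop ?M (?t j) \<xi> \<nu>) + 2 * nsq (\<lambda>\<nu>. aop ?M (r j) \<xi> \<nu> + cop ?M (r j) \<xi> \<nu>)"
            by (simp only: nsq_add_le finite_supp_add finite_supp_aop finite_supp_cop fs)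
          also have "\<dots> \<le> 2 * (2 * \<delta> * mnsq ?M (?t j) * nsq \<xi>) + 2 * (mnsq ?M (r j) * S)"
            using sq[OF rs, of j x] order_trans[OF nsq_field_le[OF M fs] mult_left_mono[OF S mnsq_nonneg]]
            by (intro add_mono mult_left_mono) auto
          also have "\<dots> \<le> 2 * (2 * \<delta> * (4 * ?a) * nsq \<xi>) + 2 * ((\<rho>\<^sup>2 * ?a) * S)"
            using t2[of j] r2[of j] \<delta> pos S0 by (intro add_mono mult_left_mono mult_right_mono) auto
          finally show ?thesis by (simp add: algebra_simps)
        qed
        have "(\<Sum>j\<in>UNIV. nsq (field_A L \<Lambda> \<epsilon> j x \<xi>)) \<le> (16 * \<delta> * nsq \<xi> + 2 * \<rho>\<^sup>2 * S) * G"
          unfolding G_def sum_distrib_left[of "16 * \<delta> * nsq \<xi> + 2 * \<rho>\<^sup>2 * S"] by (intro sum_mono one[unfolded sum_distrib_left])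
        also have "\<dots> \<le> (16 * \<delta> * nsq \<xi> + 2 * \<rho>\<^sup>2 * S) * \<Lambda>\<^sup>2"
          using G \<delta> pos S0 by (intro mult_left_mono add_nonneg_nonneg mult_nonneg_nonneg) auto
        finally show ?thesis by (simp add: S_def algebra_simps)
      qed
      have adm: "admissible L \<Lambda> (trial l \<xi>)" by (rule admissible_trial[OF l fs]) (rule supported)
      let ?E = "405 / l\<^sup>2 + \<alpha> * (\<Lambda>\<^sup>2 * (16 * \<delta> + 2 * \<rho>\<^sup>2 * (4 * d0 / \<delta> + 2))) + \<Lambda> * (d0 / \<delta>)"
      have N: "norm_sq (trial l \<xi>) = (LINT x|lborel. (bump l x)\<^sup>2) * nsq \<xi>"
        by (rule energy_trial_le(2)[OF L l fs \<alpha> _ \<Lambda> field number']) (rule supported)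
      have Npos: "0 < norm_sq (trial l \<xi>)" unfolding N using pos integral_bump_sq(2)[OF l] by simp
      have "energy_form \<alpha> L \<Lambda> \<epsilon> (trial l \<xi>) \<le> ?E * norm_sq (trial l \<xi>)"
        by (rule energy_trial_le(1)[OF L l fs \<alpha> _ \<Lambda> field number']) (rule supported)
      then have "energy_form \<alpha> L \<Lambda> \<epsilon> (trial l \<xi>) / norm_sq (trial l \<xi>) \<le> ?E"
        using Npos by (simp only: pos_divide_le_eq)
      moreover have "ground_state_energy \<alpha> L \<Lambda> \<epsilon> \<le> ereal (energy_form \<alpha> L \<Lambda> \<epsilon> (trial l \<xi>) / norm_sq (trial l \<xi>))"
        unfolding ground_state_energy_def
      proof (rule INF_lower)
        show "trial l \<xi> \<in> {\<Psi>. admissible L \<Lambda> \<Psi> \<and> norm_sq \<Psi> \<noteq> 0}" using adm Npos by (intro CollectI conjI) auto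
      qed
      ultimately show ?thesis by (meson ereal_less_eq(3) order_trans)
    qed
  qed
qed

text \<open>A single term of the series for \<open>exp (exp 1 * y)\<close> bounds
  \<open>y ^ D / fact D\<close> by \<open>exp (exp 1 * y - D)\<close>. With
  \<open>exp 1 \<le> 3\<close> and \<open>D \<ge> 8 * y\<close> this is
  \<open>exp (- 5 * y)\<close>, and the additional power of \<open>y\<close> costs one more
  \<open>exp y\<close>.\<close>

lemma taylor_remainder_le:
  assumes y: "1 \<le> y" and D: "8 * y \<le> real D"
  shows "y ^ Suc D / fact D \<le> exp (- 4 * y)"
proof -
  have "(exp 1 * y) ^ D / fact D \<le> exp (exp 1 * y)"
  proof -
    have "(exp 1 * y) ^ D / fact D = (\<Sum>n\<in>{D}. (exp 1 * y) ^ n /\<^sub>R fact n)" by (simp add: field_simps)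
    also have "\<dots> \<le> (\<Sum>n. (exp 1 * y) ^ n /\<^sub>R fact n)"
      using y by (intro sum_le_suminf summable_exp_generic) auto
    finally show ?thesis by (simp add: exp_def)
  qed
  moreover have "(exp 1 * y) ^ D = exp (real D) * y ^ D"
    by (simp add: power_mult_distrib exp_of_nat_mult[symmetric])
  ultimately have "exp (real D) * (y ^ D / fact D) \<le> exp (exp 1 * y)" by simp
  then have "y ^ D / fact D \<le> exp (exp 1 * y) / exp (real D)" by (simp add: pos_le_divide_eq mult.commute)
  also have "\<dots> = exp (exp 1 * y - real D)" by (rule exp_diff[symmetric])
  also have "\<dots> \<le> exp (- 5 * y)"
  proof -
    have "exp 1 * y \<le> 3 * y" using exp_le y by (intro mult_right_mono) auto
    then show ?thesis using D by simp
  qed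
  finally have "y ^ D / fact D \<le> exp (- 5 * y)" .
  moreover have "y \<le> exp y" using exp_ge_add_one_self[of y] by linarith
  ultimately have "y * (y ^ D / fact D) \<le> exp y * exp (- 5 * y)"
    using y by (intro mult_mono) auto
  then show ?thesis by (simp add: exp_add[symmetric])
qed

theorem ground_state_energy_upper:
  assumes L: "0 < L" and pol: "valid_polarization L \<epsilon>" and \<alpha>: "0 < \<alpha>"
  shows "\<exists>\<Lambda>0. \<forall>\<Lambda>\<ge>\<Lambda>0. ground_state_energy \<alpha> L \<Lambda> \<epsilon> < ereal (4000 * \<alpha> powr (2/7) * \<Lambda> powr (12/7))"
proof -
  \<comment> \<open>The solution \<open>y\<close> of \<open>\<Lambda> = \<alpha> * y ^ 7\<close>,
    which grows with the cutoff for fixed \<alpha>.\<close>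
  define Y where "Y \<Lambda> = (\<Lambda> / \<alpha>) powr (1/7)" for \<Lambda>
  have Ylim: "filterlim Y at_top at_top" unfolding Y_def using \<alpha> by real_asymp
  \<comment> \<open>This says that the remainder contribution is small compared with \<delta>:
    \<open>exp (- 8 * y)\<close> bounds \<open>\<rho>\<^sup>2\<close>,
    \<open>12000 * \<alpha> * y ^ 5\<close> bounds \<open>4 * d0 / \<delta>\<close>, and
    \<open>\<alpha> * y\<^sup>2\<close> is \<open>1 / \<delta>\<close>.\<close>
  have "((\<lambda>y. 2 * exp (- 8 * y) * (12000 * \<alpha> * y ^ 5 + 2) * (\<alpha> * y\<^sup>2)) \<longlongrightarrow> 0) at_top"
    using \<alpha> by real_asymp
  then have small: "\<forall>\<^sub>F y in at_top. 2 * exp (- 8 * y) * (12000 * \<alpha> * y ^ 5 + 2) * (\<alpha> * y\<^sup>2) < 1"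
    by (rule order_tendstoD) simp
  have big: "\<forall>\<^sub>F y in at_top. 1 \<le> \<alpha> * y\<^sup>2" using \<alpha> by real_asymp
  have evY: "\<forall>\<^sub>F y in at_top. 1 \<le> y \<and> 1 \<le> \<alpha> * y\<^sup>2 \<and> 2 * exp (- 8 * y) * (12000 * \<alpha> * y ^ 5 + 2) * (\<alpha> * y\<^sup>2) < 1"
    using small big eventually_ge_at_top[of 1] by eventually_elim auto
  have ev: "\<forall>\<^sub>F \<Lambda> in at_top. (1 \<le> Y \<Lambda> \<and> 1 \<le> \<alpha> * (Y \<Lambda>)\<^sup>2 \<and>
      2 * exp (- 8 * Y \<Lambda>) * (12000 * \<alpha> * Y \<Lambda> ^ 5 + 2) * (\<alpha> * (Y \<Lambda>)\<^sup>2) < 1) \<and> 0 < \<Lambda> \<and> 4 * pi / L \<le> \<Lambda>"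
    using filterlim_iff[THEN iffD1, OF Ylim, rule_format, OF evY] eventually_gt_at_top[of 0] eventually_ge_at_top[of "4 * pi / L"]
    by eventually_elim auto
  have "ground_state_energy \<alpha> L \<Lambda> \<epsilon> < ereal (4000 * \<alpha> powr (2/7) * \<Lambda> powr (12/7))"
    if y1: "1 \<le> Y \<Lambda>" and \<alpha>y: "1 \<le> \<alpha> * (Y \<Lambda>)\<^sup>2"
      and sm: "2 * exp (- 8 * Y \<Lambda>) * (12000 * \<alpha> * Y \<Lambda> ^ 5 + 2) * (\<alpha> * (Y \<Lambda>)\<^sup>2) < 1"
      and \<Lambda>: "0 < \<Lambda>" and \<Lambda>L: "4 * pi / L \<le> \<Lambda>" for \<Lambda>
  proof -
    define y where "y = Y \<Lambda>"
    have y: "1 \<le> y" "0 < y" using y1 by (auto simp: y_def)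
    have \<Lambda>y: "\<Lambda> = \<alpha> * y ^ 7"
    proof -
      have "y ^ 7 = \<Lambda> / \<alpha>"
        using \<Lambda> \<alpha> by (simp add: y_def Y_def powr_realpow[symmetric] powr_powr)
      then show ?thesis using \<alpha> by simp
    qed
    have target: "\<alpha> powr (2/7) * \<Lambda> powr (12/7) = \<alpha>\<^sup>2 * y ^ 12"
    proof -
      have "\<Lambda> powr (12/7) = \<alpha> powr (12/7) * y ^ 12"
      proof -
        have "y ^ 7 = y powr 7" using y by simp
        then have "(y ^ 7) powr (12/7) = y powr 12" by (simp only: powr_powr) simp
        also have "\<dots> = y ^ 12" using y by simp
        finally show ?thesis unfolding \<Lambda>y using \<alpha> y by (simp add: powr_mult)
      qed
      moreover have "\<alpha> powr (2/7) * \<alpha> powr (12/7) = \<alpha>\<^sup>2"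
      proof -
        have "\<alpha> powr (2/7) * \<alpha> powr (12/7) = \<alpha> powr 2" by (simp add: powr_add[symmetric])
        then show ?thesis using \<alpha> by simp
      qed
      ultimately show ?thesis by (simp only: mult.assoc[symmetric])
    qed
    define l where "l = y / \<Lambda>"
    define \<delta> where "\<delta> = 1 / (\<alpha> * y\<^sup>2)"
    \<comment> \<open>Large enough for the remainder \<open>exp (- 4 * y)\<close>, and small enough
      that \<open>D + 1 \<le> 8 * y + 2 \<le> 10 * y\<close>, which bounds the dimension by
      \<open>3000 * y ^ 3\<close>.\<close>
    define D where "D = nat \<lceil>8 * y\<rceil>"
    define \<rho> where "\<rho> = (l * \<Lambda>) ^ Suc D / fact D"
    define d0 where "d0 = 3 * real (D + 1) ^ 3"
    have l: "0 < l" using \<Lambda> y by (simp add: l_def)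
    have \<delta>: "0 < \<delta>" "\<delta> \<le> 1" using \<alpha> y \<alpha>y by (auto simp: \<delta>_def y_def pos_divide_le_eq)
    have D1: "8 * y \<le> real D" and D2: "real (D + 1) \<le> 10 * y"
      unfolding D_def using y by linarith+
    have \<rho>le: "\<rho> \<le> exp (- 4 * y)"
      unfolding \<rho>_def l_def using \<Lambda> taylor_remainder_le[OF y(1) D1] by simp
    have \<rho>0: "0 \<le> \<rho>" using l \<Lambda> by (simp add: \<rho>_def)
    have "exp (- 4 * y) \<le> 1" using y by simp
    then have \<rho>1: "\<rho> \<le> 1" using \<rho>le by linarith
    have \<rho>2: "\<rho>\<^sup>2 \<le> exp (- 8 * y)"
    proof -
      have "\<rho>\<^sup>2 \<le> (exp (- 4 * y))\<^sup>2" using \<rho>le \<rho>0 by (intro power_mono)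
      also have "\<dots> = exp (- 8 * y)" by (simp add: power2_eq_square exp_add[symmetric])
      finally show ?thesis .
    qed
    have d0: "d0 \<le> 3000 * y ^ 3"
    proof -
      have "real (D + 1) ^ 3 \<le> (10 * y) ^ 3" using D2 by (intro power_mono) auto
      then show ?thesis by (simp add: d0_def power_mult_distrib)
    qed
    have d0\<delta>: "d0 / \<delta> \<le> 3000 * \<alpha> * y ^ 5"
    proof -
      have "d0 / \<delta> = d0 * (\<alpha> * y\<^sup>2)" by (simp add: \<delta>_def)
      also have "\<dots> \<le> 3000 * y ^ 3 * (\<alpha> * y\<^sup>2)" using d0 \<alpha> by (intro mult_right_mono) auto
      also have "\<dots> = 3000 * \<alpha> * y ^ 5" by (simp add: power_add[symmetric] mult_ac eval_nat_numeral)
      finally show ?thesis .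
    qed
    have card: "(\<Lambda> * L / (8 * pi)) ^ 3 \<le> real (card (modes L \<Lambda>))"
      using \<Lambda>L L by (intro card_modes_lower[OF L]) (simp add: pos_divide_le_eq)
    moreover have "0 < (\<Lambda> * L / (8 * pi)) ^ 3" using L \<Lambda> by simp
    ultimately have ne: "modes L \<Lambda> \<noteq> {}" by auto
    define T where "T = \<alpha>\<^sup>2 * y ^ 12"
    have T: "0 < T" using \<alpha> y by (simp add: T_def)
    have T1: "405 / l\<^sup>2 = 405 * T"
      using \<alpha> y unfolding T_def l_def \<Lambda>y by (simp add: power_mult_distrib power_divide field_simps power_add[symmetric] power_mult[symmetric])
    have T2: "\<alpha> * (\<Lambda>\<^sup>2 * (16 * \<delta> + 2 * \<rho>\<^sup>2 * (4 * d0 / \<delta> + 2))) \<le> 17 * T"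
    proof -
      have "2 * \<rho>\<^sup>2 * (4 * d0 / \<delta> + 2) \<le> 2 * exp (- 8 * y) * (12000 * \<alpha> * y ^ 5 + 2)"
        using \<rho>2 d0\<delta> \<delta> by (intro mult_mono) (auto simp: d0_def)
      also have "\<dots> \<le> \<delta>"
        using sm \<alpha> y unfolding \<delta>_def y_def[symmetric] by (simp add: pos_le_divide_eq)
      finally have "16 * \<delta> + 2 * \<rho>\<^sup>2 * (4 * d0 / \<delta> + 2) \<le> 17 * \<delta>" by simp
      then have "\<alpha> * (\<Lambda>\<^sup>2 * (16 * \<delta> + 2 * \<rho>\<^sup>2 * (4 * d0 / \<delta> + 2))) \<le> \<alpha> * (\<Lambda>\<^sup>2 * (17 * \<delta>))"
        using \<alpha> by (intro mult_left_mono) auto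
      also have "\<dots> = 17 * T"
        using \<alpha> y unfolding T_def \<delta>_def \<Lambda>y by (simp add: power_mult_distrib field_simps power_add[symmetric] power_mult[symmetric])
      finally show ?thesis .
    qed
    have T3: "\<Lambda> * (d0 / \<delta>) \<le> 3000 * T"
    proof -
      have "\<Lambda> * (d0 / \<delta>) \<le> \<Lambda> * (3000 * \<alpha> * y ^ 5)" using d0\<delta> \<Lambda> by (intro mult_left_mono) auto
      also have "\<dots> = 3000 * T" unfolding T_def \<Lambda>y by (simp add: power2_eq_square power_add[symmetric] mult_ac)
      finally show ?thesis .
    qed
    have "ground_state_energy \<alpha> L \<Lambda> \<epsilon> \<le>
      ereal (405 / l\<^sup>2 + \<alpha> * (\<Lambda>\<^sup>2 * (16 * \<delta> + 2 * \<rho>\<^sup>2 * (4 * d0 / \<delta> + 2))) + \<Lambda> * (d0 / \<delta>))"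
      by (rule ground_state_energy_le[OF L pol ne \<alpha> l \<delta> \<rho>_def \<rho>1 d0_def[symmetric]])
    \<comment> \<open>Localization contributes 405, the field 17 and the photons 3000 multiples of
      \<open>T\<close>, in total less than 4000.\<close>
    also have "\<dots> < ereal (4000 * T)"
      unfolding less_ereal.simps T1 using T2 T3 T by linarith
    finally show ?thesis by (simp add: T_def target mult.assoc)
  qed
  with ev show ?thesis unfolding eventually_at_top_linorder by (meson order_refl)
qed

theorem theorem1:
  shows "\<forall>L>0. \<forall>\<epsilon>. valid_polarization L \<epsilon> \<longrightarrow>
    (\<exists>C1>0. \<exists>C2>0. \<forall>\<alpha>>0. \<exists>\<Lambda>0. \<forall>\<Lambda>\<ge>\<Lambda>0.
       ereal (C1 * \<alpha> powr (1/2) * \<Lambda> powr (3/2)) < ground_state_energy \<alpha> L \<Lambda> \<epsilon> \<and>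
       ground_state_energy \<alpha> L \<Lambda> \<epsilon> < ereal (C2 * \<alpha> powr (2/7) * \<Lambda> powr (12/7)))"
proof (intro allI impI)
  fix L :: real and \<epsilon> :: "nat \<Rightarrow> real^3 \<Rightarrow> real^3"
  assume L: "0 < L" and pol: "valid_polarization L \<epsilon>"
  from ground_state_energy_lower[OF L pol] obtain C where C: "0 < C"
    and low: "\<forall>\<alpha>>0. \<exists>\<Lambda>0. \<forall>\<Lambda>\<ge>\<Lambda>0. ereal (C * \<alpha> powr (1/2) * \<Lambda> powr (3/2)) < ground_state_energy \<alpha> L \<Lambda> \<epsilon>"
    by (elim exE conjE)
  have main: "\<exists>\<Lambda>0. \<forall>\<Lambda>\<ge>\<Lambda>0. ereal (C * \<alpha> powr (1/2) * \<Lambda> powr (3/2)) < ground_state_energy \<alpha> L \<Lambda> \<epsilon> \<and>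
      ground_state_energy \<alpha> L \<Lambda> \<epsilon> < ereal (4000 * \<alpha> powr (2/7) * \<Lambda> powr (12/7))" if \<alpha>: "0 < \<alpha>" for \<alpha>
  proof -
    from low \<alpha> obtain \<Lambda>1 where
      "\<forall>\<Lambda>\<ge>\<Lambda>1. ereal (C * \<alpha> powr (1/2) * \<Lambda> powr (3/2)) < ground_state_energy \<alpha> L \<Lambda> \<epsilon>" by blast
    moreover from ground_state_energy_upper[OF L pol \<alpha>] obtain \<Lambda>2 where
      "\<forall>\<Lambda>\<ge>\<Lambda>2. ground_state_energy \<alpha> L \<Lambda> \<epsilon> < ereal (4000 * \<alpha> powr (2/7) * \<Lambda> powr (12/7))" by blast
    ultimately show ?thesis by (intro exI[of _ "max \<Lambda>1 \<Lambda>2"]) simp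
  qed
  show "\<exists>C1>0. \<exists>C2>0. \<forall>\<alpha>>0. \<exists>\<Lambda>0. \<forall>\<Lambda>\<ge>\<Lambda>0.
       ereal (C1 * \<alpha> powr (1/2) * \<Lambda> powr (3/2)) < ground_state_energy \<alpha> L \<Lambda> \<epsilon> \<and>
       ground_state_energy \<alpha> L \<Lambda> \<epsilon> < ereal (C2 * \<alpha> powr (2/7) * \<Lambda> powr (12/7))"
  proof (rule exI[of _ C], rule conjI[OF C], rule exI[of _ "4000 :: real"], rule conjI)
    show "(0 :: real) < 4000" by simp
  qed (use main in blast)
qed

end
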